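(* Consider the generalized Riemann problem for the 1D ten-moment equations with source, in the nonsonic case, with the local configuration: 1-rarefaction wave, 2-shear wave, contact discontinuity, 5-shear wave, 6-shock wave. In the domain between the 1-rarefaction wave and the 6-shock wave one has $$\left(\tfrac{\mathcal D u_1}{\mathcal D t}\right)_\ast=\frac{d_1b_2-d_2b_1}{a_1b_2-a_2b_1},\qquad \left(\tfrac{\mathcal D p_{11}}{\mathcal D t}\right)_\ast=\frac{d_1a_2-d_2a_1}{a_2b_1-a_1b_2},$$ with $a_i,b_i,d_i$ as defined in the context. Consequently, for $K=L,R$, $$\left(\tfrac{\partial u_1}{\partial t}\right)_{\ast K}=\frac{u_{1,\ast}}{3p_{11,\ast}}\left(\tfrac{\mathcal D p_{11}}{\mathcal D t}\right)_\ast+\left(\tfrac{\mathcal D u_1}{\mathcal D t}\right)_\ast,$$ $$\left(\tfrac{\partial p_{11}}{\partial t}\right)_{\ast K}=\left(\tfrac{\mathcal D p_{11}}{\mathcal D t}\right)_\ast+\rho_{\ast K}u_{1,\ast}\left(\tfrac{\mathcal D u_1}{\mathcal D t}\right)_\ast+\tfrac12\rho_{\ast K}u_{1,\ast}W_x(0).$$ Moreover $$\left(\tfrac{\partial\rho}{\partial t}\right)_{\ast L}=\frac1{c_{\ast L}^2}\left[\left(\tfrac{\partial p_{11}}{\partial t}\right)_{\ast L}+\rho_L^2S_{1,L}'\,\rho_{\ast L}u_{1,\ast}\frac{c_{\ast L}^3}{c_L^3}\right],$$ and $\left(\frac{\partial\rho}{\partial t}\right)_{\ast R}$ satisfies $$g_\rho^R\left(\tfrac{\partial\rho}{\partial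 t}\right)_{\ast R}+g_{u_1}^R\left(\tfrac{\mathcal D u_1}{\mathcal D t}\right)_\ast+g_{p_{11}}^R\left(\tfrac{\mathcal D p_{11}}{\mathcal D t}\right)_\ast=u_{1,\ast}f_R,$$ where $$g_\rho^R=u_{1,\ast}-\sigma_R,\quad g_{u_1}^R=\rho_{\ast R}u_{1,\ast}(\sigma_R-u_{1,\ast})H_1^R,\quad g_{p_{11}}^R=\frac{\sigma_R}{c_{\ast R}^2}-u_{1,\ast}H_1^R,$$ $$f_R=(\sigma_R-u_{1,R})H_2^Rp_{11,R}'+(\sigma_R-u_{1,R})H_3^R\rho_R'-\rho_R(H_3^R+c_R^2H_2^R)u_{1,R}'-\tfrac12\rho_{\ast R}(\sigma_R-u_{1,\ast})W_x(0)H_1^R.$$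
   Context: **System.** $\mathbf V=(\rho,u_1,u_2,p_{11},p_{12},p_{22})^\top$ with $\rho>0$, $p_{11}>0$, $p_{11}p_{22}-p_{12}^2>0$; $W(x)$ is a given potential, $W_x=dW/dx$; $c=\sqrt{3p_{11}/\rho}$; $\frac{\mathcal D}{\mathcal D t}=\partial_t+u_1\partial_x$. With $E_{ij}=\frac12(\rho u_iu_j+p_{ij})$, $\mathbf U=(\rho,\rho u_1,\rho u_2,E_{11},E_{12},E_{22})^\top$, the equations are $\partial_t\mathbf U+\partial_x\mathbf F=\mathbf S$, $\mathbf F=(\rho u_1,\rho u_1^2+p_{11},\rho u_1u_2+p_{12},(E_{11}+p_{11})u_1,E_{12}u_1+\frac12(p_{11}u_2+p_{12}u_1),E_{22}u_1+p_{12}u_2)^\top$, $\mathbf S=(0,-\frac12\rho W_x,0,-\frac12\rho u_1W_x,-\frac14\rho u_2W_x,0)^\top$. For smooth solutions this is: $\frac{\mathcal D\rho}{\mathcal D t}+\rho\partial_xu_1=0$; $\frac{\mathcal D u_1}{\mathcal D t}+\frac1\rho\partial_xp_{11}=-\frac12W_x$; $\frac{\mathcal D u_2}{\mathcal D t}+\frac1\rho\partial_xp_{12}=0$; $\frac{\mathcal D p_{11}}{\mathcal D t}+3p_{11}\partial_xu_1=0$; $\frac{\mathcal D p_{12}}{\mathcal D t}+2p_{12}\partial_xu_1+p_{11}\partial_xu_2=0$; $\frac{\mathcal D p_{22}}{\mathcal D t}+p_{22}\partial_xu_1+2p_{12}\partial_xu_2=0$. Discontinuities satisfy the Rankine–Hugoniot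 conditions. **Generalized Riemann problem (GRP).** Initial data $\mathbf V(x,0)=\mathbf V_L+x\mathbf V_L'$ for $x<0$ and $\mathbf V_R+x\mathbf V_R'$ for $x>0$, with constant vectors $\mathbf V_K=(\rho_K,u_{1,K},u_{2,K},p_{11,K},p_{12,K},p_{22,K})^\top$, $\mathbf V_K'=(\rho_K',u_{1,K}',u_{2,K}',p_{11,K}',p_{12,K}',p_{22,K}')^\top$. Near $(0,0)$, $0<t\ll1$, the solution is piecewise smooth; from left to right there are a 1-rarefaction wave (field $u_1-c$), a 2-shear curve (speed $u_1-c/\sqrt3$), a contact curve (speed $u_1$), a 5-shear curve (speed $u_1+c/\sqrt3$) and a 6-shock. The four regions between consecutive waves are labelled $\ast L,\ast\ast L,\ast\ast R,\ast R$. In these, and to the left of the fan and right of the shock, $\mathbf V$ and its first derivatives have limits at $(0,0)$; a region subscript on a derivative denotes that limit. The limiting states have common $u_{1,\ast},p_{11,\ast}$ in the four middle regions, density $\rho_{\ast L}$ in $\ast L,\ast\ast L$ and $\rho_{\ast R}$ in $\ast R,\ast\ast R$; $c_{\ast K}=\sqrt{3p_{11,\ast}/\rho_{\ast K}}$. The limits of $\frac{\mathcal D u_1}{\mathcal D t}$ and $\frac{\mathcal D p_{11}}{\mathcal D t}$ are the same in the four middle regions and are denoted by the subscript $\ast$; $\partial_tu_1,\partial_tp_{11},\partial_t\rho$ have the same limits in $\ast K$ and $\ast\ast K$. Nonsonic: the $t$-axis lies between the 1-wave and the 6-wave. $\mathbf V$ is continuous across the head and the tail of the fan. $\rho,u_1,p_{11}$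 are continuous across the shear curves, $u_1,p_{11}$ across the contact. **Fan.** The 1-rarefaction region is parametrized by characteristic coordinates $(\alpha,\beta)$, $-\alpha_0\le\alpha\le0$, $\beta_L\le\beta\le\beta_{\ast L}$, $\beta_L=u_{1,L}-c_L$, $\beta_{\ast L}=u_{1,\ast}-c_{\ast L}$: curves $\beta=$ const are integral curves of $dx/dt=u_1-c$ leaving the origin with slope $\beta$, curves $\alpha=$ const are integral curves of $dx/dt=u_1+c$, and $\alpha=0$ is the origin. $x,t,\mathbf V$ are smooth functions of $(\alpha,\beta)$, $\partial t/\partial\alpha\ne0$. The invariants $\psi_1=u_1+c$, $S_1=p_{11}/\rho^3$ and their first $x$- and $t$-derivatives are continuous functions of $(\alpha,\beta)$ up to $\alpha=0$, where $\psi_1,S_1$ take their $\mathbf V_L$ values. **Left coefficients.** $c_L=\sqrt{3p_{11,L}/\rho_L}$, $\psi_{1,L}=u_{1,L}+c_L$, $S_{1,L}'=\frac1{\rho_L^3}(p_{11,L}'-c_L^2\rho_L')$, $\psi_{1,L}'=u_{1,L}'+\frac{p_{11,L}'}{\rho_Lc_L}+\frac{\rho_L^2}{2c_L}S_{1,L}'$; $a_1=1+\frac{u_{1,\ast}}{c_{\ast L}}$, $b_1=\frac{u_{1,\ast}}{3p_{11,\ast}}+\frac1{\rho_{\ast L}c_{\ast L}}$, $d_1=\left[\frac{\rho_L^2S_{1,L}'}{8c_L^3}(3c_L^2+c_{\ast L}^2)-\psi_{1,L}'\right]\psi_{1,L}-\frac12\left(1+\frac{u_{1,\ast}}{c_{\ast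 L}}\right)W_x(0)$. **Right coefficients.** $c_R=\sqrt{3p_{11,R}/\rho_R}$; the shock has $p_{11,\ast}>p_{11,R}$ and initial speed $\sigma_R=u_{1,R}+\sqrt{(2p_{11,\ast}+p_{11,R})/\rho_R}$. Let $\Lambda=[\rho_R(2p_{11,\ast}+p_{11,R})]^{-1/2}$, $\Phi_1^R=\frac{p_{11,\ast}+2p_{11,R}}{2p_{11,\ast}+p_{11,R}}\Lambda$, $\Phi_2^R=-\frac{5p_{11,\ast}+p_{11,R}}{4p_{11,\ast}+2p_{11,R}}\Lambda$, $\Phi_3^R=\frac{p_{11,R}-p_{11,\ast}}{2\rho_R}\Lambda$; $a_2=1-\rho_{\ast R}(u_{1,\ast}-\sigma_R)\Phi_1^R$, $b_2=\frac{u_{1,\ast}-\sigma_R}{3p_{11,\ast}}-\Phi_1^R$, $d_2=L_\rho^R\rho_R'+L_{u_1}^Ru_{1,R}'+L_{p_{11}}^Rp_{11,R}'-\frac12W_x(0)L_W^R$, with $L_\rho^R=(\sigma_R-u_{1,R})\Phi_3^R$, $L_{u_1}^R=\sigma_R-u_{1,R}-3p_{11,R}\Phi_2^R-\rho_R\Phi_3^R$, $L_{p_{11}}^R=-\frac1{\rho_R}+(\sigma_R-u_{1,R})\Phi_2^R$, $L_W^R=1-\rho_{\ast R}(u_{1,\ast}-\sigma_R)\Phi_1^R$. $H_1^R=\frac{3\rho_Rp_{11,R}}{(p_{11,\ast}+2p_{11,R})^2}$, $H_2^R=-\frac{3\rho_Rp_{11,\ast}}{(p_{11,\ast}+2p_{11,R})^2}$,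 $H_3^R=\frac{2p_{11,\ast}+p_{11,R}}{p_{11,\ast}+2p_{11,R}}$.
   Formalization: The two quotient formulas for the material derivatives are claimed only when a_1b_2 - a_2b_1 is nonzero; it vanishes exactly when u_{1,*} + c_{*L} = 0, a possible nonsonic case in which both quotients read 0/0. *)

theory Defs
  imports "HOL-Analysis.Analysis"
begin

section \<open>The one-dimensional ten-moment system\<close>

text \<open>A state is the primitive vector (rho, u1, u2, p11, p12, p22). In the index type 6 the
  numeral 6 is the element 0, so the six components below are distinct and exhaustive.\<close>

abbreviation rho :: "real^6 \<Rightarrow> real" where "rho v \<equiv> v $ 1"
abbreviation u1 :: "real^6 \<Rightarrow> real" where "u1 v \<equiv> v $ 2"
abbreviation u2 :: "real^6 \<Rightarrow> real" where "u2 v \<equiv> v $ 3"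
abbreviation p11 :: "real^6 \<Rightarrow> real" where "p11 v \<equiv> v $ 4"
abbreviation p12 :: "real^6 \<Rightarrow> real" where "p12 v \<equiv> v $ 5"
abbreviation p22 :: "real^6 \<Rightarrow> real" where "p22 v \<equiv> v $ 6"

definition admissible :: "real^6 \<Rightarrow> bool" where
  "admissible v \<longleftrightarrow> rho v > 0 \<and> p11 v > 0 \<and> p11 v * p22 v - (p12 v)\<^sup>2 > 0"

definition E11 :: "real^6 \<Rightarrow> real" where "E11 v = (rho v * u1 v * u1 v + p11 v) / 2"
definition E12 :: "real^6 \<Rightarrow> real" where "E12 v = (rho v * u1 v * u2 v + p12 v) / 2"
definition E22 :: "real^6 \<Rightarrow> real" where "E22 v = (rho v * u2 v * u2 v + p22 v) / 2"

definition cons :: "real^6 \<Rightarrow> real^6" where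
  "cons v = vector [rho v, rho v * u1 v, rho v * u2 v, E11 v, E12 v, E22 v]"

definition flux :: "real^6 \<Rightarrow> real^6" where
  "flux v = vector
     [rho v * u1 v,
      rho v * (u1 v)\<^sup>2 + p11 v,
      rho v * u1 v * u2 v + p12 v,
      (E11 v + p11 v) * u1 v,
      E12 v * u1 v + (p11 v * u2 v + p12 v * u1 v) / 2,
      E22 v * u1 v + p12 v * u2 v]"

text \<open>The argument w is the value of the derivative of the potential.\<close>

definition source :: "real \<Rightarrow> real^6 \<Rightarrow> real^6" where
  "source w v = vector
     [0, - (1/2) * rho v * w, 0, - (1/2) * rho v * u1 v * w, - (1/4) * rho v * u2 v * w, 0]"

definition sound :: "real^6 \<Rightarrow> real" where "sound v = sqrt (3 * p11 v / rho v)"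
definition psi1 :: "real^6 \<Rightarrow> real" where "psi1 v = u1 v + sound v"
definition S1 :: "real^6 \<Rightarrow> real" where "S1 v = p11 v / rho v ^ 3"

definition rankine_hugoniot :: "real \<Rightarrow> real^6 \<Rightarrow> real^6 \<Rightarrow> bool" where
  "rankine_hugoniot s v w \<longleftrightarrow> flux w - flux v = s *\<^sub>R (cons w - cons v)"


section \<open>Calculus in the plane\<close>

text \<open>Points of space-time are pairs (x, t).\<close>

definition pdx :: "(real \<times> real \<Rightarrow> 'a::real_normed_vector) \<Rightarrow> real \<times> real \<Rightarrow> 'a" where
  "pdx f z = vector_derivative (\<lambda>x. f (x, snd z)) (at (fst z))"

definition pdt :: "(real \<times> real \<Rightarrow> 'a::real_normed_vector) \<Rightarrow> real \<times> real \<Rightarrow> 'a" where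
  "pdt f z = vector_derivative (\<lambda>t. f (fst z, t)) (at (snd z))"

text \<open>Classes C^k on a set that need not be open (derivatives are taken within the set), used
  for smoothness up to the boundary.\<close>

primrec Ck_on :: "nat \<Rightarrow> (real \<times> real) set \<Rightarrow> (real \<times> real \<Rightarrow> 'a::real_normed_vector) \<Rightarrow> bool" where
  "Ck_on 0 A f \<longleftrightarrow> continuous_on A f"
| "Ck_on (Suc k) A f \<longleftrightarrow>
     (\<exists>f1 f2. (\<forall>z\<in>A. (f has_derivative (\<lambda>h. fst h *\<^sub>R f1 z + snd h *\<^sub>R f2 z)) (at z within A))
        \<and> Ck_on k A f1 \<and> Ck_on k A f2)"


section \<open>Local wave configuration\<close>

text \<open>The curves are the head and the tail of the 1-rarefaction fan, the 2-shear curve, the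
  contact, the 5-shear curve and the 6-shock; the regions are the seven pieces they cut out, from
  left to right.\<close>

datatype curve = Head | Tail | Shear2 | Contact | Shear5 | Shock6

datatype region = Lft | Fan | StarL | StarStarL | StarStarR | StarR | Rgt

definition middle :: "region set" where
  "middle = {StarL, StarStarL, StarStarR, StarR}"

primrec left_of :: "curve \<Rightarrow> region" where
  "left_of Head = Lft"
| "left_of Tail = Fan"
| "left_of Shear2 = StarL"
| "left_of Contact = StarStarL"
| "left_of Shear5 = StarStarR"
| "left_of Shock6 = StarR"

primrec right_of :: "curve \<Rightarrow> region" where
  "right_of Head = Fan"
| "right_of Tail = StarL"
| "right_of Shear2 = StarStarL"
| "right_of Contact = StarStarR"
| "right_of Shear5 = StarR"
| "right_of Shock6 = Rgt"

text \<open>Section at time t of each piece of the strip -delta < x < delta. The bounding curves belong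
  to the pieces on both sides.\<close>

primrec slice :: "(curve \<Rightarrow> real \<Rightarrow> real) \<Rightarrow> real \<Rightarrow> real \<Rightarrow> region \<Rightarrow> real set" where
  "slice X \<delta> t Lft = {-\<delta> <.. X Head t}"
| "slice X \<delta> t Fan = {X Head t .. X Tail t}"
| "slice X \<delta> t StarL = {X Tail t .. X Shear2 t}"
| "slice X \<delta> t StarStarL = {X Shear2 t .. X Contact t}"
| "slice X \<delta> t StarStarR = {X Contact t .. X Shear5 t}"
| "slice X \<delta> t StarR = {X Shear5 t .. X Shock6 t}"
| "slice X \<delta> t Rgt = {X Shock6 t ..< \<delta>}"

definition piece :: "(curve \<Rightarrow> real \<Rightarrow> real) \<Rightarrow> real \<Rightarrow> real \<Rightarrow> region \<Rightarrow> (real \<times> real) set" where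
  "piece X \<delta> T r = {(x, t). 0 < t \<and> t < T \<and> x \<in> slice X \<delta> t r}"

text \<open>The solution is given on the neighbourhood |x| < delta, 0 < t < T of the origin.
  \<^item> X, sp: the curves x = X j t and their speeds.
  \<^item> V r: the solution in region r, extended to the bounding curves by its one-sided traces; thus
    at a curve j the two traces are V (left_of j) and V (right_of j).
  \<^item> V0 r, Vx0 r, Vt0 r: the limits at the origin, from inside region r (not the fan), of the
    solution and of its x- and t-derivative.
    That V0 and Vx0 agree with the initial data in the outer regions is a consequence of the initial
    condition and is not assumed.
  \<^item> us, ps, rsL, rsR: the common limits of u1 and p11 in the middle regions and the limits of the
    density on the two sides of the contact; Du, Dp: the common limits in the middle regions of the
    material derivatives of u1 and p11.
  \<^item> xx, tt, Vh: position, time and state in the closed fan as functions of the characteristic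
    coordinates, on the rectangle -alpha0 <= alpha <= 0, betaL <= beta <= betasL.
    The edge alpha = 0 is the origin, so there Vh is multivalued as a function of (x, t).\<close>

locale grp_configuration =
  fixes W :: "real \<Rightarrow> real"
    and VL VL' VR VR' :: "real^6"
    and \<delta> T :: real
    and X sp :: "curve \<Rightarrow> real \<Rightarrow> real"
    and V :: "region \<Rightarrow> real \<times> real \<Rightarrow> real^6"
    and V0 Vx0 Vt0 :: "region \<Rightarrow> real^6"
    and us ps rsL rsR Du Dp \<sigma>R :: real
    and \<alpha>0 :: real
    and xx tt :: "real \<times> real \<Rightarrow> real"
    and Vh :: "real \<times> real \<Rightarrow> real^6"
    and \<beta>L \<beta>sL :: real
    and rect :: "(real \<times> real) set"
  defines "\<beta>L \<equiv> u1 VL - sound VL"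
    and "\<beta>sL \<equiv> us - sqrt (3 * ps / rsL)"
    and "rect \<equiv> {-\<alpha>0..0} \<times> {\<beta>L..\<beta>sL}"
  assumes potential: "W differentiable_on UNIV" "continuous_on UNIV (deriv W)"
    and data_admissible: "admissible VL" "admissible VR"
    and domain_pos: "\<delta> > 0" "T > 0"
    and initial_left:
      "\<And>x. -\<delta> < x \<Longrightarrow> x < 0 \<Longrightarrow> ((\<lambda>t. V Lft (x, t)) \<longlongrightarrow> VL + x *\<^sub>R VL') (at_right 0)"
    and initial_right:
      "\<And>x. 0 < x \<Longrightarrow> x < \<delta> \<Longrightarrow> ((\<lambda>t. V Rgt (x, t)) \<longlongrightarrow> VR + x *\<^sub>R VR') (at_right 0)"
    and curve_C1:
      "\<And>j t. t \<in> {0..<T} \<Longrightarrow> (X j has_real_derivative sp j t) (at t within {0..<T})"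
      "\<And>j. continuous_on {0..<T} (sp j)"
    and curve_origin: "\<And>j. X j 0 = 0"
    and curve_order:
      "\<And>t. 0 < t \<Longrightarrow> t < T \<Longrightarrow> -\<delta> < X Head t \<and> X Head t < X Tail t \<and> X Tail t < X Shear2 t
         \<and> X Shear2 t < X Contact t \<and> X Contact t < X Shear5 t \<and> X Shear5 t < X Shock6 t
         \<and> X Shock6 t < \<delta>"
    and nonsonic: "\<And>t. 0 < t \<Longrightarrow> t < T \<Longrightarrow> X Tail t < 0 \<and> 0 < X Shock6 t"
    and smooth: "\<And>r. Ck_on 1 (piece X \<delta> T r) (V r)"
    and state_admissible: "\<And>r z. z \<in> piece X \<delta> T r \<Longrightarrow> admissible (V r z)"
    and equations:
      "\<And>r z. z \<in> interior (piece X \<delta> T r) \<Longrightarrow>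
         pdt (\<lambda>y. cons (V r y)) z + pdx (\<lambda>y. flux (V r y)) z = source (deriv W (fst z)) (V r z)"
    and fan_continuous:
      "\<And>j t. j \<in> {Head, Tail} \<Longrightarrow> 0 < t \<Longrightarrow> t < T \<Longrightarrow>
         V (left_of j) (X j t, t) = V (right_of j) (X j t, t)"
    and jump_conditions:
      "\<And>j t. j \<in> {Shear2, Contact, Shear5, Shock6} \<Longrightarrow> 0 < t \<Longrightarrow> t < T \<Longrightarrow>
         rankine_hugoniot (sp j t) (V (left_of j) (X j t, t)) (V (right_of j) (X j t, t))"
    and shear_continuous:
      "\<And>j t. j \<in> {Shear2, Shear5} \<Longrightarrow> 0 < t \<Longrightarrow> t < T \<Longrightarrow>
         rho (V (left_of j) (X j t, t)) = rho (V (right_of j) (X j t, t))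
         \<and> u1 (V (left_of j) (X j t, t)) = u1 (V (right_of j) (X j t, t))
         \<and> p11 (V (left_of j) (X j t, t)) = p11 (V (right_of j) (X j t, t))"
    and contact_continuous:
      "\<And>t. 0 < t \<Longrightarrow> t < T \<Longrightarrow>
         u1 (V StarStarL (X Contact t, t)) = u1 (V StarStarR (X Contact t, t))
         \<and> p11 (V StarStarL (X Contact t, t)) = p11 (V StarStarR (X Contact t, t))"
    and shear_contact_speeds:
      "\<And>t. 0 < t \<Longrightarrow> t < T \<Longrightarrow>
         sp Shear2 t = u1 (V StarL (X Shear2 t, t)) - sound (V StarL (X Shear2 t, t)) / sqrt 3
         \<and> sp Contact t = u1 (V StarStarL (X Contact t, t))
         \<and> sp Shear5 t = u1 (V StarR (X Shear5 t, t)) + sound (V StarR (X Shear5 t, t)) / sqrt 3"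
    and limits:
      "\<And>r. r \<noteq> Fan \<Longrightarrow> (V r \<longlongrightarrow> V0 r) (at (0, 0) within piece X \<delta> T r)"
      "\<And>r. r \<noteq> Fan \<Longrightarrow> (pdx (V r) \<longlongrightarrow> Vx0 r) (at (0, 0) within interior (piece X \<delta> T r))"
      "\<And>r. r \<noteq> Fan \<Longrightarrow> (pdt (V r) \<longlongrightarrow> Vt0 r) (at (0, 0) within interior (piece X \<delta> T r))"
    and middle_states:
      "\<And>r. r \<in> middle \<Longrightarrow> admissible (V0 r) \<and> u1 (V0 r) = us \<and> p11 (V0 r) = ps"
      "rho (V0 StarL) = rsL" "rho (V0 StarStarL) = rsL"
      "rho (V0 StarStarR) = rsR" "rho (V0 StarR) = rsR"
    and middle_material:
      "\<And>r. r \<in> middle \<Longrightarrow>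
         ((\<lambda>z. u1 (pdt (V r) z) + u1 (V r z) * u1 (pdx (V r) z)) \<longlongrightarrow> Du)
           (at (0, 0) within interior (piece X \<delta> T r))"
      "\<And>r. r \<in> middle \<Longrightarrow>
         ((\<lambda>z. p11 (pdt (V r) z) + u1 (V r z) * p11 (pdx (V r) z)) \<longlongrightarrow> Dp)
           (at (0, 0) within interior (piece X \<delta> T r))"
    and middle_time_derivatives:
      "rho (Vt0 StarL) = rho (Vt0 StarStarL) \<and> u1 (Vt0 StarL) = u1 (Vt0 StarStarL)
         \<and> p11 (Vt0 StarL) = p11 (Vt0 StarStarL)"
      "rho (Vt0 StarR) = rho (Vt0 StarStarR) \<and> u1 (Vt0 StarR) = u1 (Vt0 StarStarR)
         \<and> p11 (Vt0 StarR) = p11 (Vt0 StarStarR)"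
    and shock: "ps > p11 VR" "\<sigma>R = u1 VR + sqrt ((2 * ps + p11 VR) / rho VR)" "sp Shock6 0 = \<sigma>R"
    and fan_range: "\<alpha>0 > 0" "\<beta>L < \<beta>sL"
    and fan_smooth: "Ck_on 2 rect xx" "Ck_on 2 rect tt" "Ck_on 2 rect Vh"
    and fan_admissible: "\<And>z. z \<in> rect \<Longrightarrow> admissible (Vh z)"
    and fan_origin: "\<And>\<beta>. \<beta> \<in> {\<beta>L..\<beta>sL} \<Longrightarrow> xx (0, \<beta>) = 0 \<and> tt (0, \<beta>) = 0"
    and fan_minus_characteristics:
      "\<And>\<alpha> \<beta>. (\<alpha>, \<beta>) \<in> rect \<Longrightarrow>
         vector_derivative (\<lambda>a. xx (a, \<beta>)) (at \<alpha> within {-\<alpha>0..0})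
         = (u1 (Vh (\<alpha>, \<beta>)) - sound (Vh (\<alpha>, \<beta>)))
           * vector_derivative (\<lambda>a. tt (a, \<beta>)) (at \<alpha> within {-\<alpha>0..0})"
    and fan_plus_characteristics:
      "\<And>\<alpha> \<beta>. (\<alpha>, \<beta>) \<in> rect \<Longrightarrow>
         vector_derivative (\<lambda>b. xx (\<alpha>, b)) (at \<beta> within {\<beta>L..\<beta>sL})
         = (u1 (Vh (\<alpha>, \<beta>)) + sound (Vh (\<alpha>, \<beta>)))
           * vector_derivative (\<lambda>b. tt (\<alpha>, b)) (at \<beta> within {\<beta>L..\<beta>sL})"
    and fan_slopes:
      "\<And>\<beta>. \<beta> \<in> {\<beta>L..\<beta>sL} \<Longrightarrow>
         vector_derivative (\<lambda>a. xx (a, \<beta>)) (at 0 within {-\<alpha>0..0})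
         = \<beta> * vector_derivative (\<lambda>a. tt (a, \<beta>)) (at 0 within {-\<alpha>0..0})"
    and fan_nondegenerate:
      "\<And>\<alpha> \<beta>. (\<alpha>, \<beta>) \<in> rect \<Longrightarrow>
         vector_derivative (\<lambda>a. tt (a, \<beta>)) (at \<alpha> within {-\<alpha>0..0}) \<noteq> 0"
    and fan_head_tail:
      "\<And>\<alpha>. -\<alpha>0 \<le> \<alpha> \<Longrightarrow> \<alpha> < 0 \<Longrightarrow>
         xx (\<alpha>, \<beta>L) = X Head (tt (\<alpha>, \<beta>L)) \<and> xx (\<alpha>, \<beta>sL) = X Tail (tt (\<alpha>, \<beta>sL))"
    and fan_time: "\<And>\<alpha> \<beta>. (\<alpha>, \<beta>) \<in> rect \<Longrightarrow> \<alpha> < 0 \<Longrightarrow> 0 < tt (\<alpha>, \<beta>) \<and> tt (\<alpha>, \<beta>) < T"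
    and fan_inside:
      "\<And>\<alpha> \<beta>. -\<alpha>0 \<le> \<alpha> \<Longrightarrow> \<alpha> < 0 \<Longrightarrow> \<beta>L < \<beta> \<Longrightarrow> \<beta> < \<beta>sL \<Longrightarrow>
         X Head (tt (\<alpha>, \<beta>)) < xx (\<alpha>, \<beta>) \<and> xx (\<alpha>, \<beta>) < X Tail (tt (\<alpha>, \<beta>))"
    and fan_injective: "inj_on (\<lambda>z. (xx z, tt z)) ({-\<alpha>0..<0} \<times> {\<beta>L..\<beta>sL})"
    and fan_covered:
      "\<exists>\<epsilon>>0. \<forall>z \<in> piece X \<delta> T Fan. snd z < \<epsilon> \<longrightarrow>
         z \<in> (\<lambda>y. (xx y, tt y)) ` ({-\<alpha>0..<0} \<times> {\<beta>L..\<beta>sL})"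
    and fan_state: "\<And>\<alpha> \<beta>. (\<alpha>, \<beta>) \<in> rect \<Longrightarrow> \<alpha> < 0 \<Longrightarrow> Vh (\<alpha>, \<beta>) = V Fan (xx (\<alpha>, \<beta>), tt (\<alpha>, \<beta>))"
    and fan_invariants_origin:
      "\<And>\<beta>. \<beta> \<in> {\<beta>L..\<beta>sL} \<Longrightarrow> psi1 (Vh (0, \<beta>)) = psi1 VL \<and> S1 (Vh (0, \<beta>)) = S1 VL"
    and fan_invariants_derivatives:
      "\<And>f pd. f \<in> {psi1, S1} \<Longrightarrow> pd \<in> {pdx, pdt} \<Longrightarrow>
         \<exists>g. continuous_on rect g \<and>
           (\<forall>\<alpha>\<in>{-\<alpha>0..<0}. \<forall>\<beta>\<in>{\<beta>L<..<\<beta>sL}.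
              g (\<alpha>, \<beta>) = pd (\<lambda>z. f (V Fan z)) (xx (\<alpha>, \<beta>), tt (\<alpha>, \<beta>)))"

end

theory Submission
  imports Defs
begin

text \<open>Near the origin only first-order information counts. In each region outside the fan the
differential equations pass to the limit at the origin, so that the limits of the first derivatives
of rho, u1, p11 satisfy the primitive equations (\<open>primitive_origin\<close>). In the middle regions
this expresses the x- and t-derivatives of u1 and p11 through the two unknowns Du and Dp
(\<open>middle_derivatives\<close>). One linear equation for (Du, Dp) comes from each of the two outer
waves, together with one equation for the time derivative of rho.

\<^bold>\<open>Shock.\<close> The Rankine-Hugoniot conditions determine u1 and rho behind the shock as
explicit functions of p11 behind it and of the state ahead of it (\<open>shock_relations\<close>). Along the
shock curve both traces are differentiable at time 0 with derivative Vt0 + s * Vx0, where s is the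
initial speed (\<open>curve_trace_derivative\<close>). Differentiating the two relations at time 0 gives
\<open>shock_derivatives\<close>; the coefficients Phi1, Phi2, Phi3 and H1, H2, H3 are the partial
derivatives of these functions.

\<^bold>\<open>Fan.\<close> By the differential equations S1 is transported with speed u1, and psi1 is
transported with speed u1 + c up to a source made of the x-derivative of S1 and of the potential.
On the edge alpha = 0 of characteristic coordinates, psi1 and S1 are constant, so their
beta-derivatives vanish there. Their alpha-derivatives on that edge nevertheless change with
beta, and for a function whose beta-derivative is H times that of tt, the law is
  (d/d beta) of the alpha-derivative = H * (mixed second derivative of tt)
(\<open>edge_derivative\<close>). Applied to tt, xx, S1 and psi1 this becomes a system of ordinary
differential equations in beta, with c = (psi1 - beta) / 2 on the edge, which integrates
explicitly: writing S_x and psi_x for the limits of the x-derivatives at the edge,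
  S_x / c   and   psi_x - (3/4) A c^2,   A = rho_L^2 S_L' / (2 c_L^3),
are constant (\<open>fan_gradients_at_origin\<close>). At the head the limits are those of the left
data, at the tail those of the region behind the fan (\<open>fan_boundary_match\<close>), so the
x-derivatives of S1 and psi1 behind the fan are known (\<open>fan_gradient_relations\<close>). Rewritten
in terms of Du and Dp this is the left linear equation, and the equation for the time derivative
of rho.\<close>

section \<open>State vectors with six components\<close>

lemma exhaust_6:
  fixes x :: 6
  shows "x = 1 \<or> x = 2 \<or> x = 3 \<or> x = 4 \<or> x = 5 \<or> x = 6"
proof (induct x)
  case (of_int z)
  then have "z = 0 \<or> z = 1 \<or> z = 2 \<or> z = 3 \<or> z = 4 \<or> z = 5" by fastforce
  then show ?case by auto
qed

lemma forall_6: "(\<forall>i::6. P i) \<longleftrightarrow> P 1 \<and> P 2 \<and> P 3 \<and> P 4 \<and> P 5 \<and> P 6"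
  by (metis exhaust_6)

lemma vector_6 [simp]:
  "(vector [a, b, c, d, e, f] :: ('a::zero)^6) $ 1 = a"
  "(vector [a, b, c, d, e, f] :: ('a::zero)^6) $ 2 = b"
  "(vector [a, b, c, d, e, f] :: ('a::zero)^6) $ 3 = c"
  "(vector [a, b, c, d, e, f] :: ('a::zero)^6) $ 4 = d"
  "(vector [a, b, c, d, e, f] :: ('a::zero)^6) $ 5 = e"
  "(vector [a, b, c, d, e, f] :: ('a::zero)^6) $ 6 = f"
  unfolding vector_def by simp_all

lemma has_vector_derivative_vec_nth:
  assumes "(f has_vector_derivative f') F"
  shows "((\<lambda>x. f x $ i) has_real_derivative f' $ i) F"
  using bounded_linear.has_vector_derivative[OF bounded_linear_vec_nth assms]
  by (simp add: has_real_derivative_iff_has_vector_derivative)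

text \<open>The functions pdx and pdt differentiate vector-valued functions, and a vector derivative is
meaningful only if all components are differentiable; this is why differentiability is required
of every component although only one of them is computed.\<close>

lemma vector_derivative_vec_nth:
  fixes f :: "real \<Rightarrow> real^'n"
  assumes "\<And>i. (\<lambda>x. f x $ i) differentiable at x"
    and "((\<lambda>x. f x $ i) has_real_derivative d) (at x)"
  shows "vector_derivative f (at x) $ i = d"
proof -
  obtain d' where d': "\<And>i. ((\<lambda>x. f x $ i) has_derivative (\<lambda>h. h * d' i)) (at x)"
    using assms(1) unfolding real_differentiable_def has_field_derivative_def
    by (metis mult_commute_abs)
  have "(f has_vector_derivative (\<chi> i. d' i)) (at x)"
    unfolding has_vector_derivative_def
    apply (subst has_derivative_componentwise_within)
    using d' by (auto simp: Basis_vec_def inner_axis)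
  then have *: "((\<lambda>x. f x $ i) has_real_derivative vector_derivative f (at x) $ i) (at x)"
    using has_vector_derivative_vec_nth vector_derivative_at by metis
  show ?thesis
    using DERIV_unique[OF * assms(2)] .
qed

section \<open>Primitive form of the equations and transport of the invariants\<close>

text \<open>The differentials at the state v of S1 and psi1, applied to an increment h. In the second one
the sound speed c enters through 2 c dc = 3 d(p11 / rho).\<close>

definition dS1 :: "real^6 \<Rightarrow> real^6 \<Rightarrow> real" where
  "dS1 v h = (p11 h - 3 * p11 v / rho v * rho h) / rho v ^ 3"

definition dpsi1 :: "real^6 \<Rightarrow> real^6 \<Rightarrow> real" where
  "dpsi1 v h = u1 h + 3 / (2 * sound v * rho v) * (p11 h - p11 v / rho v * rho h)"

text \<open>The equations for rho, u1 and p11 form a closed subsystem: the one-dimensional Euler equations with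
adiabatic exponent 3 and a force.\<close>

definition primitive_eqs :: "real \<Rightarrow> real^6 \<Rightarrow> real^6 \<Rightarrow> real^6 \<Rightarrow> bool" where
  "primitive_eqs w v vt vx \<longleftrightarrow>
     rho vt + u1 v * rho vx + rho v * u1 vx = 0 \<and>
     u1 vt + u1 v * u1 vx + p11 vx / rho v = - w / 2 \<and>
     p11 vt + u1 v * p11 vx + 3 * p11 v * u1 vx = 0"

lemma sound_pos: "admissible v \<Longrightarrow> sound v > 0"
  and sound_sq: "admissible v \<Longrightarrow> (sound v)\<^sup>2 = 3 * p11 v / rho v"
  by (auto simp: admissible_def sound_def)

lemma S1_has_derivative:
  assumes "admissible (f t)" "(f has_vector_derivative f') (at t within s)"
  shows "((\<lambda>t. S1 (f t)) has_real_derivative dS1 (f t) f') (at t within s)"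
  unfolding S1_def dS1_def
  using assms(1)
  by (auto intro!: derivative_eq_intros has_vector_derivative_vec_nth[OF assms(2)]
      simp: admissible_def divide_simps power_eq_if algebra_simps)

lemma psi1_has_derivative:
  assumes "admissible (f t)" "(f has_vector_derivative f') (at t within s)"
  shows "((\<lambda>t. psi1 (f t)) has_real_derivative dpsi1 (f t) f') (at t within s)"
proof -
  have pos: "rho (f t) > 0" "3 * p11 (f t) / rho (f t) > 0"
    using assms(1) by (auto simp: admissible_def)
  have "((\<lambda>t. 3 * p11 (f t) / rho (f t)) has_real_derivative
      3 / rho (f t) * (p11 f' - p11 (f t) / rho (f t) * rho f')) (at t within s)"
    using pos by (auto intro!: derivative_eq_intros has_vector_derivative_vec_nth[OF assms(2)]
      simp: divide_simps)
  from DERIV_chain2[OF DERIV_real_sqrt[OF pos(2)] this]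
  show ?thesis unfolding psi1_def dpsi1_def sound_def
    apply (rule DERIV_cong[OF DERIV_add[OF has_vector_derivative_vec_nth[OF assms(2)]]])
    using pos by (simp add: divide_simps)
qed

lemma dS1_transport:
  assumes "admissible v" "primitive_eqs w v vt vx"
  shows "dS1 v vt = - u1 v * dS1 v vx"
proof -
  have r: "rho v > 0" using assms by (simp add: admissible_def)
  have t: "rho vt = - (u1 v * rho vx + rho v * u1 vx)" "p11 vt = - (u1 v * p11 vx + 3 * p11 v * u1 vx)"
    using assms(2) by (auto simp: primitive_eqs_def)
  show ?thesis unfolding dS1_def t using r by (simp add: divide_simps) (simp add: algebra_simps)
qed

text \<open>Along the characteristics of speed u1 + c the change of u1 + c is not zero: it is driven by the
entropy gradient and by the potential. This source is what makes the gradient of psi1 vary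
across the fan.\<close>

lemma dpsi1_transport:
  assumes "admissible v" "primitive_eqs w v vt vx"
  shows "dpsi1 v vt = - (u1 v + sound v) * dpsi1 v vx + (rho v)\<^sup>2 / 2 * dS1 v vx - w / 2"
proof -
  have r: "rho v > 0" using assms by (simp add: admissible_def)
  have t: "rho vt = - (u1 v * rho vx + rho v * u1 vx)" "p11 vt = - (u1 v * p11 vx + 3 * p11 v * u1 vx)"
     "u1 vt = - w / 2 - u1 v * u1 vx - p11 vx / rho v"
    using assms(2) by (auto simp: primitive_eqs_def)
  have c: "sound v > 0" "p11 v = (sound v)\<^sup>2 * rho v / 3"
    using sound_pos[OF assms(1)] sound_sq[OF assms(1)] r by (auto simp: field_simps)
  show ?thesis unfolding dS1_def dpsi1_def t c(2)
    using r c(1) by (simp add: divide_simps) (simp add: algebra_simps power_eq_if)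
qed

lemma has_derivative_plane_partials:
  fixes f :: "real \<times> real \<Rightarrow> 'a::real_normed_vector"
  assumes "(f has_derivative (\<lambda>h. fst h *\<^sub>R fx + snd h *\<^sub>R ft)) (at z)"
  shows "((\<lambda>x. f (x, snd z)) has_vector_derivative fx) (at (fst z))"
    and "((\<lambda>t. f (fst z, t)) has_vector_derivative ft) (at (snd z))"
proof -
  have 1: "((\<lambda>x. (x, snd z)) has_derivative (\<lambda>h. (h, 0))) (at (fst z))"
   and 2: "((\<lambda>t. (fst z, t)) has_derivative (\<lambda>h. (0, h))) (at (snd z))"
    by (auto intro!: derivative_eq_intros)
  show "((\<lambda>x. f (x, snd z)) has_vector_derivative fx) (at (fst z))"
    using has_derivative_compose[OF 1, of f "\<lambda>h. fst h *\<^sub>R fx + snd h *\<^sub>R ft"] assms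
    by (simp add: has_vector_derivative_def)
  show "((\<lambda>t. f (fst z, t)) has_vector_derivative ft) (at (snd z))"
    using has_derivative_compose[OF 2, of f "\<lambda>h. fst h *\<^sub>R fx + snd h *\<^sub>R ft"] assms
    by (simp add: has_vector_derivative_def)
qed

text \<open>The momentum equation minus u1 times the mass equation is rho times the equation for u1. With
both at hand the time derivatives of rho and u1 are eliminated from the energy equation, which
leaves the equation for p11.\<close>

lemma conservative_imp_primitive:
  fixes f :: "real \<times> real \<Rightarrow> real^6"
  assumes der: "(f has_derivative (\<lambda>h. fst h *\<^sub>R fx + snd h *\<^sub>R ft)) (at z)"
    and adm: "admissible (f z)"
    and eq: "pdt (\<lambda>y. cons (f y)) z + pdx (\<lambda>y. flux (f y)) z = source w (f z)"
  shows "primitive_eqs w (f z) ft fx"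
proof -
  note dx = has_vector_derivative_vec_nth[OF has_derivative_plane_partials(1)[OF der]]
  note dt = has_vector_derivative_vec_nth[OF has_derivative_plane_partials(2)[OF der]]
  have fl: "(\<lambda>x. flux (f (x, snd z)) $ i) differentiable at (fst z)" for i
  proof -
    have "\<forall>i. (\<lambda>x. flux (f (x, snd z)) $ i) differentiable at (fst z)"
      unfolding forall_6 flux_def vector_6 E11_def E12_def E22_def
      by (intro conjI derivative_intros) (use dx real_differentiable_def in auto)
    then show ?thesis by blast
  qed
  have co: "(\<lambda>t. cons (f (fst z, t)) $ i) differentiable at (snd z)" for i
  proof -
    have "\<forall>i. (\<lambda>t. cons (f (fst z, t)) $ i) differentiable at (snd z)"
      unfolding forall_6 cons_def vector_6 E11_def E12_def E22_def
      by (intro conjI derivative_intros) (use dt real_differentiable_def in auto)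
    then show ?thesis by blast
  qed
  let ?v = "f z"
  have [simp]: "(fst z, snd z) = z" by simp
  have comp: "dt' + dx' = source w ?v $ i"
    if "((\<lambda>t. cons (f (fst z, t)) $ i) has_real_derivative dt') (at (snd z))"
       "((\<lambda>x. flux (f (x, snd z)) $ i) has_real_derivative dx') (at (fst z))" for i dt' dx'
  proof -
    have "pdt (\<lambda>y. cons (f y)) z $ i = dt'" "pdx (\<lambda>y. flux (f y)) z $ i = dx'"
      unfolding pdt_def pdx_def
      using vector_derivative_vec_nth[OF co that(1)] vector_derivative_vec_nth[OF fl that(2)] .
    then show ?thesis using eq by (metis vector_add_component)
  qed
  have 1: "rho ft + (rho fx * u1 ?v + rho ?v * u1 fx) = 0"
  proof -
    have "rho ft + (rho fx * u1 ?v + rho ?v * u1 fx) = source w ?v $ 1"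
      by (rule comp) (auto intro!: derivative_eq_intros dx dt simp: cons_def flux_def)
    then show ?thesis by (simp add: source_def)
  qed
  have 2: "(rho ft * u1 ?v + rho ?v * u1 ft) +
      (rho fx * (u1 ?v)\<^sup>2 + rho ?v * (2 * u1 ?v * u1 fx) + p11 fx) = - (rho ?v * w) / 2"
  proof -
    have "(rho ft * u1 ?v + rho ?v * u1 ft) +
      (rho fx * (u1 ?v)\<^sup>2 + rho ?v * (2 * u1 ?v * u1 fx) + p11 fx) = source w ?v $ 2"
      by (rule comp) (auto intro!: derivative_eq_intros dx dt simp: cons_def flux_def)
    then show ?thesis by (simp add: source_def)
  qed
  have 4: "(rho ft * (u1 ?v)\<^sup>2 + rho ?v * (2 * u1 ?v * u1 ft) + p11 ft) / 2 +
      ((rho fx * (u1 ?v)\<^sup>2 + rho ?v * (2 * u1 ?v * u1 fx) + 3 * p11 fx) / 2 * u1 ?v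
        + (rho ?v * (u1 ?v)\<^sup>2 + 3 * p11 ?v) / 2 * u1 fx) = - (rho ?v * u1 ?v * w) / 2"
  proof -
    have "(rho ft * (u1 ?v)\<^sup>2 + rho ?v * (2 * u1 ?v * u1 ft) + p11 ft) / 2 +
      ((rho fx * (u1 ?v)\<^sup>2 + rho ?v * (2 * u1 ?v * u1 fx) + 3 * p11 fx) / 2 * u1 ?v
        + (rho ?v * (u1 ?v)\<^sup>2 + 3 * p11 ?v) / 2 * u1 fx) = source w ?v $ 4"
      by (rule comp) (auto intro!: derivative_eq_intros dx dt
          simp: cons_def flux_def E11_def field_simps power2_eq_square)
    then show ?thesis by (simp add: source_def)
  qed
  define r u p where v: "r = rho ?v" "u = u1 ?v" "p = p11 ?v"
  have r: "r > 0" using adm by (simp add: admissible_def v)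
  have a: "rho ft = - (rho fx * u + r * u1 fx)" using 1 by (simp add: v)
  have b: "r * u1 ft = - r * u * u1 fx - p11 fx - r * w / 2"
    using 2 unfolding v(1,2)[symmetric] a by (simp add: algebra_simps power2_eq_square)
  have "p11 ft = - (u * p11 fx + 3 * p * u1 fx)"
  proof -
    have "rho ft * u\<^sup>2 + 2 * u * (r * u1 ft) + p11 ft + 
      (rho fx * u\<^sup>2 + r * (2 * u * u1 fx) + 3 * p11 fx) * u + (r * u\<^sup>2 + 3 * p) * u1 fx = - (r * u * w)"
      using 4 unfolding v(1,2,3)[symmetric] by (simp add: field_simps)
    then show ?thesis unfolding a b by (simp add: algebra_simps power2_eq_square)
  qed
  moreover have "u1 ft + u * u1 fx + p11 fx / r = - w / 2"
    using b r by (simp add: field_simps)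
  ultimately show ?thesis using a by (simp add: primitive_eqs_def v algebra_simps)
qed

section \<open>Jump relations across the shock\<close>

lemma rankine_hugoniot_components:
  assumes "rankine_hugoniot s v w"
  shows "rho w * u1 w - rho v * u1 v = s * (rho w - rho v)"
    and "rho w * (u1 w)\<^sup>2 + p11 w - (rho v * (u1 v)\<^sup>2 + p11 v) = s * (rho w * u1 w - rho v * u1 v)"
    and "(E11 w + p11 w) * u1 w - (E11 v + p11 v) * u1 v = s * (E11 w - E11 v)"
proof -
  have "(flux w - flux v) $ i = (s *\<^sub>R (cons w - cons v)) $ i" for i
    using assms by (simp add: rankine_hugoniot_def)
  from this[of 1] this[of 2] this[of 4]
  show "rho w * u1 w - rho v * u1 v = s * (rho w - rho v)"
    "rho w * (u1 w)\<^sup>2 + p11 w - (rho v * (u1 v)\<^sup>2 + p11 v) = s * (rho w * u1 w - rho v * u1 v)"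
    "(E11 w + p11 w) * u1 w - (E11 v + p11 v) * u1 v = s * (E11 w - E11 v)"
    by (simp_all add: flux_def cons_def)
qed

text \<open>In the frame of the shock the mass flux M is the same on both sides. The momentum condition
reads p - q = M (a - b) for the relative velocities a, b, and the energy condition then yields a
Hugoniot relation between densities and pressures only. Inserting it into the momentum condition
gives M^2 = r (2 p + q); the assumption on the speed fixes the sign of M, hence the branch.\<close>

lemma shock_relations:
  assumes rh: "rankine_hugoniot s v w" and adm: "admissible v" "admissible w"
    and pgt: "p11 v > p11 w" and spd: "s > u1 w"
  shows "u1 v = u1 w + (p11 v - p11 w) / sqrt (rho w * (2 * p11 v + p11 w))"
    and "rho v = rho w * (2 * p11 v + p11 w) / (p11 v + 2 * p11 w)"
proof -
  define a b M where "a = u1 v - s" and "b = u1 w - s" and M: "M = - (rho w * b)"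
  have u: "u1 v = a + s" "u1 w = b + s" by (auto simp: a_def b_def)
  define p q r R where z: "p = p11 v" "q = p11 w" "r = rho w" "R = rho v"
  have pos: "p > 0" "q > 0" "r > 0" "R > 0" "p > q"
    using adm pgt by (auto simp: admissible_def z)
  note R = rankine_hugoniot_components[OF rh, unfolded u E11_def z[symmetric]]
  have m1: "R * a = - M" using R(1) by (simp add: M z algebra_simps)
  have m2: "r * b = - M" by (simp add: M z)
  have Mp: "M > 0" using spd pos by (auto simp: m2[symmetric] M b_def z mult_less_0_iff mult_neg_pos)
  have mom: "p - q = M * (a - b)"
  proof -
    have "q + r * b * b = p + R * a * a" using R(1,2) by algebra
    then show ?thesis unfolding m1 m2 by (simp add: algebra_simps)
  qed
  have en: "(r * b\<^sup>2 + 3 * q) * b = (R * a\<^sup>2 + 3 * p) * a"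
    using R by (simp add: field_simps) algebra
  have ra: "a = - M / R" "b = - M / r" using m1 m2 pos by (auto simp: field_simps)
  have "M * ((- M * b + 3 * q) * R) = M * ((- M * a + 3 * p) * r)"
    using en m1 m2 by algebra
  then have e2: "(- M * b + 3 * q) * R = (- M * a + 3 * p) * r"
    using Mp by simp
  \<comment> \<open>Eliminate the velocities from the energy condition; M has already been cancelled.\<close>
  have hug: "R * (p + 2 * q) = r * (2 * p + q)"
  proof -
    have "M * a * r - M * b * R = 3 * p * r - 3 * q * R" using e2 by (simp add: algebra_simps)
    moreover have "M * a * r - M * b * R = (p - q) * (r + R)"
    proof -
      have "(p - q) * (r + R) = M * (a * r - b * r + a * R - b * R)"
        unfolding mom by (simp add: algebra_simps)
      also have "a * R = b * r" using m1 m2 by (simp add: algebra_simps)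
      finally show ?thesis by (simp add: algebra_simps)
    qed
    ultimately show ?thesis by (simp add: algebra_simps)
  qed
  have Rr: "R = r * (2 * p + q) / (p + 2 * q)" using hug pos by (simp add: field_simps)
  have "p - q = M\<^sup>2 * (R - r) / (R * r)"
    using mom pos unfolding ra by (simp add: field_simps power2_eq_square)
  moreover have "R - r = r * (p - q) / (p + 2 * q)"
    unfolding Rr using pos by (simp add: field_simps)
  moreover define X where "X = M\<^sup>2 / (R * (p + 2 * q))"
  ultimately have "p - q = (p - q) * X" using pos by (simp add: mult_ac)
  then have "X = 1" using pos by simp
  then have "M\<^sup>2 = R * (p + 2 * q)" using pos by (simp add: X_def)
  then have "M = sqrt (r * (2 * p + q))" using Mp hug by (simp add: real_sqrt_unique)
  moreover have "a = b + (p - q) / M" using mom Mp by (simp add: field_simps)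
  ultimately show "u1 v = u1 w + (p11 v - p11 w) / sqrt (rho w * (2 * p11 v + p11 w))"
    by (simp add: u z)
  show "rho v = rho w * (2 * p11 v + p11 w) / (p11 v + 2 * p11 w)" using Rr by (simp add: z)
qed


section \<open>One-sided calculus at the origin\<close>

text \<open>The limits at the origin are assumed along the interior of a region only, while the traces on the
bounding curves need them along the whole region.\<close>

lemma tendsto_within_from_interior:
  fixes f :: "'a::metric_space \<Rightarrow> 'b::metric_space"
  assumes lim: "(f \<longlongrightarrow> l) (at a within interior A)"
    and cont: "continuous_on A f" and dense: "A \<subseteq> closure (interior A)"
  shows "(f \<longlongrightarrow> l) (at a within A)"
proof (rule tendstoI)
  fix e :: real assume "e > 0"
  then obtain d where d: "d > 0"
    "\<And>x. x \<in> interior A \<Longrightarrow> x \<noteq> a \<Longrightarrow> dist x a < d \<Longrightarrow> dist (f x) l < e / 2"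
    using tendstoD[OF lim, of "e/2"] by (auto simp: eventually_at)
  have "dist (f y) l < e" if y: "y \<in> A" "y \<noteq> a" "dist y a < d" for y
  proof -
    obtain d' where d': "d' > 0" "\<And>x. x \<in> A \<Longrightarrow> dist x y < d' \<Longrightarrow> dist (f x) (f y) < e / 2"
      using cont y(1) \<open>e > 0\<close> unfolding continuous_on_iff by (meson half_gt_zero)
    define m where "m = min d' (min (d - dist y a) (dist y a))"
    have "m > 0" using d' y by (simp add: m_def)
    then obtain x where x: "x \<in> interior A" "dist x y < m"
      using dense y(1) closure_approachable by blast
    have "dist x a < d" "x \<noteq> a"
      using x(2) dist_triangle[of x a y] by (auto simp: m_def dist_commute)
    then have "dist (f x) l < e / 2" using d(2) x(1) by blast
    moreover have "dist (f x) (f y) < e / 2"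
      using d'(2) x interior_subset by (force simp: m_def)
    ultimately show ?thesis
      using dist_triangle[of "f y" l "f x"] by (simp add: dist_commute)
  qed
  then show "\<forall>\<^sub>F x in at a within A. dist (f x) l < e"
    using d(1) by (auto simp: eventually_at)
qed

text \<open>The initial condition concerns pointwise limits as t tends to 0 and says nothing about
derivatives. The x-derivative is recovered from the mean value inequality on horizontal segments:
if the x-derivative of f is within e of b' near the origin, difference quotients at small times
t are within e of b', and as t tends to 0 they become exactly a'.\<close>

lemma initial_data_limits:
  fixes f :: "real \<times> real \<Rightarrow> 'a::real_normed_vector"
  assumes I: "at 0 within I \<noteq> bot" "0 \<notin> I"
    and init: "\<And>x. x \<in> I \<Longrightarrow> ((\<lambda>t. f (x, t)) \<longlongrightarrow> a + x *\<^sub>R a') (at_right 0)"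
    and inside: "\<And>x y. x \<in> I \<Longrightarrow> y \<in> I \<Longrightarrow> \<forall>\<^sub>F t in at_right 0. closed_segment x y \<times> {t} \<subseteq> U"
    and der: "\<And>z. z \<in> U \<Longrightarrow> (f has_derivative (\<lambda>h. fst h *\<^sub>R fx z + snd h *\<^sub>R ft z)) (at z)"
    and lim: "(f \<longlongrightarrow> b) (at (0, 0) within U)" "(fx \<longlongrightarrow> b') (at (0, 0) within U)"
  shows "b = a" "b' = a'"
proof -
  have near: "\<forall>\<^sub>F t in at_right 0. \<forall>w\<in>closed_segment x y. (w, t) \<in> U \<and> (w, t) \<noteq> (0, 0) \<and> dist (w, t) (0, 0) < d"
    if "x \<in> I" "y \<in> I" "\<bar>x\<bar> < d / 2" "\<bar>y\<bar> < d / 2" for x y d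
  proof -
    have d: "d > 0" using that by linarith
    have "\<forall>\<^sub>F t in at_right (0::real). 0 < t \<and> t < d / 2"
      by (rule eventually_at_rightI[of 0 "d/2"]) (use d in auto)
    with inside[OF that(1,2)] show ?thesis
    proof eventually_elim
      case (elim t)
      show ?case
      proof
        fix w assume w: "w \<in> closed_segment x y"
        then have "\<bar>w\<bar> < d / 2"
          using that(3,4) by (auto simp: closed_segment_eq_real_ivl split: if_splits)
        then have "dist (w, t) (0, 0) < d"
          using elim sqrt_sum_squares_le_sum_abs[of w t] by (simp add: dist_Pair_Pair)
        then show "(w, t) \<in> U \<and> (w, t) \<noteq> (0, 0) \<and> dist (w, t) (0, 0) < d"
          using elim w by auto
      qed
    qed
  qed
  have "((\<lambda>x. a + x *\<^sub>R a') \<longlongrightarrow> b) (at 0 within I)"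
  proof (rule tendstoI)
    fix e :: real assume "e > 0"
    then obtain d where d: "d > 0"
      "\<And>z. z \<in> U \<Longrightarrow> z \<noteq> (0, 0) \<Longrightarrow> dist z (0, 0) < d \<Longrightarrow> dist (f z) b < e / 2"
      using tendstoD[OF lim(1), of "e/2"] by (auto simp: eventually_at)
    have "dist (a + x *\<^sub>R a') b < e" if x: "x \<in> I" "\<bar>x\<bar> < d / 2" for x
    proof -
      have "\<forall>\<^sub>F t in at_right 0. dist (f (x, t)) b \<le> e / 2"
        using near[OF x(1) x(1) x(2) x(2)] by eventually_elim (use d(2) in \<open>fastforce intro: less_imp_le\<close>)
      then have "dist (a + x *\<^sub>R a') b \<le> e / 2"
        by (intro tendsto_upperbound[OF tendsto_dist[OF init[OF x(1)] tendsto_const]]) auto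
      then show ?thesis using \<open>e > 0\<close> by linarith
    qed
    then show "\<forall>\<^sub>F x in at 0 within I. dist (a + x *\<^sub>R a') b < e"
      using d(1) unfolding eventually_at by (intro exI[of _ "d/2"]) auto
  qed
  moreover have "((\<lambda>x. a + x *\<^sub>R a') \<longlongrightarrow> a + 0 *\<^sub>R a') (at 0 within I)"
    by (intro tendsto_intros)
  ultimately show "b = a" using I(1) tendsto_unique by fastforce
  have "norm (a' - b') \<le> e" if "e > 0" for e
  proof -
    obtain d where d: "d > 0"
      "\<And>z. z \<in> U \<Longrightarrow> z \<noteq> (0, 0) \<Longrightarrow> dist z (0, 0) < d \<Longrightarrow> dist (fx z) b' < e"
      using tendstoD[OF lim(2) \<open>e > 0\<close>] by (auto simp: eventually_at)
    have lp: "\<exists>x\<in>I. x \<noteq> 0 \<and> \<bar>x\<bar> < r" if "r > 0" for r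
      using I(1) that unfolding trivial_limit_within islimpt_approachable by (auto simp: dist_real_def)
    obtain x where x: "x \<in> I" "x \<noteq> 0" "\<bar>x\<bar> < d / 2" using lp[of "d/2"] d(1) by auto
    obtain y where y: "y \<in> I" "\<bar>y\<bar> < \<bar>x\<bar>" using lp[of "\<bar>x\<bar>"] x by auto
    have "\<forall>\<^sub>F t in at_right 0. norm (f (y, t) - f (x, t) - (y - x) *\<^sub>R b') \<le> e * \<bar>y - x\<bar>"
    proof (rule eventually_mono)
      show "\<forall>\<^sub>F t in at_right 0. \<forall>w\<in>closed_segment x y.
          (w, t) \<in> U \<and> (w, t) \<noteq> (0, 0) \<and> dist (w, t) (0, 0) < d"
        using near[OF x(1) y(1) x(3)] y(2) x(3) by simp
    next
      fix t assume t: "\<forall>w\<in>closed_segment x y. (w, t) \<in> U \<and> (w, t) \<noteq> (0, 0) \<and> dist (w, t) (0, 0) < d"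
      define g where "g = (\<lambda>w. f (w, t) - w *\<^sub>R b')"
      have g: "(g has_derivative (\<lambda>h. h *\<^sub>R (fx (w, t) - b'))) (at w within closed_segment x y)"
        if "w \<in> closed_segment x y" for w
      proof -
        have "((\<lambda>w. f (w, t)) has_vector_derivative fx (w, t)) (at w)"
          using has_derivative_plane_partials(1)[OF der, of "(w, t)"] t that by auto
        then have "(g has_vector_derivative fx (w, t) - b') (at w)"
          unfolding g_def by (auto intro!: derivative_eq_intros)
        then show ?thesis
          by (auto simp: has_vector_derivative_def intro: has_derivative_at_withinI)
      qed
      have "norm (g y - g x) \<le> e * norm (y - x)"
        by (rule differentiable_bound[OF convex_closed_segment g])
          (use t d(2) in \<open>auto simp: onorm_scaleR_left onorm_id dist_norm intro!: less_imp_le\<close>)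
      then show "norm (f (y, t) - f (x, t) - (y - x) *\<^sub>R b') \<le> e * \<bar>y - x\<bar>"
        by (simp add: g_def algebra_simps)
    qed
    moreover have "((\<lambda>t. norm (f (y, t) - f (x, t) - (y - x) *\<^sub>R b'))
        \<longlongrightarrow> norm ((a + y *\<^sub>R a') - (a + x *\<^sub>R a') - (y - x) *\<^sub>R b')) (at_right 0)"
      by (intro tendsto_intros init x y)
    ultimately have "norm ((a + y *\<^sub>R a') - (a + x *\<^sub>R a') - (y - x) *\<^sub>R b') \<le> e * \<bar>y - x\<bar>"
      by (intro tendsto_upperbound) auto
    moreover have "(a + y *\<^sub>R a') - (a + x *\<^sub>R a') - (y - x) *\<^sub>R b' = (y - x) *\<^sub>R (a' - b')"
      by (simp add: algebra_simps)
    moreover have "\<bar>y - x\<bar> > 0" using y by auto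
    ultimately show ?thesis by (simp add: mult.commute)
  qed
  then have "norm (a' - b') \<le> 0" by (rule field_le_epsilon) simp
  then show "b' = a'" by simp
qed

text \<open>For t > 0 the derivative along the curve is given by the chain rule and has a limit as t tends to
0. A function that is continuous at an end point and whose derivative has a limit there is
differentiable at that end point with this limit as derivative.\<close>

lemma trace_has_vector_derivative:
  fixes f :: "real \<times> real \<Rightarrow> 'a::real_normed_vector"
  assumes T: "T > 0"
    and der: "\<And>z. z \<in> A \<Longrightarrow>
      (f has_derivative (\<lambda>h. fst h *\<^sub>R fx z + snd h *\<^sub>R ft z)) (at z within A)"
    and lim: "(f \<longlongrightarrow> b) (at (0, 0) within A)" "(fx \<longlongrightarrow> bx) (at (0, 0) within A)"
      "(ft \<longlongrightarrow> bt) (at (0, 0) within A)"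
    and X: "\<And>t. t \<in> {0..<T} \<Longrightarrow> (X has_real_derivative s t) (at t within {0..<T})"
      "continuous_on {0..<T} s" "X 0 = 0"
    and inA: "\<And>t. 0 < t \<Longrightarrow> t < T \<Longrightarrow> (X t, t) \<in> A"
  shows "((\<lambda>t. if t = 0 then b else f (X t, t)) has_vector_derivative bt + s 0 *\<^sub>R bx)
    (at 0 within {0..<T})"
proof -
  let ?l = "bt + s 0 *\<^sub>R bx"
  have right: "at 0 within {0..<T} = at_right (0::real)"
    by (rule at_within_nhd[of _ "{..<T}"]) (use T in auto)
  have curve: "filterlim (\<lambda>t. (X t, t)) (at (0, 0) within A) (at_right 0)"
  proof -
    have "(X \<longlongrightarrow> 0) (at_right 0)"
      using DERIV_continuous[OF X(1)[of 0]] T X(3) by (simp add: continuous_within right)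
    then have "((\<lambda>t. (X t, t)) \<longlongrightarrow> (0, 0)) (at_right 0)"
      by (intro tendsto_intros)
    moreover have "\<forall>\<^sub>F t in at_right 0. (X t, t) \<in> A \<and> (X t, t) \<noteq> (0, 0)"
      by (rule eventually_at_rightI[of 0 T]) (use inA T in auto)
    ultimately show ?thesis unfolding filterlim_at by blast
  qed
  define g' where "g' = (\<lambda>t. s t *\<^sub>R fx (X t, t) + ft (X t, t))"
  have gder: "((\<lambda>t. f (X t, t)) has_vector_derivative g' t) (at t within {0<..<T})"
    if t: "t \<in> {0<..<T}" for t
  proof -
    have "(X has_real_derivative s t) (at t within {0<..<T})"
      by (rule DERIV_subset[OF X(1)]) (use t in auto)
    then have "((\<lambda>t. (X t, t)) has_derivative (\<lambda>h. (h * s t, h))) (at t within {0<..<T})"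
      by (auto intro!: derivative_eq_intros simp: has_field_derivative_def mult.commute)
    moreover have "(f has_derivative (\<lambda>h. fst h *\<^sub>R fx (X t, t) + snd h *\<^sub>R ft (X t, t)))
        (at (X t, t) within (\<lambda>t. (X t, t)) ` {0<..<T})"
      by (rule has_derivative_subset[OF der]) (use inA t in auto)
    ultimately have "((\<lambda>t. f (X t, t)) has_derivative
        (\<lambda>h. (h * s t) *\<^sub>R fx (X t, t) + h *\<^sub>R ft (X t, t))) (at t within {0<..<T})"
      using has_derivative_in_compose[of "\<lambda>t. (X t, t)" "\<lambda>h. (h * s t, h)" t "{0<..<T}" f
          "\<lambda>h. fst h *\<^sub>R fx (X t, t) + snd h *\<^sub>R ft (X t, t)"] by simp
    then show ?thesis
      by (simp add: has_vector_derivative_def g'_def scaleR_add_right)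
  qed
  have "(s \<longlongrightarrow> s 0) (at_right 0)"
    using X(2) T by (auto simp: continuous_on_def right[symmetric])
  then have g'lim: "(g' \<longlongrightarrow> s 0 *\<^sub>R bx + bt) (at_right 0)"
    unfolding g'_def
    by (intro tendsto_intros filterlim_compose[OF lim(2) curve] filterlim_compose[OF lim(3) curve])
  have glim: "((\<lambda>t. f (X t, t)) \<longlongrightarrow> b) (at_right 0)"
    by (rule filterlim_compose[OF lim(1) curve])
  show ?thesis
    unfolding has_vector_derivative_def has_derivative_within_alt
  proof (intro conjI allI impI)
    show "bounded_linear (\<lambda>h::real. h *\<^sub>R ?l)" by (rule bounded_linear_scaleR_left)
    fix e :: real assume "e > 0"
    then have "\<forall>\<^sub>F t in at_right 0. dist (g' t) (s 0 *\<^sub>R bx + bt) < e"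
      using g'lim tendstoD by blast
    then obtain d0 where d0: "d0 > 0"
        "\<And>t. 0 < t \<Longrightarrow> t < d0 \<Longrightarrow> dist (g' t) (s 0 *\<^sub>R bx + bt) < e"
      unfolding eventually_at_right_field by auto
    define d where "d = min d0 T"
    have d: "d > 0" "d \<le> T" using d0 T by (auto simp: d_def)
    have bd: "norm (g' t - ?l) \<le> e" if "0 < t" "t < d" for t
      using d0(2)[of t] that by (simp add: d_def dist_norm add.commute)
    have "norm (f (X t, t) - b - t *\<^sub>R ?l) \<le> e * t" if t: "0 < t" "t < d" for t
    proof -
      have est: "norm (f (X t, t) - f (X u, u) - (t - u) *\<^sub>R ?l) \<le> e * (t - u)"
        if u: "0 < u" "u < t" for u
      proof -
        define g where "g = (\<lambda>w. f (X w, w) - w *\<^sub>R ?l)"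
        have "(g has_derivative (\<lambda>h. h *\<^sub>R (g' w - ?l))) (at w within {u..t})"
          if "w \<in> {u..t}" for w
        proof -
          have "((\<lambda>t. f (X t, t)) has_vector_derivative g' w) (at w within {u..t})"
            by (rule has_vector_derivative_within_subset[OF gder]) (use that u t d in auto)
          then have "(g has_vector_derivative g' w - ?l) (at w within {u..t})"
            unfolding g_def by (rule has_vector_derivative_diff) (auto intro!: derivative_eq_intros)
          then show ?thesis by (simp add: has_vector_derivative_def)
        qed
        from differentiable_bound[OF convex_real_interval(5) this, of e t u]
        have "norm (g t - g u) \<le> e * norm (t - u)"
          using u t bd by (auto simp: onorm_scaleR_left onorm_id)
        then show ?thesis using u by (simp add: g_def algebra_simps)
      qed
      have "\<forall>\<^sub>F u in at_right 0. norm (f (X t, t) - f (X u, u) - (t - u) *\<^sub>R ?l) \<le> e * (t - u)"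
        by (rule eventually_at_rightI[of 0 t]) (use est t in auto)
      moreover have "((\<lambda>u. norm (f (X t, t) - f (X u, u) - (t - u) *\<^sub>R ?l))
          \<longlongrightarrow> norm (f (X t, t) - b - (t - 0) *\<^sub>R ?l)) (at_right 0)"
        by (intro tendsto_intros glim)
      moreover have "((\<lambda>u. e * (t - u)) \<longlongrightarrow> e * (t - 0)) (at_right 0)"
        by (intro tendsto_intros)
      ultimately show ?thesis
        using tendsto_le[OF trivial_limit_at_right_real] by fastforce
    qed
    then show "\<exists>d>0. \<forall>y\<in>{0..<T}. norm (y - 0) < d \<longrightarrow>
        norm ((if y = 0 then b else f (X y, y)) - (if 0 = 0 then b else f (X 0, 0)) - (y - 0) *\<^sub>R ?l)
          \<le> e * norm (y - 0)"
      using d(1) by (intro exI[of _ d]) auto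
  qed
qed

text \<open>A form of the symmetry of second derivatives on the edge alpha = 0 for functions F that need not
be twice differentiable. For small alpha < 0, by the mean value theorem in beta,
F(alpha, v) - F(alpha, u) = (v - u) * tau(alpha, eta) * H(alpha, eta), and tau(alpha, eta) =
alpha * tau'(xi, eta) because tau vanishes on the edge. Divide by alpha and let alpha tend to 0:
since F is constant on the edge, the left-hand side tends to q v - q u.\<close>

lemma edge_derivative:
  fixes F \<tau> \<tau>' H :: "real \<times> real \<Rightarrow> real" and q :: "real \<Rightarrow> real"
  defines "R a b0 b1 \<equiv> {-a..0} \<times> {b0..b1}"
  assumes a: "a > 0"
    and const: "\<And>\<beta>. \<beta> \<in> {b0..b1} \<Longrightarrow> F (0, \<beta>) = C"
    and q: "\<And>\<beta>. \<beta> \<in> {b0..b1} \<Longrightarrow>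
      ((\<lambda>\<alpha>. F (\<alpha>, \<beta>)) has_real_derivative q \<beta>) (at 0 within {-a..0})"
    and cont: "\<And>\<alpha>. -a < \<alpha> \<Longrightarrow> \<alpha> < 0 \<Longrightarrow> continuous_on {b0..b1} (\<lambda>\<beta>. F (\<alpha>, \<beta>))"
    and der: "\<And>\<alpha> \<beta>. -a < \<alpha> \<Longrightarrow> \<alpha> < 0 \<Longrightarrow> b0 < \<beta> \<Longrightarrow> \<beta> < b1 \<Longrightarrow>
      ((\<lambda>\<beta>. F (\<alpha>, \<beta>)) has_real_derivative \<tau> (\<alpha>, \<beta>) * H (\<alpha>, \<beta>)) (at \<beta>)"
    and \<tau>0: "\<And>\<beta>. \<beta> \<in> {b0..b1} \<Longrightarrow> \<tau> (0, \<beta>) = 0"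
    and \<tau>': "\<And>\<alpha> \<beta>. (\<alpha>, \<beta>) \<in> R a b0 b1 \<Longrightarrow>
      ((\<lambda>\<alpha>. \<tau> (\<alpha>, \<beta>)) has_real_derivative \<tau>' (\<alpha>, \<beta>)) (at \<alpha> within {-a..0})"
    and contR: "continuous_on (R a b0 b1) \<tau>'" "continuous_on (R a b0 b1) H"
    and \<beta>: "\<beta> \<in> {b0..b1}"
  shows "(q has_real_derivative \<tau>' (0, \<beta>) * H (0, \<beta>)) (at \<beta> within {b0..b1})"
proof -
  let ?L = "\<tau>' (0, \<beta>) * H (0, \<beta>)"
  have "continuous_on (R a b0 b1 \<times> R a b0 b1) (\<lambda>p. \<tau>' (fst p) * H (snd p))"
    by (intro continuous_intros continuous_on_compose2[OF contR(1)] continuous_on_compose2[OF contR(2)]) auto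
  moreover have in0: "((0, \<beta>), (0, \<beta>)) \<in> R a b0 b1 \<times> R a b0 b1" using \<beta> a by (auto simp: R_def)
  ultimately have uc: "\<exists>d>0. \<forall>p\<in>R a b0 b1 \<times> R a b0 b1. dist p ((0, \<beta>), (0, \<beta>)) < d \<longrightarrow>
      dist (\<tau>' (fst p) * H (snd p)) ?L < e" if "e > 0" for e
    using that unfolding continuous_on_iff by fastforce
  have main: "\<exists>d>0. \<forall>\<beta>'\<in>{b0..b1}. \<bar>\<beta>' - \<beta>\<bar> < d \<longrightarrow> \<bar>q \<beta>' - q \<beta> - (\<beta>' - \<beta>) * ?L\<bar> \<le> e * \<bar>\<beta>' - \<beta>\<bar>"
    if e: "e > 0" for e
  proof -
    obtain d where d: "d > 0" "\<And>z w. z \<in> R a b0 b1 \<Longrightarrow> w \<in> R a b0 b1 \<Longrightarrow>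
        dist (z, w) ((0, \<beta>), (0, \<beta>)) < d \<Longrightarrow> \<bar>\<tau>' z * H w - ?L\<bar> < e"
      using uc[OF e] by (force simp: dist_real_def)
    have small: "dist ((x, y), (x', y)) ((0, \<beta>), (0, \<beta>)) < d"
      if "\<bar>x\<bar> < d / 4" "\<bar>x'\<bar> < d / 4" "\<bar>y - \<beta>\<bar> < d / 4" for x x' y
    proof -
      have "dist (x, y) (0, \<beta>) \<le> \<bar>x\<bar> + \<bar>y - \<beta>\<bar>" "dist (x', y) (0, \<beta>) \<le> \<bar>x'\<bar> + \<bar>y - \<beta>\<bar>"
        using sqrt_sum_squares_le_sum_abs by (auto simp: dist_Pair_Pair dist_real_def)
      moreover have "dist ((x, y), (x', y)) ((0, \<beta>), (0, \<beta>)) \<le> dist (x, y) (0, \<beta>) + dist (x', y) (0, \<beta>)"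
        using sqrt_sum_squares_le_sum_abs[of "dist (x, y) (0, \<beta>)" "dist (x', y) (0, \<beta>)"]
        by (simp add: dist_Pair_Pair[of "(x, y)"])
      ultimately show ?thesis using that by linarith
    qed
    \<comment> \<open>The estimate is uniform in alpha, so that it survives the limit alpha to 0 for fixed u and v.\<close>
    have quot: "\<bar>(F (\<alpha>, v) - F (\<alpha>, u)) / \<alpha> - (v - u) * ?L\<bar> \<le> e * (v - u)"
      if uv: "u \<in> {b0..b1}" "v \<in> {b0..b1}" "u < v" "\<bar>u - \<beta>\<bar> < d / 4" "\<bar>v - \<beta>\<bar> < d / 4"
        and \<alpha>: "-a < \<alpha>" "\<alpha> < 0" "- d / 4 < \<alpha>" for u v \<alpha>
    proof -
      have "\<exists>\<eta>. u < \<eta> \<and> \<eta> < v \<and> F (\<alpha>, v) - F (\<alpha>, u) = (v - u) * (\<tau> (\<alpha>, \<eta>) * H (\<alpha>, \<eta>))"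
      proof -
        have "\<exists>l z. u < z \<and> z < v \<and> ((\<lambda>\<beta>. F (\<alpha>, \<beta>)) has_real_derivative l) (at z)
             \<and> F (\<alpha>, v) - F (\<alpha>, u) = (v - u) * l"
        proof (rule MVT[OF uv(3)])
          show "continuous_on {u..v} (\<lambda>\<beta>. F (\<alpha>, \<beta>))"
            by (rule continuous_on_subset[OF cont]) (use \<alpha> uv in auto)
          show "(\<lambda>\<beta>. F (\<alpha>, \<beta>)) differentiable at x" if "u < x" "x < v" for x
            using der[of \<alpha> x] \<alpha> uv that unfolding real_differentiable_def by auto
        qed
        then obtain l z where z: "u < z" "z < v" "((\<lambda>\<beta>. F (\<alpha>, \<beta>)) has_real_derivative l) (at z)"
             "F (\<alpha>, v) - F (\<alpha>, u) = (v - u) * l" by blast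
        have "l = \<tau> (\<alpha>, z) * H (\<alpha>, z)"
          using DERIV_unique[OF z(3) der] \<alpha> uv z by auto
        then show ?thesis using z by blast
      qed
      then obtain \<eta> where \<eta>: "u < \<eta>" "\<eta> < v" "F (\<alpha>, v) - F (\<alpha>, u) = (v - u) * (\<tau> (\<alpha>, \<eta>) * H (\<alpha>, \<eta>))"
        by blast
      have \<eta>b: "\<eta> \<in> {b0..b1}" "\<bar>\<eta> - \<beta>\<bar> < d / 4" using \<eta> uv by (simp, linarith)
      have "\<exists>\<xi>\<in>{\<alpha><..<0}. \<tau> (0, \<eta>) - \<tau> (\<alpha>, \<eta>) = (0 - \<alpha>) * \<tau>' (\<xi>, \<eta>)"
      proof -
        have "((\<lambda>\<alpha>. \<tau> (\<alpha>, \<eta>)) has_derivative (*) (\<tau>' (\<xi>, \<eta>))) (at \<xi> within {\<alpha>..0})"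
          if "\<alpha> \<le> \<xi>" "\<xi> \<le> 0" for \<xi>
        proof -
          have "((\<lambda>\<alpha>. \<tau> (\<alpha>, \<eta>)) has_real_derivative \<tau>' (\<xi>, \<eta>)) (at \<xi> within {\<alpha>..0})"
            by (rule DERIV_subset[OF \<tau>']) (use that \<alpha> \<eta>b in \<open>auto simp: R_def\<close>)
          then show ?thesis by (simp only: has_field_derivative_def)
        qed
        from mvt_simple[OF \<alpha>(2) this]
        have "\<exists>\<xi>\<in>{\<alpha><..<0}. \<tau> (0, \<eta>) - \<tau> (\<alpha>, \<eta>) = \<tau>' (\<xi>, \<eta>) * (0 - \<alpha>)" .
        then show ?thesis by (simp add: mult.commute)
      qed
      then obtain \<xi> where \<xi>: "\<alpha> < \<xi>" "\<xi> < 0" "\<tau> (\<alpha>, \<eta>) = \<alpha> * \<tau>' (\<xi>, \<eta>)"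
        using \<tau>0[OF \<eta>b(1)] by auto
      have "(F (\<alpha>, v) - F (\<alpha>, u)) / \<alpha> = (v - u) * (\<tau>' (\<xi>, \<eta>) * H (\<alpha>, \<eta>))"
        unfolding \<eta>(3) \<xi>(3) using \<alpha> by simp
      moreover have "\<bar>\<tau>' (\<xi>, \<eta>) * H (\<alpha>, \<eta>) - ?L\<bar> < e"
        using \<alpha> \<xi> \<eta>b by (intro d(2) small) (auto simp: R_def)
      ultimately show ?thesis using uv(3)
        by (simp add: right_diff_distrib[symmetric] abs_mult mult.commute)
    qed
    have quotlim: "((\<lambda>\<alpha>. (F (\<alpha>, v) - F (\<alpha>, u)) / \<alpha>) \<longlongrightarrow> q v - q u) (at_left 0)"
      if "u \<in> {b0..b1}" "v \<in> {b0..b1}" for u v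
    proof -
      have "((\<lambda>\<alpha>. F (\<alpha>, v) - F (\<alpha>, u)) has_real_derivative q v - q u) (at 0 within {-a..0})"
        by (intro derivative_intros q that)
      then show ?thesis
        using const[OF that(1)] const[OF that(2)] a
        by (simp add: has_field_derivative_iff at_within_Icc_at_left)
    qed
    have lin: "\<bar>q v - q u - (v - u) * ?L\<bar> \<le> e * (v - u)"
      if uv: "u \<in> {b0..b1}" "v \<in> {b0..b1}" "u < v" "\<bar>u - \<beta>\<bar> < d / 4" "\<bar>v - \<beta>\<bar> < d / 4" for u v
    proof (rule tendsto_upperbound)
      show "((\<lambda>\<alpha>. \<bar>(F (\<alpha>, v) - F (\<alpha>, u)) / \<alpha> - (v - u) * ?L\<bar>) \<longlongrightarrow> \<bar>q v - q u - (v - u) * ?L\<bar>) (at_left 0)"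
        by (intro tendsto_intros quotlim uv)
      show "\<forall>\<^sub>F \<alpha> in at_left 0. \<bar>(F (\<alpha>, v) - F (\<alpha>, u)) / \<alpha> - (v - u) * ?L\<bar> \<le> e * (v - u)"
        by (rule eventually_at_leftI[of "max (-a) (- d / 4)"]) (use quot[OF uv] a d(1) in auto)
    qed auto
    show ?thesis
    proof (intro exI[of _ "d/4"] conjI ballI impI)
      fix \<beta>' assume b: "\<beta>' \<in> {b0..b1}" "\<bar>\<beta>' - \<beta>\<bar> < d / 4"
      consider "\<beta>' = \<beta>" | "\<beta> < \<beta>'" | "\<beta>' < \<beta>" by linarith
      then show "\<bar>q \<beta>' - q \<beta> - (\<beta>' - \<beta>) * ?L\<bar> \<le> e * \<bar>\<beta>' - \<beta>\<bar>"
      proof cases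
        case 2 then show ?thesis using lin[OF \<beta> b(1)] b d(1) by simp
      next
        case 3
        have "\<bar>q \<beta>' - q \<beta> - (\<beta>' - \<beta>) * ?L\<bar> = \<bar>q \<beta> - q \<beta>' - (\<beta> - \<beta>') * ?L\<bar>"
          by (subst abs_minus_cancel[symmetric]) (simp add: algebra_simps)
        then show ?thesis using lin[OF b(1) \<beta> 3] 3 b d(1) by simp
      qed simp
    qed (use d in simp)
  qed
  show ?thesis
    unfolding has_field_derivative_def has_derivative_within_alt
    using main by (auto simp: bounded_linear_mult_right mult.commute)
qed

lemma rect_eq_from_interior:
  fixes f g :: "real \<times> real \<Rightarrow> real"
  assumes "a0 < a1" "b0 < b1"
    and cont: "continuous_on ({a0..a1} \<times> {b0..b1}) f" "continuous_on ({a0..a1} \<times> {b0..b1}) g"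
    and eq: "\<And>\<alpha> \<beta>. a0 < \<alpha> \<Longrightarrow> \<alpha> < a1 \<Longrightarrow> b0 < \<beta> \<Longrightarrow> \<beta> < b1 \<Longrightarrow> f (\<alpha>, \<beta>) = g (\<alpha>, \<beta>)"
    and z: "z \<in> {a0..a1} \<times> {b0..b1}"
  shows "f z = g z"
proof -
  have cl: "closure ({a0<..<a1} \<times> {b0<..<b1}) = {a0..a1} \<times> {b0..b1}"
    using assms(1,2) by (simp add: closure_Times)
  have "f z - g z = 0"
    by (rule continuous_constant_on_closure[of "{a0<..<a1} \<times> {b0<..<b1}" "\<lambda>z. f z - g z"])
      (use eq z in \<open>auto simp: cl intro!: continuous_intros cont\<close>)
  then show ?thesis by simp
qed


section \<open>Geometry of the regions and limits at the origin\<close>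

primrec lower :: "(curve \<Rightarrow> real \<Rightarrow> real) \<Rightarrow> real \<Rightarrow> region \<Rightarrow> real \<Rightarrow> real" where
  "lower X \<delta> Lft = (\<lambda>t. - \<delta>)"
| "lower X \<delta> Fan = X Head"
| "lower X \<delta> StarL = X Tail"
| "lower X \<delta> StarStarL = X Shear2"
| "lower X \<delta> StarStarR = X Contact"
| "lower X \<delta> StarR = X Shear5"
| "lower X \<delta> Rgt = X Shock6"

primrec upper :: "(curve \<Rightarrow> real \<Rightarrow> real) \<Rightarrow> real \<Rightarrow> region \<Rightarrow> real \<Rightarrow> real" where
  "upper X \<delta> Lft = X Head"
| "upper X \<delta> Fan = X Tail"
| "upper X \<delta> StarL = X Shear2"
| "upper X \<delta> StarStarL = X Contact"
| "upper X \<delta> StarStarR = X Shear5"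
| "upper X \<delta> StarR = X Shock6"
| "upper X \<delta> Rgt = (\<lambda>t. \<delta>)"

lemma slice_bounds:
  "x \<in> slice X \<delta> t r \<Longrightarrow> lower X \<delta> r t \<le> x \<and> x \<le> upper X \<delta> r t"
  "lower X \<delta> r t < x \<Longrightarrow> x < upper X \<delta> r t \<Longrightarrow> x \<in> slice X \<delta> t r"
  by (cases r; simp)+

context grp_configuration
begin

abbreviation reg :: "region \<Rightarrow> (real \<times> real) set" where
  "reg r \<equiv> piece X \<delta> T r"

lemma lower_less_upper: "0 < t \<Longrightarrow> t < T \<Longrightarrow> lower X \<delta> r t < upper X \<delta> r t"
  using curve_order[of t] by (cases r) auto

lemma continuous_bounds:
  "continuous_on {0<..<T} (lower X \<delta> r)" "continuous_on {0<..<T} (upper X \<delta> r)"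
proof -
  have "continuous_on {0<..<T} (X j)" for j
  proof (rule continuous_on_subset)
    show "continuous_on {0..<T} (X j)"
      using curve_C1(1) DERIV_continuous continuous_on_eq_continuous_within by blast
  qed auto
  then show "continuous_on {0<..<T} (lower X \<delta> r)" "continuous_on {0<..<T} (upper X \<delta> r)"
    by (cases r; auto intro: continuous_on_const)+
qed

lemma in_interior_piece:
  assumes "0 < t" "t < T" "lower X \<delta> r t < x" "x < upper X \<delta> r t"
  shows "(x, t) \<in> interior (reg r)"
proof -
  let ?S = "UNIV \<times> {0<..<T}"
  have oS: "open ?S" by (intro open_Times) auto
  have "continuous_on ?S (\<lambda>z. fst z - lower X \<delta> r (snd z))"
       "continuous_on ?S (\<lambda>z. upper X \<delta> r (snd z) - fst z)"
    by (auto intro!: continuous_intros continuous_on_compose2[OF continuous_bounds(1)]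
        continuous_on_compose2[OF continuous_bounds(2)])
  then have "open ((?S \<inter> (\<lambda>z. fst z - lower X \<delta> r (snd z)) -` {0<..}) \<inter>
      (?S \<inter> (\<lambda>z. upper X \<delta> r (snd z) - fst z) -` {0<..}))" (is "open ?U")
    by (intro open_Int continuous_open_preimage oS) auto
  moreover have "?U \<subseteq> reg r"
    using slice_bounds(2) by (auto simp: piece_def)
  ultimately have "?U \<subseteq> interior (reg r)" by (simp add: interior_maximal)
  moreover have "(x, t) \<in> ?U" using assms by auto
  ultimately show ?thesis by blast
qed

lemma piece_subset_closure_interior: "reg r \<subseteq> closure (interior (reg r))"
proof
  fix z assume "z \<in> reg r"
  then obtain x t where z: "z = (x, t)" "0 < t" "t < T" "x \<in> slice X \<delta> t r"
    by (auto simp: piece_def)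
  have "x \<in> closure {lower X \<delta> r t <..< upper X \<delta> r t}"
    using slice_bounds(1)[OF z(4)] lower_less_upper[OF z(2,3), of r] by simp
  have "\<exists>y\<in>interior (reg r). dist y z < e" if "e > 0" for e
  proof -
    obtain y where "y \<in> {lower X \<delta> r t <..< upper X \<delta> r t}" "dist y x < e"
      using \<open>x \<in> closure _\<close> \<open>e > 0\<close> unfolding closure_approachable by blast
    then show ?thesis
      using in_interior_piece[OF z(2,3), of r y] z(1)
      by (intro bexI[of _ "(y, t)"]) (auto simp: dist_Pair_Pair)
  qed
  then show "z \<in> closure (interior (reg r))" by (simp add: closure_approachable)
qed

lemma curve_in_pieces:
  assumes "0 < t" "t < T"
  shows "(X j t, t) \<in> reg (left_of j)" "(X j t, t) \<in> reg (right_of j)"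
  using assms curve_order[OF assms] by (cases j; auto simp: piece_def)+

lemma curve_tendsto_origin: "((\<lambda>t. (X j t, t)) \<longlongrightarrow> (0, 0)) (at_right 0)"
proof -
  have "at 0 within {0..<T} = at_right (0::real)"
    by (rule at_within_nhd[of _ "{..<T}"]) (use domain_pos in auto)
  then have "(X j \<longlongrightarrow> 0) (at_right 0)"
    using DERIV_continuous[OF curve_C1(1)[of 0 j]] domain_pos curve_origin[of j]
    by (simp add: continuous_within)
  then show ?thesis by (intro tendsto_intros)
qed

lemma eventually_time_small: "\<forall>\<^sub>F t in at_right 0. 0 < t \<and> t < T"
  by (rule eventually_at_rightI[of 0 T]) (use domain_pos in auto)

text \<open>Limits at the origin from inside a region are unique because a curve bounding the region runs into
the origin.\<close>

lemma origin_adherent: "at (0, 0) within interior (reg r) \<noteq> bot"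
proof -
  obtain j where j: "r = left_of j \<or> r = right_of j"
    by (metis left_of.simps right_of.simps region.exhaust)
  have "(0, 0) \<in> closure (reg r)"
  proof (rule Lim_in_closed_set[OF closed_closure _ _ curve_tendsto_origin[of j]])
    show "\<forall>\<^sub>F t in at_right 0. (X j t, t) \<in> closure (reg r)"
      using eventually_time_small by eventually_elim (use j curve_in_pieces closure_subset in blast)
  qed simp
  then have "(0, 0) \<in> closure (interior (reg r))"
    using piece_subset_closure_interior closure_minimal closed_closure by blast
  moreover have "(0, 0) \<notin> interior (reg r)"
    using interior_subset by (fastforce simp: piece_def)
  ultimately show ?thesis
    by (auto simp: closure_def trivial_limit_within)
qed

text \<open>The solution is differentiable within the closed region, with partial derivatives f1, f2 that are
continuous up to the bounding curves. There pdx and pdt, which look at both sides of the curve, are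
not the one-sided derivatives, so f1 and f2 are used in their place.\<close>

lemma solution_C1:
  obtains f1 f2 where
    "\<And>z. z \<in> reg r \<Longrightarrow>
      (V r has_derivative (\<lambda>h. fst h *\<^sub>R f1 z + snd h *\<^sub>R f2 z)) (at z within reg r)"
    "continuous_on (reg r) f1" "continuous_on (reg r) f2"
    "\<And>z. z \<in> interior (reg r) \<Longrightarrow> f1 z = pdx (V r) z \<and> f2 z = pdt (V r) z"
proof -
  obtain f1 f2 where f: "\<forall>z\<in>reg r.
      (V r has_derivative (\<lambda>h. fst h *\<^sub>R f1 z + snd h *\<^sub>R f2 z)) (at z within reg r)"
    "continuous_on (reg r) f1" "continuous_on (reg r) f2"
    using smooth[of r] by auto
  have eq: "f1 z = pdx (V r) z \<and> f2 z = pdt (V r) z" if z: "z \<in> interior (reg r)" for z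
  proof -
    have "(V r has_derivative (\<lambda>h. fst h *\<^sub>R f1 z + snd h *\<^sub>R f2 z)) (at z)"
      using f(1) z interior_subset at_within_interior[OF z] by force
    from has_derivative_plane_partials[OF this] show ?thesis
      unfolding pdx_def pdt_def by (simp add: vector_derivative_at)
  qed
  show ?thesis by (rule that[OF _ f(2,3) eq]) (use f(1) in blast)
qed

lemma solution_interior_derivative:
  assumes "z \<in> interior (reg r)"
  shows "(V r has_derivative (\<lambda>h. fst h *\<^sub>R pdx (V r) z + snd h *\<^sub>R pdt (V r) z)) (at z)"
proof (rule solution_C1[of r])
  fix f1 f2
  assume "\<And>z. z \<in> reg r \<Longrightarrow>
      (V r has_derivative (\<lambda>h. fst h *\<^sub>R f1 z + snd h *\<^sub>R f2 z)) (at z within reg r)"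
    and "\<And>z. z \<in> interior (reg r) \<Longrightarrow> f1 z = pdx (V r) z \<and> f2 z = pdt (V r) z"
  from this(1)[of z] this(2)[of z] show ?thesis
    using assms interior_subset at_within_interior[OF assms] by force
qed

lemma primitive_interior:
  assumes "z \<in> interior (reg r)"
  shows "primitive_eqs (deriv W (fst z)) (V r z) (pdt (V r) z) (pdx (V r) z)"
proof (rule conservative_imp_primitive[OF solution_interior_derivative[OF assms] _ equations[OF assms]])
  show "admissible (V r z)"
    using assms interior_subset[of "reg r"] by (intro state_admissible[of _ r]) auto
qed

lemma limits_interior: "r \<noteq> Fan \<Longrightarrow> (V r \<longlongrightarrow> V0 r) (at (0, 0) within interior (reg r))"
  using tendsto_within_subset[OF limits(1) interior_subset] .

lemma primitive_origin:
  assumes r: "r \<noteq> Fan" and adm: "admissible (V0 r)"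
  shows "primitive_eqs (deriv W 0) (V0 r) (Vt0 r) (Vx0 r)"
proof -
  let ?F = "at (0, 0) within interior (reg r)"
  note lims = limits_interior[OF r] limits(2,3)[OF r]
  have "((\<lambda>z. deriv W (fst z)) \<longlongrightarrow> deriv W (fst (0::real, 0::real))) ?F"
    using potential(2) continuous_on_eq_continuous_at[OF open_UNIV]
    by (intro isCont_tendsto_compose[of _ "deriv W"] tendsto_intros tendsto_ident_at) auto
  then have lw: "((\<lambda>z. deriv W (fst z)) \<longlongrightarrow> deriv W 0) ?F" by simp
  have ev: "\<forall>\<^sub>F z in ?F. primitive_eqs (deriv W (fst z)) (V r z) (pdt (V r) z) (pdx (V r) z)"
    using primitive_interior by (auto simp: eventually_at intro!: exI[of _ 1])
  have unique: "a = 0" if "\<forall>\<^sub>F z in ?F. f z = 0" "(f \<longlongrightarrow> a) ?F" for f and a :: real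
    using tendsto_unique[OF origin_adherent that(2)] tendsto_eventually[OF that(1)] by simp
  have rho0: "rho (V0 r) \<noteq> 0" using adm by (simp add: admissible_def)
  have "rho (Vt0 r) + u1 (V0 r) * rho (Vx0 r) + rho (V0 r) * u1 (Vx0 r) = 0"
  proof (rule unique)
    show "\<forall>\<^sub>F z in ?F. rho (pdt (V r) z) + u1 (V r z) * rho (pdx (V r) z) + rho (V r z) * u1 (pdx (V r) z) = 0"
      using ev by eventually_elim (simp add: primitive_eqs_def)
  qed (intro tendsto_intros lims)
  moreover have "u1 (Vt0 r) + u1 (V0 r) * u1 (Vx0 r) + p11 (Vx0 r) / rho (V0 r) + deriv W 0 / 2 = 0"
  proof (rule unique)
    show "\<forall>\<^sub>F z in ?F. u1 (pdt (V r) z) + u1 (V r z) * u1 (pdx (V r) z) + p11 (pdx (V r) z) / rho (V r z) + deriv W (fst z) / 2 = 0"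
      using ev by eventually_elim (simp add: primitive_eqs_def)
  qed (intro tendsto_intros lims lw rho0, simp)
  moreover have "p11 (Vt0 r) + u1 (V0 r) * p11 (Vx0 r) + 3 * p11 (V0 r) * u1 (Vx0 r) = 0"
  proof (rule unique)
    show "\<forall>\<^sub>F z in ?F. p11 (pdt (V r) z) + u1 (V r z) * p11 (pdx (V r) z) + 3 * p11 (V r z) * u1 (pdx (V r) z) = 0"
      using ev by eventually_elim (simp add: primitive_eqs_def)
  qed (intro tendsto_intros lims)
  ultimately show ?thesis by (simp add: primitive_eqs_def)
qed

lemma middle_material_derivatives:
  assumes "r \<in> middle"
  shows "Du = u1 (Vt0 r) + us * u1 (Vx0 r)" "Dp = p11 (Vt0 r) + us * p11 (Vx0 r)"
proof -
  have r: "r \<noteq> Fan" using assms by (auto simp: middle_def)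
  note lims = limits_interior[OF r] limits(2,3)[OF r]
  have us: "u1 (V0 r) = us" using middle_states(1)[OF assms] by simp
  show "Du = u1 (Vt0 r) + us * u1 (Vx0 r)"
    by (rule tendsto_unique[OF origin_adherent middle_material(1)[OF assms]], unfold us[symmetric])
      (intro tendsto_intros lims)
  show "Dp = p11 (Vt0 r) + us * p11 (Vx0 r)"
    by (rule tendsto_unique[OF origin_adherent middle_material(2)[OF assms]], unfold us[symmetric])
      (intro tendsto_intros lims)
qed

lemma outer_left: "V0 Lft = VL" "Vx0 Lft = VL'"
proof -
  have bot: "at 0 within {-\<delta><..<0} \<noteq> (bot :: real filter)"
    using domain_pos by (auto simp: trivial_limit_within islimpt_greaterThanLessThan2)
  have seg: "\<forall>\<^sub>F t in at_right 0. closed_segment x y \<times> {t} \<subseteq> interior (reg Lft)"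
    if "x \<in> {-\<delta><..<0}" "y \<in> {-\<delta><..<0}" for x y
  proof -
    have "((\<lambda>t. X Head t) \<longlongrightarrow> 0) (at_right 0)"
      using tendsto_fst[OF curve_tendsto_origin[of Head]] by simp
    then have "\<forall>\<^sub>F t in at_right 0. max x y < X Head t"
      by (rule order_tendstoD) (use that in auto)
    with eventually_time_small show ?thesis
      by eventually_elim (use that in \<open>auto simp: closed_segment_eq_real_ivl
          intro!: in_interior_piece split: if_splits\<close>)
  qed
  show "V0 Lft = VL" "Vx0 Lft = VL'"
    using initial_data_limits[of "{-\<delta><..<0}" "V Lft" VL VL' "interior (reg Lft)"
        "pdx (V Lft)" "pdt (V Lft)" "V0 Lft" "Vx0 Lft"]
      bot seg initial_left solution_interior_derivative limits_interior[of Lft] limits(2)[of Lft]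
    by auto
qed

lemma outer_right: "V0 Rgt = VR" "Vx0 Rgt = VR'"
proof -
  have bot: "at 0 within {0<..<\<delta>} \<noteq> (bot :: real filter)"
    using domain_pos by (auto simp: trivial_limit_within islimpt_greaterThanLessThan1)
  have seg: "\<forall>\<^sub>F t in at_right 0. closed_segment x y \<times> {t} \<subseteq> interior (reg Rgt)"
    if "x \<in> {0<..<\<delta>}" "y \<in> {0<..<\<delta>}" for x y
  proof -
    have "((\<lambda>t. X Shock6 t) \<longlongrightarrow> 0) (at_right 0)"
      using tendsto_fst[OF curve_tendsto_origin[of Shock6]] by simp
    then have "\<forall>\<^sub>F t in at_right 0. X Shock6 t < min x y"
      by (rule order_tendstoD) (use that in auto)
    with eventually_time_small show ?thesis
      by eventually_elim (use that in \<open>auto simp: closed_segment_eq_real_ivl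
          intro!: in_interior_piece split: if_splits\<close>)
  qed
  show "V0 Rgt = VR" "Vx0 Rgt = VR'"
    using initial_data_limits[of "{0<..<\<delta>}" "V Rgt" VR VR' "interior (reg Rgt)"
        "pdx (V Rgt)" "pdt (V Rgt)" "V0 Rgt" "Vx0 Rgt"]
      bot seg initial_right solution_interior_derivative limits_interior[of Rgt] limits(2)[of Rgt]
    by auto
qed

text \<open>The value at time 0 is the limit of the state at the origin, which makes the trace continuous
there.\<close>

definition curve_trace :: "region \<Rightarrow> curve \<Rightarrow> real \<Rightarrow> real^6" where
  "curve_trace r j t = (if t = 0 then V0 r else V r (X j t, t))"

lemma curve_trace_derivative:
  assumes r: "r \<noteq> Fan" and j: "r = left_of j \<or> r = right_of j"
  shows "(curve_trace r j has_vector_derivative Vt0 r + sp j 0 *\<^sub>R Vx0 r) (at 0 within {0..<T})"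
proof (rule solution_C1[of r])
  fix f1 f2
  assume f: "\<And>z. z \<in> reg r \<Longrightarrow>
      (V r has_derivative (\<lambda>h. fst h *\<^sub>R f1 z + snd h *\<^sub>R f2 z)) (at z within reg r)"
    "continuous_on (reg r) f1" "continuous_on (reg r) f2"
    and eq: "\<And>z. z \<in> interior (reg r) \<Longrightarrow> f1 z = pdx (V r) z \<and> f2 z = pdt (V r) z"
  have ev: "\<forall>\<^sub>F z in at (0, 0) within interior (reg r). f1 z = pdx (V r) z \<and> f2 z = pdt (V r) z"
    using eq by (auto simp: eventually_at intro!: exI[of _ 1])
  have "(f1 \<longlongrightarrow> Vx0 r) (at (0, 0) within interior (reg r))"
    by (rule Lim_transform_eventually[OF limits(2)[OF r]]) (use ev in \<open>auto elim!: eventually_mono\<close>)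
  moreover have "(f2 \<longlongrightarrow> Vt0 r) (at (0, 0) within interior (reg r))"
    by (rule Lim_transform_eventually[OF limits(3)[OF r]]) (use ev in \<open>auto elim!: eventually_mono\<close>)
  ultimately have "(f1 \<longlongrightarrow> Vx0 r) (at (0, 0) within reg r)" "(f2 \<longlongrightarrow> Vt0 r) (at (0, 0) within reg r)"
    by (auto intro: tendsto_within_from_interior[OF _ f(2) piece_subset_closure_interior]
        tendsto_within_from_interior[OF _ f(3) piece_subset_closure_interior])
  from trace_has_vector_derivative[OF domain_pos(2) f(1) limits(1)[OF r] this
      curve_C1(1)[of _ j] curve_C1(2)[of j] curve_origin[of j]]
  show ?thesis
    using curve_in_pieces[of _ j] j unfolding curve_trace_def by blast
qed

end


section \<open>Differentiating the jump relations along the shock\<close>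

lemma vector_derivative_eq_if_eventually_eq:
  fixes f g :: "real \<Rightarrow> 'a::real_normed_vector"
  assumes bot: "at a within S \<noteq> bot" and a: "a \<in> S"
    and f: "(f has_vector_derivative f') (at a within S)"
    and g: "(g has_vector_derivative g') (at a within S)"
    and eq: "\<forall>\<^sub>F x in at a within S. f x = g x"
  shows "f a = g a" "f' = g'"
proof -
  have lim: "(f \<longlongrightarrow> f a) (at a within S)" "(g \<longlongrightarrow> g a) (at a within S)"
    using f g has_vector_derivative_continuous by (auto simp: continuous_within)
  have "(f \<longlongrightarrow> g a) (at a within S)"
    by (rule Lim_transform_eventually[OF lim(2)]) (use eq in \<open>auto elim!: eventually_mono\<close>)
  with lim(1) show fg: "f a = g a" using bot tendsto_unique by blast
  have "(f has_vector_derivative g') (at a within S)"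
    using has_derivative_transform_eventually[OF g[unfolded has_vector_derivative_def], of f] eq fg a
    by (simp add: has_vector_derivative_def eq_commute)
  then show "f' = g'" using vector_derivative_unique_within[OF bot f] by blast
qed

text \<open>The coefficients are the partial derivatives of (p - q) / sqrt (r (2 p + q)) with respect to the
pressure p behind the shock, the pressure q ahead and the density r ahead.\<close>

lemma shock_velocity_jump_derivative:
  fixes p q r :: "real \<Rightarrow> real"
  assumes der: "(p has_real_derivative p') (at t within S)" "(q has_real_derivative q') (at t within S)"
      "(r has_real_derivative r') (at t within S)"
    and pos: "p t > 0" "q t > 0" "r t > 0"
    and Lam: "Lam = 1 / sqrt (r t * (2 * p t + q t))"
  shows "((\<lambda>t. (p t - q t) / sqrt (r t * (2 * p t + q t))) has_real_derivative
      (p t + 2 * q t) / (2 * p t + q t) * Lam * p'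
      + - ((5 * p t + q t) / (4 * p t + 2 * q t)) * Lam * q'
      + (q t - p t) / (2 * r t) * Lam * r') (at t within S)"
proof -
  define N N' where "N = r t * (2 * p t + q t)" and "N' = r' * (2 * p t + q t) + r t * (2 * p' + q')"
  have N: "N > 0" using pos by (simp add: N_def)
  have dN: "((\<lambda>t. r t * (2 * p t + q t)) has_real_derivative N') (at t within S)"
    unfolding N'_def by (auto intro!: derivative_eq_intros der)
  have ds: "((\<lambda>t. sqrt (r t * (2 * p t + q t))) has_real_derivative inverse (sqrt N) / 2 * N') (at t within S)"
    using DERIV_chain2[OF DERIV_real_sqrt dN] N by (simp add: N_def)
  have D: "((\<lambda>t. (p t - q t) / sqrt (r t * (2 * p t + q t))) has_real_derivative
     ((p' - q') * sqrt N - (p t - q t) * (inverse (sqrt N) / 2 * N')) / (sqrt N * sqrt N)) (at t within S)"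
    unfolding N_def
    by (rule DERIV_divide[OF DERIV_diff[OF der(1,2)] ds[unfolded N_def]]) (use N in \<open>simp add: N_def[symmetric]\<close>)
  have e1: "((p' - q') * sqrt N - (p t - q t) * (inverse (sqrt N) / 2 * N')) / (sqrt N * sqrt N)
      = Lam * ((p' - q') - (p t - q t) * N' / (2 * N))"
  proof -
    define s where "s = sqrt N"
    have s: "sqrt N = s" "N = s * s" "s > 0" "Lam = 1 / s" using N Lam by (auto simp: N_def s_def)
    show ?thesis unfolding s(1,4) unfolding s(2) using s(3) by (simp add: field_simps)
  qed
  have e2: "(p' - q') - (p t - q t) * N' / (2 * N) =
      (p t + 2 * q t) / (2 * p t + q t) * p' - (5 * p t + q t) / (4 * p t + 2 * q t) * q'
      + (q t - p t) / (2 * r t) * r'"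
  proof -
    define P where "P = 2 * p t + q t"
    have P: "P > 0" "4 * p t + 2 * q t = 2 * P" "q t = P - 2 * p t" using pos by (auto simp: P_def)
    show ?thesis unfolding N_def N'_def P_def[symmetric] P(2) using P(1) pos(3)
      unfolding P(3) by (simp add: field_simps)
  qed
  show ?thesis by (rule DERIV_cong[OF D], unfold e1 e2) (simp add: algebra_simps)
qed

lemma shock_density_derivative:
  fixes p q r :: "real \<Rightarrow> real"
  assumes der: "(p has_real_derivative p') (at t within S)" "(q has_real_derivative q') (at t within S)"
      "(r has_real_derivative r') (at t within S)"
    and pos: "p t > 0" "q t > 0" "r t > 0"
  shows "((\<lambda>t. r t * (2 * p t + q t) / (p t + 2 * q t)) has_real_derivative
      3 * r t * q t / (p t + 2 * q t)\<^sup>2 * p' + - (3 * r t * p t / (p t + 2 * q t)\<^sup>2) * q'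
      + (2 * p t + q t) / (p t + 2 * q t) * r') (at t within S)"
proof -
  define Q where "Q = p t + 2 * q t"
  have Q: "Q > 0" "p t = Q - 2 * q t" using pos by (auto simp: Q_def)
  have "((\<lambda>t. r t * (2 * p t + q t) / (p t + 2 * q t)) has_real_derivative
      ((r' * (2 * p t + q t) + r t * (2 * p' + q')) * Q
        - r t * (2 * p t + q t) * (p' + 2 * q')) / Q\<^sup>2) (at t within S)"
    using Q(1) pos by (auto intro!: derivative_eq_intros der simp: Q_def power2_eq_square mult.commute)
  moreover have "((r' * (2 * p t + q t) + r t * (2 * p' + q')) * Q
        - r t * (2 * p t + q t) * (p' + 2 * q')) / Q\<^sup>2 =
      3 * r t * q t / Q\<^sup>2 * p' + - (3 * r t * p t / Q\<^sup>2) * q' + (2 * p t + q t) / Q * r'"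
    unfolding Q(2) using Q(1) by (simp add: field_simps power2_eq_square)
  ultimately show ?thesis by (simp add: Q_def)
qed

context grp_configuration
begin

lemma shock_speed_gap: "\<sigma>R - u1 VR > 0"
proof -
  have "ps > 0" "p11 VR > 0" "rho VR > 0" using shock(1) data_admissible by (auto simp: admissible_def)
  then show ?thesis using shock(2) by simp
qed

text \<open>The inequalities that select the branch of the Hugoniot curve hold at the origin, hence by
continuity for all small times.\<close>

lemma shock_trace_relations:
  "\<forall>\<^sub>F t in at 0 within {0..<T}.
     u1 (curve_trace StarR Shock6 t) = u1 (curve_trace Rgt Shock6 t) +
       (p11 (curve_trace StarR Shock6 t) - p11 (curve_trace Rgt Shock6 t))
         / sqrt (rho (curve_trace Rgt Shock6 t) * (2 * p11 (curve_trace StarR Shock6 t) + p11 (curve_trace Rgt Shock6 t))) \<and>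
     rho (curve_trace StarR Shock6 t) = rho (curve_trace Rgt Shock6 t) *
       (2 * p11 (curve_trace StarR Shock6 t) + p11 (curve_trace Rgt Shock6 t))
         / (p11 (curve_trace StarR Shock6 t) + 2 * p11 (curve_trace Rgt Shock6 t))"
proof -
  let ?F = "at 0 within {0..<T}" and ?l = "curve_trace StarR Shock6" and ?r = "curve_trace Rgt Shock6"
  have lim: "(?l \<longlongrightarrow> V0 StarR) ?F" "(?r \<longlongrightarrow> VR) ?F"
    using has_vector_derivative_continuous[OF curve_trace_derivative[of StarR Shock6]]
      has_vector_derivative_continuous[OF curve_trace_derivative[of Rgt Shock6]] outer_right
    by (auto simp: continuous_within curve_trace_def)
  have "(sp Shock6 \<longlongrightarrow> \<sigma>R) ?F"
    using curve_C1(2)[of Shock6] domain_pos shock(3) by (auto simp: continuous_on_def)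
  then have "\<forall>\<^sub>F t in ?F. sp Shock6 t - u1 (?r t) > 0"
    by (intro order_tendstoD(1)[OF _ shock_speed_gap] tendsto_intros lim)
  moreover have "\<forall>\<^sub>F t in ?F. p11 (?l t) - p11 (?r t) > 0"
    by (rule order_tendstoD(1)[OF tendsto_diff[OF tendsto_vec_nth[OF lim(1)] tendsto_vec_nth[OF lim(2)]]])
      (use shock(1) middle_states(1)[of StarR] in \<open>auto simp: middle_def\<close>)
  moreover have "\<forall>\<^sub>F t in ?F. 0 < t \<and> t < T" by (auto simp: eventually_at intro!: exI[of _ 1])
  ultimately show ?thesis
  proof eventually_elim
    case (elim t)
    have tr: "?l t = V StarR (X Shock6 t, t)" "?r t = V Rgt (X Shock6 t, t)"
      using elim by (auto simp: curve_trace_def)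
    have adm: "admissible (?l t)" "admissible (?r t)"
      unfolding tr using elim curve_in_pieces[of t Shock6] state_admissible by auto
    have "rankine_hugoniot (sp Shock6 t) (?l t) (?r t)"
      unfolding tr using jump_conditions[of Shock6 t] elim by simp
    from shock_relations[OF this adm] show ?case using elim by simp
  qed
qed

lemma shock_derivatives:
  fixes dl dr :: "real^6"
  defines "dl \<equiv> Vt0 StarR + \<sigma>R *\<^sub>R Vx0 StarR" and "dr \<equiv> Vt0 Rgt + \<sigma>R *\<^sub>R VR'"
  assumes Lam: "Lam = 1 / sqrt (rho VR * (2 * ps + p11 VR))"
  shows "u1 dl = u1 dr + ((ps + 2 * p11 VR) / (2 * ps + p11 VR) * Lam * p11 dl
      + - ((5 * ps + p11 VR) / (4 * ps + 2 * p11 VR)) * Lam * p11 dr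
      + (p11 VR - ps) / (2 * rho VR) * Lam * rho dr)"
    and "rho dl = 3 * rho VR * p11 VR / (ps + 2 * p11 VR)\<^sup>2 * p11 dl
      + - (3 * rho VR * ps / (ps + 2 * p11 VR)\<^sup>2) * p11 dr
      + (2 * ps + p11 VR) / (ps + 2 * p11 VR) * rho dr"
proof -
  let ?F = "at 0 within {0..<T}" and ?l = "curve_trace StarR Shock6" and ?r = "curve_trace Rgt Shock6"
  have der: "(?l has_vector_derivative dl) ?F" "(?r has_vector_derivative dr) ?F"
    using curve_trace_derivative[of StarR Shock6] curve_trace_derivative[of Rgt Shock6]
    by (auto simp: dl_def dr_def shock(3) outer_right)
  note dln = has_vector_derivative_vec_nth[OF der(1)] and drn = has_vector_derivative_vec_nth[OF der(2)]
  have val: "p11 (?l 0) = ps" "?r 0 = VR"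
    using middle_states(1)[of StarR] outer_right by (auto simp: middle_def curve_trace_def)
  have pos: "ps > 0" "p11 VR > 0" "rho VR > 0"
    using shock(1) data_admissible by (auto simp: admissible_def)
  have bot: "?F \<noteq> bot"
  proof -
    have "?F = at_right (0::real)"
      by (rule at_within_nhd[of _ "{..<T}"]) (use domain_pos in auto)
    then show ?thesis by simp
  qed
  have uniq: "a = b" if "(f has_real_derivative a) ?F" "(g has_real_derivative b) ?F"
      "\<forall>\<^sub>F t in ?F. f t = g t" for f g a b
    using vector_derivative_eq_if_eventually_eq(2)[OF bot _ _ _ that(3)] that(1,2) domain_pos
    by (simp add: has_real_derivative_iff_has_vector_derivative)
  show "u1 dl = u1 dr + ((ps + 2 * p11 VR) / (2 * ps + p11 VR) * Lam * p11 dl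
      + - ((5 * ps + p11 VR) / (4 * ps + 2 * p11 VR)) * Lam * p11 dr
      + (p11 VR - ps) / (2 * rho VR) * Lam * rho dr)"
    by (rule uniq[OF dln DERIV_add[OF drn shock_velocity_jump_derivative[OF dln drn drn, of 4 4 1 Lam, unfolded val]]])
      (use shock_trace_relations pos Lam in \<open>auto elim!: eventually_mono\<close>)
  show "rho dl = 3 * rho VR * p11 VR / (ps + 2 * p11 VR)\<^sup>2 * p11 dl
      + - (3 * rho VR * ps / (ps + 2 * p11 VR)\<^sup>2) * p11 dr
      + (2 * ps + p11 VR) / (ps + 2 * p11 VR) * rho dr"
    by (rule uniq[OF dln shock_density_derivative[OF dln drn drn, of 4 4 1, unfolded val]])
      (use shock_trace_relations pos in \<open>auto elim!: eventually_mono\<close>)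
qed

end


section \<open>Evolution of gradients along the edge of a centred fan\<close>

lemma Ck_on_cong:
  assumes "Ck_on k A f" "\<And>z. z \<in> A \<Longrightarrow> f z = g z"
  shows "Ck_on k A g"
proof (cases k)
  case 0
  then show ?thesis using assms continuous_on_cong[of A A f g] by simp
next
  case (Suc n)
  then obtain f1 f2 where f: "\<forall>z\<in>A. (f has_derivative (\<lambda>h. fst h *\<^sub>R f1 z + snd h *\<^sub>R f2 z)) (at z within A)"
     "Ck_on n A f1" "Ck_on n A f2" using assms(1) by auto
  then have "\<forall>z\<in>A. (g has_derivative (\<lambda>h. fst h *\<^sub>R f1 z + snd h *\<^sub>R f2 z)) (at z within A)"
    using assms(2) has_derivative_transform[of _ A g f] by auto
  then show ?thesis using f Suc by auto
qed

lemma partials_in_rectangle: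
  fixes f :: "real \<times> real \<Rightarrow> 'a::real_normed_vector"
  assumes "(f has_derivative (\<lambda>h. fst h *\<^sub>R fa + snd h *\<^sub>R fb)) (at (\<alpha>, \<beta>) within A \<times> B)"
    and "\<alpha> \<in> A" "\<beta> \<in> B"
  shows "((\<lambda>a. f (a, \<beta>)) has_vector_derivative fa) (at \<alpha> within A)"
    and "((\<lambda>b. f (\<alpha>, b)) has_vector_derivative fb) (at \<beta> within B)"
proof -
  have 1: "((\<lambda>a. (a, \<beta>)) has_derivative (\<lambda>h. (h, 0))) (at \<alpha> within A)"
   and 2: "((\<lambda>b. (\<alpha>, b)) has_derivative (\<lambda>h. (0, h))) (at \<beta> within B)"
    by (auto intro!: derivative_eq_intros)
  show "((\<lambda>a. f (a, \<beta>)) has_vector_derivative fa) (at \<alpha> within A)"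
    using has_derivative_in_compose[OF 1 has_derivative_subset[OF assms(1)]] assms
    by (auto simp: has_vector_derivative_def)
  show "((\<lambda>b. f (\<alpha>, b)) has_vector_derivative fb) (at \<beta> within B)"
    using has_derivative_in_compose[OF 2 has_derivative_subset[OF assms(1)]] assms
    by (auto simp: has_vector_derivative_def)
qed

lemma at_within_Icc_not_bot:
  "a < b \<Longrightarrow> x \<in> {a..b} \<Longrightarrow> at x within {a..b} \<noteq> (bot :: real filter)"
  by (auto simp: trivial_limit_within islimpt_Icc)

text \<open>Here tau, s, r are the alpha-derivatives of tt, S1, psi1 on the edge, m is the mixed second
derivative of tt, and S and \<open>\<Psi>\<close> are the limits of the x-derivatives of S1 and psi1. The
equations for tau and beta * tau, which is the alpha-derivative of xx, give 2 c m = tau, hence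
tau * c is a constant k; together with c' = -1/2 this makes s / c constant, and S = - s / k.
With K S = A c the equation for r becomes r' = k (A c^3 - w/2) / (2 c^2), and solving the formula
for r for \<open>\<Psi>\<close> shows that the terms with w cancel in the derivative of \<open>\<Psi>\<close>, which is that
of (3/4) A c^2.\<close>

lemma fan_gradients_at_origin:
  fixes \<tau> m c S \<Psi> s r :: "real \<Rightarrow> real"
  assumes b: "b0 < b1" and c: "\<And>\<beta>. \<beta> \<in> {b0..b1} \<Longrightarrow> 0 < c \<beta> \<and> 2 * c \<beta> = \<psi> - \<beta>"
    and \<tau>: "\<And>\<beta>. \<beta> \<in> {b0..b1} \<Longrightarrow> \<tau> \<beta> \<noteq> 0"
    and d\<tau>: "\<And>\<beta>. \<beta> \<in> {b0..b1} \<Longrightarrow> (\<tau> has_real_derivative m \<beta>) (at \<beta> within {b0..b1})"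
    and dx: "\<And>\<beta>. \<beta> \<in> {b0..b1} \<Longrightarrow>
      ((\<lambda>\<beta>. \<beta> * \<tau> \<beta>) has_real_derivative m \<beta> * \<psi>) (at \<beta> within {b0..b1})"
    and s: "\<And>\<beta>. \<beta> \<in> {b0..b1} \<Longrightarrow> s \<beta> = - c \<beta> * \<tau> \<beta> * S \<beta>"
    and ds: "\<And>\<beta>. \<beta> \<in> {b0..b1} \<Longrightarrow>
      (s has_real_derivative m \<beta> * (c \<beta> * S \<beta>)) (at \<beta> within {b0..b1})"
    and r: "\<And>\<beta>. \<beta> \<in> {b0..b1} \<Longrightarrow>
      r \<beta> = \<tau> \<beta> * (- 2 * c \<beta> * \<Psi> \<beta> + K * (c \<beta>)\<^sup>2 * S \<beta> - w / 2)"
    and dr: "\<And>\<beta>. \<beta> \<in> {b0..b1} \<Longrightarrow>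
      (r has_real_derivative m \<beta> * (K * (c \<beta>)\<^sup>2 * S \<beta> - w / 2)) (at \<beta> within {b0..b1})"
    and A: "A = K * S b0 / c b0"
  shows "S b1 / c b1 = S b0 / c b0"
    and "\<Psi> b1 - 3 / 4 * A * (c b1)\<^sup>2 = \<Psi> b0 - 3 / 4 * A * (c b0)\<^sup>2"
proof -
  let ?I = "{b0..b1}"
  have b01: "b0 \<in> ?I" "b1 \<in> ?I" using b by auto
  have const: "f b1 = f b0" if "\<And>\<beta>. \<beta> \<in> ?I \<Longrightarrow> (f has_real_derivative 0) (at \<beta> within ?I)" for f
    using has_field_derivative_zero_constant[OF convex_real_interval(5) that] b01 by metis
  have const': "f \<beta> = f b0" if "\<beta> \<in> ?I" "\<And>\<beta>. \<beta> \<in> ?I \<Longrightarrow> (f has_real_derivative 0) (at \<beta> within ?I)" for f \<beta>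
    using has_field_derivative_zero_constant[OF convex_real_interval(5) that(2)] b01 that(1) by metis
  have dc: "(c has_real_derivative - 1 / 2) (at \<beta> within ?I)" if "\<beta> \<in> ?I" for \<beta>
  proof -
    have "((\<lambda>\<beta>. (\<psi> - \<beta>) / 2) has_real_derivative - 1 / 2) (at \<beta> within ?I)"
      by (auto intro!: derivative_eq_intros)
    then show ?thesis
      by (rule has_field_derivative_transform_within[OF _ zero_less_one that]) (use c in force)
  qed
  \<comment> \<open>Compare the two derivatives of beta * tau.\<close>
  have m: "2 * c \<beta> * m \<beta> = \<tau> \<beta>" if \<beta>: "\<beta> \<in> ?I" for \<beta>
  proof -
    have "((\<lambda>\<beta>. \<beta> * \<tau> \<beta>) has_real_derivative \<tau> \<beta> + \<beta> * m \<beta>) (at \<beta> within ?I)"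
      by (auto intro!: derivative_eq_intros d\<tau> \<beta>)
    with dx[OF \<beta>] have "m \<beta> * \<psi> = \<tau> \<beta> + \<beta> * m \<beta>"
      using vector_derivative_unique_within[OF at_within_Icc_not_bot[OF b \<beta>]]
      by (metis has_real_derivative_iff_has_vector_derivative)
    moreover have "2 * c \<beta> = \<psi> - \<beta>" using c[OF \<beta>] by simp
    ultimately show ?thesis by algebra
  qed
  define k where "k = \<tau> b0 * c b0"
  have k: "\<tau> \<beta> * c \<beta> = k" if "\<beta> \<in> ?I" for \<beta>
    unfolding k_def
  proof (rule const'[OF that])
    fix \<beta> assume \<beta>: "\<beta> \<in> ?I"
    show "((\<lambda>\<beta>. \<tau> \<beta> * c \<beta>) has_real_derivative 0) (at \<beta> within ?I)"
      using m[OF \<beta>] by (auto intro!: derivative_eq_intros d\<tau> dc \<beta> simp: mult_ac)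
  qed
  have k0: "k \<noteq> 0" using c b01 \<tau> by (force simp: k_def)
  have S: "S \<beta> = - s \<beta> / k" if "\<beta> \<in> ?I" for \<beta>
    using s[OF that] k[OF that] k0 by (simp add: field_simps)
  have ratio: "S \<beta> / c \<beta> = S b0 / c b0" if "\<beta> \<in> ?I" for \<beta>
  proof -
    have "s \<beta> / c \<beta> = s b0 / c b0"
    proof (rule const'[OF that])
      fix \<beta> assume \<beta>: "\<beta> \<in> ?I"
      have "c \<beta> \<noteq> 0" using c[OF \<beta>] by simp
      moreover have "m \<beta> * (c \<beta> * S \<beta>) * c \<beta> - s \<beta> * (- 1 / 2) = 0"
        unfolding s[OF \<beta>] m[OF \<beta>, symmetric] by simp
      ultimately show "((\<lambda>\<beta>. s \<beta> / c \<beta>) has_real_derivative 0) (at \<beta> within ?I)"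
        using DERIV_divide[OF ds[OF \<beta>] dc[OF \<beta>]] by simp
    qed
    moreover have "S \<gamma> / c \<gamma> = - (s \<gamma> / c \<gamma>) / k" if "\<gamma> \<in> ?I" for \<gamma>
      by (simp add: S[OF that] mult.commute)
    ultimately show ?thesis using that b01(1) by metis
  qed
  then show "S b1 / c b1 = S b0 / c b0" using b01 by blast
  have KS: "K * S \<beta> = A * c \<beta>" if "\<beta> \<in> ?I" for \<beta>
    using ratio[OF that] c[OF that] by (simp add: A field_simps)
  have \<Psi>: "\<Psi> \<beta> = (A * (c \<beta>)\<^sup>2 - w / (2 * c \<beta>)) / 2 - r \<beta> / (2 * k)" if "\<beta> \<in> ?I" for \<beta>
  proof -
    have "r \<beta> * c \<beta> = k * (- 2 * c \<beta> * \<Psi> \<beta> + A * (c \<beta>)^3 - w / 2)"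
      using r[OF that] k[OF that] KS[OF that] by algebra
    moreover have "c \<beta> > 0" using c[OF that] by simp
    ultimately show ?thesis using k0 by (simp add: field_simps power2_eq_square power3_eq_cube)
  qed
  define D where "D = (\<lambda>\<beta>. (A * (c \<beta>)\<^sup>2 - w / (2 * c \<beta>)) / 2 - r \<beta> / (2 * k) - 3 / 4 * A * (c \<beta>)\<^sup>2)"
  have "D b1 = D b0"
  proof (rule const)
    fix \<beta> assume \<beta>: "\<beta> \<in> ?I"
    have cp: "c \<beta> > 0" using c[OF \<beta>] by simp
    have mk: "m \<beta> = k / (2 * (c \<beta>)\<^sup>2)"
      using m[OF \<beta>] k[OF \<beta>] cp by (simp add: field_simps power2_eq_square)
    have rr: "K * (c \<beta>)\<^sup>2 * S \<beta> = A * (c \<beta>)^3"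
      using KS[OF \<beta>] by algebra
    note dr' = dr[OF \<beta>, unfolded rr mk]
    show "(D has_real_derivative 0) (at \<beta> within ?I)"
      unfolding D_def
      by (auto intro!: derivative_eq_intros dc[OF \<beta>] dr' simp: cp cp[THEN less_imp_neq, symmetric])
        (use cp k0 in \<open>simp_all add: field_simps power2_eq_square power3_eq_cube\<close>)
  qed
  then show "\<Psi> b1 - 3 / 4 * A * (c b1)\<^sup>2 = \<Psi> b0 - 3 / 4 * A * (c b0)\<^sup>2"
    using \<Psi>[OF b01(1)] \<Psi>[OF b01(2)] by (simp add: D_def)
qed

lemma dS1_linear:
  "dS1 v (a *\<^sub>R g + b *\<^sub>R h) = a * dS1 v g + b * dS1 v h"
  by (simp add: dS1_def algebra_simps add_divide_distrib diff_divide_distrib)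

lemma dpsi1_linear:
  "dpsi1 v (a *\<^sub>R g + b *\<^sub>R h) = a * dpsi1 v g + b * dpsi1 v h"
  by (simp add: dpsi1_def algebra_simps add_divide_distrib diff_divide_distrib)

context grp_configuration
begin

text \<open>One-sided partial derivatives in characteristic coordinates, taken within the rectangle so that
they are also meaningful on its edges.\<close>

definition d\<alpha> :: "(real \<times> real \<Rightarrow> 'a::real_normed_vector) \<Rightarrow> real \<times> real \<Rightarrow> 'a" where
  "d\<alpha> f z = vector_derivative (\<lambda>a. f (a, snd z)) (at (fst z) within {-\<alpha>0..0})"

definition d\<beta> :: "(real \<times> real \<Rightarrow> 'a::real_normed_vector) \<Rightarrow> real \<times> real \<Rightarrow> 'a" where
  "d\<beta> f z = vector_derivative (\<lambda>b. f (fst z, b)) (at (snd z) within {\<beta>L..\<beta>sL})"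

lemma rect_iff: "(\<alpha>, \<beta>) \<in> rect \<longleftrightarrow> \<alpha> \<in> {-\<alpha>0..0} \<and> \<beta> \<in> {\<beta>L..\<beta>sL}"
  unfolding rect_def by auto

lemma fan_partials:
  fixes f :: "real \<times> real \<Rightarrow> 'a::real_normed_vector"
  assumes f: "Ck_on (Suc k) rect f"
  shows "Ck_on k rect (d\<alpha> f)" "Ck_on k rect (d\<beta> f)" "continuous_on rect f"
    and "(\<alpha>, \<beta>) \<in> rect \<Longrightarrow>
      ((\<lambda>a. f (a, \<beta>)) has_vector_derivative d\<alpha> f (\<alpha>, \<beta>)) (at \<alpha> within {-\<alpha>0..0})"
    and "(\<alpha>, \<beta>) \<in> rect \<Longrightarrow>
      ((\<lambda>b. f (\<alpha>, b)) has_vector_derivative d\<beta> f (\<alpha>, \<beta>)) (at \<beta> within {\<beta>L..\<beta>sL})"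
proof -
  obtain f1 f2 where f12: "\<forall>z\<in>rect. (f has_derivative (\<lambda>h. fst h *\<^sub>R f1 z + snd h *\<^sub>R f2 z)) (at z within rect)"
    "Ck_on k rect f1" "Ck_on k rect f2" using f by auto
  have d: "((\<lambda>a. f (a, \<beta>)) has_vector_derivative f1 (\<alpha>, \<beta>)) (at \<alpha> within {-\<alpha>0..0})"
      "((\<lambda>b. f (\<alpha>, b)) has_vector_derivative f2 (\<alpha>, \<beta>)) (at \<beta> within {\<beta>L..\<beta>sL})"
    if "(\<alpha>, \<beta>) \<in> rect" for \<alpha> \<beta>
    using partials_in_rectangle[OF bspec[OF f12(1) that, unfolded rect_def]] that
    by (auto simp: rect_iff)
  have eq: "d\<alpha> f z = f1 z" "d\<beta> f z = f2 z" if "z \<in> rect" for z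
  proof -
    obtain \<alpha> \<beta> where z: "z = (\<alpha>, \<beta>)" by (cases z)
    show "d\<alpha> f z = f1 z" "d\<beta> f z = f2 z"
      using vector_derivative_within[OF at_within_Icc_not_bot d(1)[of \<alpha> \<beta>]]
        vector_derivative_within[OF at_within_Icc_not_bot d(2)[of \<alpha> \<beta>]] that fan_range
      by (auto simp: d\<alpha>_def d\<beta>_def z rect_iff)
  qed
  show "Ck_on k rect (d\<alpha> f)" "Ck_on k rect (d\<beta> f)"
    using Ck_on_cong[OF f12(2), of "d\<alpha> f"] Ck_on_cong[OF f12(3), of "d\<beta> f"] eq by auto
  show "continuous_on rect f"
    using f12(1) has_derivative_continuous continuous_on_eq_continuous_within by blast
  show "((\<lambda>a. f (a, \<beta>)) has_vector_derivative d\<alpha> f (\<alpha>, \<beta>)) (at \<alpha> within {-\<alpha>0..0})"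
    and "((\<lambda>b. f (\<alpha>, b)) has_vector_derivative d\<beta> f (\<alpha>, \<beta>)) (at \<beta> within {\<beta>L..\<beta>sL})"
    if "(\<alpha>, \<beta>) \<in> rect" using d[OF that] eq[OF that] by auto
qed

lemmas fan_C2 = fan_smooth[unfolded numeral_2_eq_2]

lemma fan_continuous_fields:
  "continuous_on rect xx" "continuous_on rect tt" "continuous_on rect Vh"
  "continuous_on rect (d\<alpha> tt)" "continuous_on rect (d\<alpha> Vh)" "continuous_on rect (d\<alpha> (d\<beta> tt))"
  using fan_partials[OF fan_C2(1)] fan_partials[OF fan_C2(2)] fan_partials[OF fan_C2(3)]
    fan_partials[OF fan_partials(1)[OF fan_C2(2)]]
    fan_partials[OF fan_partials(1)[OF fan_C2(3)]]
    fan_partials(1)[OF fan_partials(2)[OF fan_C2(2)]]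
  by auto

lemma fan_characteristics:
  assumes "(\<alpha>, \<beta>) \<in> rect"
  shows "d\<alpha> xx (\<alpha>, \<beta>) = (u1 (Vh (\<alpha>, \<beta>)) - sound (Vh (\<alpha>, \<beta>))) * d\<alpha> tt (\<alpha>, \<beta>)"
    and "d\<beta> xx (\<alpha>, \<beta>) = (u1 (Vh (\<alpha>, \<beta>)) + sound (Vh (\<alpha>, \<beta>))) * d\<beta> tt (\<alpha>, \<beta>)"
    and "d\<alpha> tt (\<alpha>, \<beta>) \<noteq> 0"
  using fan_minus_characteristics[OF assms] fan_plus_characteristics[OF assms] fan_nondegenerate[OF assms]
  by (auto simp: d\<alpha>_def d\<beta>_def)

text \<open>On the edge the slope of the characteristic beta = const is both u1 - c and beta, and
psi1 = u1 + c keeps its left value; so u1, rho and p11 on the edge are known functions of beta.\<close>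

lemma fan_edge_state:
  assumes \<beta>: "\<beta> \<in> {\<beta>L..\<beta>sL}"
  shows "(0, \<beta>) \<in> rect" "d\<alpha> xx (0, \<beta>) = \<beta> * d\<alpha> tt (0, \<beta>)" "d\<beta> tt (0, \<beta>) = 0"
    "u1 (Vh (0, \<beta>)) = \<beta> + sound (Vh (0, \<beta>))" "2 * sound (Vh (0, \<beta>)) = psi1 VL - \<beta>"
    "sound (Vh (0, \<beta>)) > 0"
    "(rho (Vh (0, \<beta>)))\<^sup>2 = (sound (Vh (0, \<beta>)))\<^sup>2 / (3 * S1 VL)"
proof -
  show r: "(0, \<beta>) \<in> rect" using \<beta> fan_range by (simp add: rect_iff)
  show x: "d\<alpha> xx (0, \<beta>) = \<beta> * d\<alpha> tt (0, \<beta>)" using fan_slopes[OF \<beta>] by (simp add: d\<alpha>_def)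
  have "((\<lambda>b. tt (0, b)) has_vector_derivative 0) (at \<beta> within {\<beta>L..\<beta>sL})"
    by (rule has_vector_derivative_transform[of _ _ _ "\<lambda>b. 0"]) (use \<beta> fan_origin in auto)
  then show "d\<beta> tt (0, \<beta>) = 0"
    unfolding d\<beta>_def using vector_derivative_within[OF at_within_Icc_not_bot] fan_range \<beta> by fastforce
  show u: "u1 (Vh (0, \<beta>)) = \<beta> + sound (Vh (0, \<beta>))"
    using fan_characteristics(1,3)[OF r] x by auto
  then show "2 * sound (Vh (0, \<beta>)) = psi1 VL - \<beta>"
    using fan_invariants_origin[OF \<beta>] by (simp add: psi1_def[of "Vh (0, \<beta>)"])
  have adm: "admissible (Vh (0, \<beta>))" using fan_admissible[OF r] .
  then show "sound (Vh (0, \<beta>)) > 0" by (rule sound_pos)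
  have "(sound (Vh (0, \<beta>)))\<^sup>2 = 3 * S1 (Vh (0, \<beta>)) * (rho (Vh (0, \<beta>)))\<^sup>2" "S1 (Vh (0, \<beta>)) > 0"
    using adm sound_sq[OF adm] by (auto simp: S1_def admissible_def power2_eq_square power3_eq_cube)
  then show "(rho (Vh (0, \<beta>)))\<^sup>2 = (sound (Vh (0, \<beta>)))\<^sup>2 / (3 * S1 VL)"
    using fan_invariants_origin[OF \<beta>] by simp
qed

lemma fan_point_interior:
  assumes "-\<alpha>0 < \<alpha>" "\<alpha> < 0" "\<beta>L < \<beta>" "\<beta> < \<beta>sL"
  shows "(xx (\<alpha>, \<beta>), tt (\<alpha>, \<beta>)) \<in> interior (reg Fan)" "(\<alpha>, \<beta>) \<in> rect"
proof -
  show r: "(\<alpha>, \<beta>) \<in> rect" using assms by (simp add: rect_iff)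
  show "(xx (\<alpha>, \<beta>), tt (\<alpha>, \<beta>)) \<in> interior (reg Fan)"
    using fan_inside[of \<alpha> \<beta>] fan_time[OF r] assms by (intro in_interior_piece) auto
qed

lemma fan_chain_rule:
  assumes in_fan: "-\<alpha>0 < \<alpha>" "\<alpha> < 0" "\<beta>L < \<beta>" "\<beta> < \<beta>sL"
  defines "z \<equiv> (xx (\<alpha>, \<beta>), tt (\<alpha>, \<beta>))"
  shows "d\<alpha> Vh (\<alpha>, \<beta>) = d\<alpha> xx (\<alpha>, \<beta>) *\<^sub>R pdx (V Fan) z + d\<alpha> tt (\<alpha>, \<beta>) *\<^sub>R pdt (V Fan) z"
    and "d\<beta> Vh (\<alpha>, \<beta>) = d\<beta> xx (\<alpha>, \<beta>) *\<^sub>R pdx (V Fan) z + d\<beta> tt (\<alpha>, \<beta>) *\<^sub>R pdt (V Fan) z"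
proof -
  note r = fan_point_interior(2)[OF in_fan]
  have dV: "(V Fan has_derivative (\<lambda>h. fst h *\<^sub>R pdx (V Fan) z + snd h *\<^sub>R pdt (V Fan) z)) (at z)"
    unfolding z_def by (rule solution_interior_derivative[OF fan_point_interior(1)[OF in_fan]])
  have chain: "((\<lambda>a. V Fan (x a, t a)) has_vector_derivative x' *\<^sub>R pdx (V Fan) z + t' *\<^sub>R pdt (V Fan) z) (at a)"
    if "(x has_vector_derivative x') (at a)" "(t has_vector_derivative t') (at a)" "(x a, t a) = z"
    for x t x' t' a
  proof -
    have "((\<lambda>a. (x a, t a)) has_derivative (\<lambda>h. (h * x', h * t'))) (at a)"
      using that(1,2) unfolding has_vector_derivative_def by (auto intro!: derivative_eq_intros)
    from has_derivative_compose[OF this, of "V Fan" "\<lambda>h. fst h *\<^sub>R pdx (V Fan) z + snd h *\<^sub>R pdt (V Fan) z"]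
      dV that(3)
    show ?thesis by (simp add: has_vector_derivative_def scaleR_add_right)
  qed
  have at: "at \<alpha> within {-\<alpha>0..0} = at \<alpha>" "at \<beta> within {\<beta>L..\<beta>sL} = at \<beta>"
    using in_fan by (auto simp: at_within_Icc_at)
  note da = fan_partials(4)[OF _ r, unfolded at] and db = fan_partials(5)[OF _ r, unfolded at]
  have "((\<lambda>a. Vh (a, \<beta>)) has_vector_derivative
      d\<alpha> xx (\<alpha>, \<beta>) *\<^sub>R pdx (V Fan) z + d\<alpha> tt (\<alpha>, \<beta>) *\<^sub>R pdt (V Fan) z) (at \<alpha>)"
    by (rule has_vector_derivative_transform_within_open
        [OF chain[OF da[OF fan_C2(1)] da[OF fan_C2(2)]], of "{-\<alpha>0<..<0}"])
      (use in_fan fan_state in \<open>auto simp: z_def rect_iff\<close>)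
  from vector_derivative_unique_at[OF da[OF fan_C2(3)] this]
  show "d\<alpha> Vh (\<alpha>, \<beta>) = d\<alpha> xx (\<alpha>, \<beta>) *\<^sub>R pdx (V Fan) z + d\<alpha> tt (\<alpha>, \<beta>) *\<^sub>R pdt (V Fan) z" .
  have "((\<lambda>b. Vh (\<alpha>, b)) has_vector_derivative
      d\<beta> xx (\<alpha>, \<beta>) *\<^sub>R pdx (V Fan) z + d\<beta> tt (\<alpha>, \<beta>) *\<^sub>R pdt (V Fan) z) (at \<beta>)"
    by (rule has_vector_derivative_transform_within_open
        [OF chain[OF db[OF fan_C2(1)] db[OF fan_C2(2)]], of "{\<beta>L<..<\<beta>sL}"])
      (use in_fan fan_state in \<open>auto simp: z_def rect_iff\<close>)
  from vector_derivative_unique_at[OF db[OF fan_C2(3)] this]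
  show "d\<beta> Vh (\<alpha>, \<beta>) = d\<beta> xx (\<alpha>, \<beta>) *\<^sub>R pdx (V Fan) z + d\<beta> tt (\<alpha>, \<beta>) *\<^sub>R pdt (V Fan) z" .
qed

text \<open>Along a curve beta = const one has dx/dt = u1 - c, along alpha = const dx/dt = u1 + c. Eliminating
the time derivatives by the transport equations leaves the x-derivatives only; in the
beta-derivative of psi1 even the x-derivative of psi1 disappears.\<close>

lemma fan_transport:
  assumes in_fan: "-\<alpha>0 < \<alpha>" "\<alpha> < 0" "\<beta>L < \<beta>" "\<beta> < \<beta>sL"
  defines "z \<equiv> (xx (\<alpha>, \<beta>), tt (\<alpha>, \<beta>))" and "v \<equiv> Vh (\<alpha>, \<beta>)"
  shows "dS1 v (d\<alpha> Vh (\<alpha>, \<beta>)) = - sound v * d\<alpha> tt (\<alpha>, \<beta>) * dS1 v (pdx (V Fan) z)"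
    "dS1 v (d\<beta> Vh (\<alpha>, \<beta>)) = d\<beta> tt (\<alpha>, \<beta>) * (sound v * dS1 v (pdx (V Fan) z))"
    "dpsi1 v (d\<alpha> Vh (\<alpha>, \<beta>)) = d\<alpha> tt (\<alpha>, \<beta>) *
       (- 2 * sound v * dpsi1 v (pdx (V Fan) z) + (rho v)\<^sup>2 / 2 * dS1 v (pdx (V Fan) z)
         - deriv W (xx (\<alpha>, \<beta>)) / 2)"
    "dpsi1 v (d\<beta> Vh (\<alpha>, \<beta>)) = d\<beta> tt (\<alpha>, \<beta>) *
       ((rho v)\<^sup>2 / 2 * dS1 v (pdx (V Fan) z) - deriv W (xx (\<alpha>, \<beta>)) / 2)"
proof -
  note r = fan_point_interior(2)[OF in_fan] and i = fan_point_interior(1)[OF in_fan]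
  have v: "v = V Fan z" unfolding v_def z_def using fan_state[OF r in_fan(2)] .
  have adm: "admissible v" unfolding v_def using fan_admissible[OF r] .
  have prim: "primitive_eqs (deriv W (xx (\<alpha>, \<beta>))) v (pdt (V Fan) z) (pdx (V Fan) z)"
    using primitive_interior[OF i] unfolding v by (simp add: z_def)
  note tr = dS1_transport[OF adm prim] dpsi1_transport[OF adm prim]
  note ch = fan_chain_rule[OF in_fan, folded z_def]
    fan_characteristics(1,2)[OF r, folded v_def]
  show "dS1 v (d\<alpha> Vh (\<alpha>, \<beta>)) = - sound v * d\<alpha> tt (\<alpha>, \<beta>) * dS1 v (pdx (V Fan) z)"
    "dS1 v (d\<beta> Vh (\<alpha>, \<beta>)) = d\<beta> tt (\<alpha>, \<beta>) * (sound v * dS1 v (pdx (V Fan) z))"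
    "dpsi1 v (d\<alpha> Vh (\<alpha>, \<beta>)) = d\<alpha> tt (\<alpha>, \<beta>) *
       (- 2 * sound v * dpsi1 v (pdx (V Fan) z) + (rho v)\<^sup>2 / 2 * dS1 v (pdx (V Fan) z)
         - deriv W (xx (\<alpha>, \<beta>)) / 2)"
    "dpsi1 v (d\<beta> Vh (\<alpha>, \<beta>)) = d\<beta> tt (\<alpha>, \<beta>) *
       ((rho v)\<^sup>2 / 2 * dS1 v (pdx (V Fan) z) - deriv W (xx (\<alpha>, \<beta>)) / 2)"
    unfolding ch dS1_linear dpsi1_linear tr by (simp_all add: algebra_simps)
qed

text \<open>The case in which the factor that vanishes on the edge is the beta-derivative of tt: the whole
edge is the origin, where tt = 0.\<close>

lemma fan_edge_derivative:
  fixes F H :: "real \<times> real \<Rightarrow> real"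
  assumes const: "\<And>\<beta>. \<beta> \<in> {\<beta>L..\<beta>sL} \<Longrightarrow> F (0, \<beta>) = C"
    and q: "\<And>\<beta>. \<beta> \<in> {\<beta>L..\<beta>sL} \<Longrightarrow>
      ((\<lambda>\<alpha>. F (\<alpha>, \<beta>)) has_real_derivative q \<beta>) (at 0 within {-\<alpha>0..0})"
    and cont: "continuous_on rect F" "continuous_on rect H"
    and der: "\<And>\<alpha> \<beta>. -\<alpha>0 < \<alpha> \<Longrightarrow> \<alpha> < 0 \<Longrightarrow> \<beta>L < \<beta> \<Longrightarrow> \<beta> < \<beta>sL \<Longrightarrow>
      ((\<lambda>\<beta>. F (\<alpha>, \<beta>)) has_real_derivative d\<beta> tt (\<alpha>, \<beta>) * H (\<alpha>, \<beta>)) (at \<beta>)"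
    and \<beta>: "\<beta> \<in> {\<beta>L..\<beta>sL}"
  shows "(q has_real_derivative d\<alpha> (d\<beta> tt) (0, \<beta>) * H (0, \<beta>)) (at \<beta> within {\<beta>L..\<beta>sL})"
proof (rule edge_derivative[of \<alpha>0 \<beta>L \<beta>sL F C q "d\<beta> tt" H])
  show "continuous_on {\<beta>L..\<beta>sL} (\<lambda>\<beta>. F (\<alpha>, \<beta>))" if "-\<alpha>0 < \<alpha>" "\<alpha> < 0" for \<alpha>
    by (rule continuous_on_compose2[OF cont(1)])
      (use that in \<open>auto intro!: continuous_intros simp: rect_iff\<close>)
  show "((\<lambda>\<alpha>. d\<beta> tt (\<alpha>, \<beta>)) has_real_derivative d\<alpha> (d\<beta> tt) (\<alpha>, \<beta>)) (at \<alpha> within {-\<alpha>0..0})"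
    if "(\<alpha>, \<beta>) \<in> {-\<alpha>0..0} \<times> {\<beta>L..\<beta>sL}" for \<alpha> \<beta>
    using fan_partials(4)[OF fan_partials(2)[OF fan_C2(2)], of \<alpha> \<beta>] that
    by (simp add: rect_def has_real_derivative_iff_has_vector_derivative)
  show "continuous_on ({-\<alpha>0..0} \<times> {\<beta>L..\<beta>sL}) (d\<alpha> (d\<beta> tt))"
    "continuous_on ({-\<alpha>0..0} \<times> {\<beta>L..\<beta>sL}) H"
    using fan_continuous_fields(6) cont(2) by (simp_all add: rect_def)
qed (use const q der fan_edge_state(3) fan_range \<beta> in auto)

text \<open>The head and the tail are the curves beta = const at the two ends of the fan. Since V is continuous
across them, the alpha-derivative of Vh there is a derivative along the bounding curve and can be
computed from the outer side. The speed of the curve at time 0 is beta.\<close>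

lemma fan_boundary_match:
  assumes j: "(j, r, \<beta>) \<in> {(Head, Lft, \<beta>L), (Tail, StarL, \<beta>sL)}"
  shows "Vh (0, \<beta>) = V0 r" "d\<alpha> Vh (0, \<beta>) = d\<alpha> tt (0, \<beta>) *\<^sub>R (Vt0 r + \<beta> *\<^sub>R Vx0 r)"
proof -
  let ?F = "at 0 within {-\<alpha>0..0}"
  have \<beta>: "\<beta> \<in> {\<beta>L..\<beta>sL}" and r: "r \<noteq> Fan" and jr: "r = left_of j \<or> r = right_of j"
    using j fan_range by auto
  have bot: "?F \<noteq> bot" and zero: "0 \<in> {-\<alpha>0..0}" using fan_range at_within_Icc_not_bot by auto
  note R = fan_edge_state(1)[OF \<beta>]
  have tt0: "tt (0, \<beta>) = 0" "xx (0, \<beta>) = 0" using fan_origin[OF \<beta>] by auto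
  have xj: "xx (\<alpha>, \<beta>) = X j (tt (\<alpha>, \<beta>))" "0 < tt (\<alpha>, \<beta>)" "tt (\<alpha>, \<beta>) < T" "(\<alpha>, \<beta>) \<in> rect"
    if "-\<alpha>0 \<le> \<alpha>" "\<alpha> < 0" for \<alpha>
  proof -
    show \<open>(\<alpha>, \<beta>) \<in> rect\<close> using that \<beta> by (simp add: rect_iff)
    then show "0 < tt (\<alpha>, \<beta>)" "tt (\<alpha>, \<beta>) < T" using fan_time that by auto
    show "xx (\<alpha>, \<beta>) = X j (tt (\<alpha>, \<beta>))" using fan_head_tail[of \<alpha>] that j by auto
  qed
  have sub: "(\<lambda>a. tt (a, \<beta>)) ` {-\<alpha>0..0} \<subseteq> {0..<T}"
  proof
    fix t assume "t \<in> (\<lambda>a. tt (a, \<beta>)) ` {-\<alpha>0..0}"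
    then obtain a where "a \<in> {-\<alpha>0..0}" "t = tt (a, \<beta>)" by blast
    then show "t \<in> {0..<T}" using xj(2,3)[of a] tt0 domain_pos by (cases "a = 0") auto
  qed
  note da = fan_partials(4)[OF _ R]
  have chain: "((\<lambda>a. g (tt (a, \<beta>))) has_vector_derivative d\<alpha> tt (0, \<beta>) *\<^sub>R g') ?F"
    if "(g has_vector_derivative g') (at 0 within {0..<T})" for g :: "real \<Rightarrow> 'b::real_normed_vector" and g'
    using vector_diff_chain_within[OF da[OF fan_C2(2)], of g g'] 
      has_vector_derivative_within_subset[OF that sub] tt0 by (simp add: o_def)
  have ev: "\<forall>\<^sub>F a in ?F. -\<alpha>0 \<le> a \<and> a < 0" by (auto simp: eventually_at intro!: exI[of _ 1])
  have speed: "sp j 0 = \<beta>"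
  proof -
    have "d\<alpha> xx (0, \<beta>) = d\<alpha> tt (0, \<beta>) *\<^sub>R sp j 0"
    proof (rule vector_derivative_eq_if_eventually_eq(2)[OF bot zero da[OF fan_C2(1)] chain])
      show "(X j has_vector_derivative sp j 0) (at 0 within {0..<T})"
        using curve_C1(1)[of 0 j] domain_pos by (simp add: has_real_derivative_iff_has_vector_derivative)
      show "\<forall>\<^sub>F a in ?F. xx (a, \<beta>) = X j (tt (a, \<beta>))"
        using ev by eventually_elim (use xj in auto)
    qed
    then show ?thesis using fan_edge_state(2)[OF \<beta>] fan_characteristics(3)[OF R] by simp
  qed
  have "\<forall>\<^sub>F a in ?F. Vh (a, \<beta>) = curve_trace r j (tt (a, \<beta>))"
    using ev
  proof eventually_elim
    case (elim a)
    note x = xj[of a]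
    have "Vh (a, \<beta>) = V Fan (X j (tt (a, \<beta>)), tt (a, \<beta>))"
      using fan_state[OF x(4)] x elim by simp
    also have "\<dots> = V r (X j (tt (a, \<beta>)), tt (a, \<beta>))"
      using fan_continuous[of j "tt (a, \<beta>)"] x elim j by auto
    finally show ?case using x elim by (simp add: curve_trace_def)
  qed
  from vector_derivative_eq_if_eventually_eq[OF bot zero da[OF fan_C2(3)] chain[OF curve_trace_derivative[OF r jr]] this]
  show "Vh (0, \<beta>) = V0 r" "d\<alpha> Vh (0, \<beta>) = d\<alpha> tt (0, \<beta>) *\<^sub>R (Vt0 r + \<beta> *\<^sub>R Vx0 r)"
    by (simp_all add: tt0 curve_trace_def speed)
qed

text \<open>The coefficient A is K S_x / c evaluated at the head, where K = 1 / (6 S1) and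
rho^2 = c^2 / (3 S1).\<close>

lemma fan_gradient_relations:
  defines "A \<equiv> (rho VL)\<^sup>2 * dS1 VL VL' / (2 * (sound VL) ^ 3)"
  shows "dS1 (V0 StarL) (Vx0 StarL) / sound (V0 StarL) = dS1 VL VL' / sound VL"
    and "dpsi1 (V0 StarL) (Vx0 StarL) - 3 / 4 * A * (sound (V0 StarL))\<^sup>2
      = dpsi1 VL VL' - 3 / 4 * A * (sound VL)\<^sup>2"
    and "u1 (V0 StarL) + sound (V0 StarL) = psi1 VL"
    and "S1 (V0 StarL) = S1 VL"
proof -
  \<comment> \<open>The continuous extensions of the x-derivatives of S1 and psi1 up to the edge alpha = 0.\<close>
  have grad: "\<exists>g. continuous_on rect g \<and> (\<forall>\<alpha> \<beta>. -\<alpha>0 < \<alpha> \<longrightarrow> \<alpha> < 0 \<longrightarrow> \<beta>L < \<beta> \<longrightarrow> \<beta> < \<beta>sL \<longrightarrow>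
      g (\<alpha>, \<beta>) = df (Vh (\<alpha>, \<beta>)) (pdx (V Fan) (xx (\<alpha>, \<beta>), tt (\<alpha>, \<beta>))))"
    if f: "f \<in> {psi1, S1}" and df: "\<And>g g' t. admissible (g t) \<Longrightarrow> (g has_vector_derivative g') (at t) \<Longrightarrow>
      ((\<lambda>t. f (g t)) has_real_derivative df (g t) g') (at t)" for f df
  proof -
    obtain g where g: "continuous_on rect g" "\<And>\<alpha> \<beta>. \<alpha> \<in> {-\<alpha>0..<0} \<Longrightarrow> \<beta> \<in> {\<beta>L<..<\<beta>sL} \<Longrightarrow>
        g (\<alpha>, \<beta>) = pdx (\<lambda>z. f (V Fan z)) (xx (\<alpha>, \<beta>), tt (\<alpha>, \<beta>))"
      using fan_invariants_derivatives[OF f, of pdx] by blast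
    have "g (\<alpha>, \<beta>) = df (Vh (\<alpha>, \<beta>)) (pdx (V Fan) (xx (\<alpha>, \<beta>), tt (\<alpha>, \<beta>)))"
      if in_fan: "-\<alpha>0 < \<alpha>" "\<alpha> < 0" "\<beta>L < \<beta>" "\<beta> < \<beta>sL" for \<alpha> \<beta>
    proof -
      let ?z = "(xx (\<alpha>, \<beta>), tt (\<alpha>, \<beta>))"
      note i = fan_point_interior[OF in_fan]
      have v: "Vh (\<alpha>, \<beta>) = V Fan ?z" using fan_state[OF i(2) in_fan(2)] .
      have "((\<lambda>x. f (V Fan (x, snd ?z))) has_real_derivative df (V Fan (fst ?z, snd ?z)) (pdx (V Fan) ?z)) (at (fst ?z))"
        by (rule df[OF _ has_derivative_plane_partials(1)[OF solution_interior_derivative[OF i(1)]]])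
          (use fan_admissible[OF i(2)] v in simp)
      then have "pdx (\<lambda>z. f (V Fan z)) ?z = df (Vh (\<alpha>, \<beta>)) (pdx (V Fan) ?z)"
        unfolding pdx_def v has_real_derivative_iff_has_vector_derivative
        by (simp add: vector_derivative_at)
      then show ?thesis using g(2)[of \<alpha> \<beta>] that by simp
    qed
    then show ?thesis using g(1) by blast
  qed
  obtain gS where gSc: "continuous_on rect gS"
    and gS: "\<And>\<alpha> \<beta>. -\<alpha>0 < \<alpha> \<Longrightarrow> \<alpha> < 0 \<Longrightarrow> \<beta>L < \<beta> \<Longrightarrow> \<beta> < \<beta>sL \<Longrightarrow>
      dS1 (Vh (\<alpha>, \<beta>)) (pdx (V Fan) (xx (\<alpha>, \<beta>), tt (\<alpha>, \<beta>))) = gS (\<alpha>, \<beta>)"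
  proof -
    have "\<exists>g. continuous_on rect g \<and> (\<forall>\<alpha> \<beta>. -\<alpha>0 < \<alpha> \<longrightarrow> \<alpha> < 0 \<longrightarrow> \<beta>L < \<beta> \<longrightarrow> \<beta> < \<beta>sL \<longrightarrow>
      g (\<alpha>, \<beta>) = dS1 (Vh (\<alpha>, \<beta>)) (pdx (V Fan) (xx (\<alpha>, \<beta>), tt (\<alpha>, \<beta>))))"
      by (rule grad[OF _ S1_has_derivative]) auto
    then show ?thesis using that by (auto simp: eq_commute)
  qed
  obtain g\<psi> where g\<psi>c: "continuous_on rect g\<psi>"
    and g\<psi>: "\<And>\<alpha> \<beta>. -\<alpha>0 < \<alpha> \<Longrightarrow> \<alpha> < 0 \<Longrightarrow> \<beta>L < \<beta> \<Longrightarrow> \<beta> < \<beta>sL \<Longrightarrow>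
      dpsi1 (Vh (\<alpha>, \<beta>)) (pdx (V Fan) (xx (\<alpha>, \<beta>), tt (\<alpha>, \<beta>))) = g\<psi> (\<alpha>, \<beta>)"
  proof -
    have "\<exists>g. continuous_on rect g \<and> (\<forall>\<alpha> \<beta>. -\<alpha>0 < \<alpha> \<longrightarrow> \<alpha> < 0 \<longrightarrow> \<beta>L < \<beta> \<longrightarrow> \<beta> < \<beta>sL \<longrightarrow>
      g (\<alpha>, \<beta>) = dpsi1 (Vh (\<alpha>, \<beta>)) (pdx (V Fan) (xx (\<alpha>, \<beta>), tt (\<alpha>, \<beta>))))"
      by (rule grad[OF _ psi1_has_derivative]) auto
    then show ?thesis using that by (auto simp: eq_commute)
  qed
  note gc = gSc g\<psi>c
  have adm: "admissible (Vh z)" if "z \<in> rect" for z using fan_admissible that by (cases z) auto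
  have rho0: "rho (Vh z) \<noteq> 0" "sound (Vh z) \<noteq> 0" if "z \<in> rect" for z
    using adm[OF that] sound_pos[OF adm[OF that]] by (auto simp: admissible_def)
  note fc = fan_continuous_fields
  have comp: "continuous_on rect (\<lambda>z. Vh z $ i)" "continuous_on rect (\<lambda>z. d\<alpha> Vh z $ i)" for i
    using fc(3,5) by (auto intro: bounded_linear.continuous_on[OF bounded_linear_vec_nth])
  have cs: "continuous_on rect (\<lambda>z. sound (Vh z))"
    unfolding sound_def by (intro continuous_intros comp ballI rho0)
  have cdS: "continuous_on rect (\<lambda>z. dS1 (Vh z) (d\<alpha> Vh z))"
    unfolding dS1_def by (intro continuous_intros comp) (use rho0 in auto)
  have cdp: "continuous_on rect (\<lambda>z. dpsi1 (Vh z) (d\<alpha> Vh z))"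
    unfolding dpsi1_def by (intro continuous_intros comp cs) (use rho0 in auto)
  have cS: "continuous_on rect (\<lambda>z. S1 (Vh z))" and cp: "continuous_on rect (\<lambda>z. psi1 (Vh z))"
    unfolding S1_def psi1_def by (intro continuous_intros comp cs; use rho0 in auto)+
  have cW: "continuous_on rect (\<lambda>z. deriv W (xx z))"
    by (rule continuous_on_compose2[OF potential(2) fc(1)]) auto
  note ceq = rect_eq_from_interior[of "-\<alpha>0" 0 \<beta>L \<beta>sL, folded rect_def]
  \<comment> \<open>Identities in the open fan extend by continuity to the edge, which is mapped to the single
    point (0, 0), where V Fan has no derivatives.\<close>
  have S\<alpha>: "dS1 (Vh z) (d\<alpha> Vh z) = - sound (Vh z) * d\<alpha> tt z * gS z" if "z \<in> rect" for z
    by (rule ceq[OF _ _ cdS _ _ that])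
      (use fan_range fan_transport(1) gS in \<open>auto intro!: continuous_intros cs fc gc\<close>)
  have \<psi>\<alpha>: "dpsi1 (Vh z) (d\<alpha> Vh z) = d\<alpha> tt z *
      (- 2 * sound (Vh z) * g\<psi> z + (rho (Vh z))\<^sup>2 / 2 * gS z - deriv W (xx z) / 2)" if "z \<in> rect" for z
    by (rule ceq[OF _ _ cdp _ _ that])
      (use fan_range fan_transport(3) gS g\<psi> in \<open>auto intro!: continuous_intros cs fc gc cW comp\<close>)
  let ?I = "{\<beta>L..\<beta>sL}"
  define m where "m = (\<lambda>\<beta>. d\<alpha> (d\<beta> tt) (0, \<beta>))"
  have b: "\<beta>L \<in> ?I" "\<beta>sL \<in> ?I" using fan_range by auto
  note da = fan_partials(4)[OF _ fan_edge_state(1)]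
  have db: "((\<lambda>b. f (\<alpha>, b)) has_vector_derivative d\<beta> f (\<alpha>, \<beta>)) (at \<beta>)"
    if "Ck_on (Suc k) rect f" "-\<alpha>0 < \<alpha>" "\<alpha> < 0" "\<beta>L < \<beta>" "\<beta> < \<beta>sL"
    for f :: "real \<times> real \<Rightarrow> 'b::real_normed_vector" and k \<alpha> \<beta>
    using fan_partials(5)[OF that(1), of \<alpha> \<beta>] that by (simp add: rect_iff at_within_Icc_at)
  have d\<tau>: "((\<lambda>\<beta>. d\<alpha> tt (0, \<beta>)) has_real_derivative m \<beta>) (at \<beta> within ?I)" if "\<beta> \<in> ?I" for \<beta>
    unfolding m_def
    using fan_edge_derivative[of tt 0 "\<lambda>\<beta>. d\<alpha> tt (0, \<beta>)" "\<lambda>_. 1", OF _ _ fc(2) _ _ that]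
      fan_origin da[OF fan_C2(2)] db[OF fan_C2(2)]
    by (simp add: has_real_derivative_iff_has_vector_derivative)
  have edge_x: "((\<lambda>\<beta>. d\<alpha> xx (0, \<beta>)) has_real_derivative m \<beta> * (u1 (Vh (0, \<beta>)) + sound (Vh (0, \<beta>)))) (at \<beta> within ?I)"
    if "\<beta> \<in> ?I" for \<beta>
    unfolding m_def
  proof (rule fan_edge_derivative[of xx 0 "\<lambda>\<beta>. d\<alpha> xx (0, \<beta>)" "\<lambda>z. u1 (Vh z) + sound (Vh z)", OF _ _ fc(1) _ _ that])
    show "continuous_on rect (\<lambda>z. u1 (Vh z) + sound (Vh z))" by (intro continuous_intros comp cs)
    show "((\<lambda>\<beta>. xx (\<alpha>, \<beta>)) has_real_derivative d\<beta> tt (\<alpha>, \<beta>) * (u1 (Vh (\<alpha>, \<beta>)) + sound (Vh (\<alpha>, \<beta>)))) (at \<beta>)"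
      if "-\<alpha>0 < \<alpha>" "\<alpha> < 0" "\<beta>L < \<beta>" "\<beta> < \<beta>sL" for \<alpha> \<beta>
      using db[OF fan_C2(1) that] fan_characteristics(2)[OF fan_point_interior(2)[OF that]]
      by (simp add: has_real_derivative_iff_has_vector_derivative mult.commute)
  qed (use fan_origin da[OF fan_C2(1)] in \<open>simp_all add: has_real_derivative_iff_has_vector_derivative\<close>)
  have dx: "((\<lambda>\<beta>. \<beta> * d\<alpha> tt (0, \<beta>)) has_real_derivative m \<beta> * psi1 VL) (at \<beta> within ?I)"
    if "\<beta> \<in> ?I" for \<beta>
  proof -
    have "u1 (Vh (0, \<beta>)) + sound (Vh (0, \<beta>)) = psi1 VL"
      using fan_invariants_origin[OF that] by (simp add: psi1_def)
    then show ?thesis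
      using has_field_derivative_transform_within[OF edge_x[OF that] zero_less_one that,
          of "\<lambda>\<beta>. \<beta> * d\<alpha> tt (0, \<beta>)"] fan_edge_state(2) by simp
  qed
  define s where "s = (\<lambda>\<beta>. dS1 (Vh (0, \<beta>)) (d\<alpha> Vh (0, \<beta>)))"
  define r where "r = (\<lambda>\<beta>. dpsi1 (Vh (0, \<beta>)) (d\<alpha> Vh (0, \<beta>)))"
  define K where "K = 1 / (6 * S1 VL)"
  have ds: "(s has_real_derivative m \<beta> * (sound (Vh (0, \<beta>)) * gS (0, \<beta>))) (at \<beta> within ?I)"
    if "\<beta> \<in> ?I" for \<beta>
    unfolding m_def s_def
  proof (rule fan_edge_derivative[of "\<lambda>z. S1 (Vh z)" "S1 VL" _ "\<lambda>z. sound (Vh z) * gS z", OF _ _ cS _ _ that])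
    show "continuous_on rect (\<lambda>z. sound (Vh z) * gS z)" by (intro continuous_intros gc cs)
    show "((\<lambda>\<alpha>. S1 (Vh (\<alpha>, \<beta>))) has_real_derivative dS1 (Vh (0, \<beta>)) (d\<alpha> Vh (0, \<beta>))) (at 0 within {-\<alpha>0..0})"
      if "\<beta> \<in> ?I" for \<beta>
      by (rule S1_has_derivative[OF adm da[OF fan_C2(3)]]) (use that fan_edge_state in auto)
    show "((\<lambda>\<beta>. S1 (Vh (\<alpha>, \<beta>))) has_real_derivative d\<beta> tt (\<alpha>, \<beta>) * (sound (Vh (\<alpha>, \<beta>)) * gS (\<alpha>, \<beta>))) (at \<beta>)"
      if "-\<alpha>0 < \<alpha>" "\<alpha> < 0" "\<beta>L < \<beta>" "\<beta> < \<beta>sL" for \<alpha> \<beta>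
      using S1_has_derivative[OF adm[OF fan_point_interior(2)[OF that]] db[OF fan_C2(3) that]]
      unfolding fan_transport(2)[OF that] gS[OF that] .
  qed (use fan_invariants_origin in auto)
  have dr0: "(r has_real_derivative m \<beta> * ((rho (Vh (0, \<beta>)))\<^sup>2 / 2 * gS (0, \<beta>) - deriv W (xx (0, \<beta>)) / 2)) (at \<beta> within ?I)"
    if "\<beta> \<in> ?I" for \<beta>
    unfolding m_def r_def
  proof (rule fan_edge_derivative[of "\<lambda>z. psi1 (Vh z)" "psi1 VL" _
        "\<lambda>z. (rho (Vh z))\<^sup>2 / 2 * gS z - deriv W (xx z) / 2", OF _ _ cp _ _ that])
    show "continuous_on rect (\<lambda>z. (rho (Vh z))\<^sup>2 / 2 * gS z - deriv W (xx z) / 2)"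
      by (intro continuous_intros gc comp cW) auto
    show "((\<lambda>\<alpha>. psi1 (Vh (\<alpha>, \<beta>))) has_real_derivative dpsi1 (Vh (0, \<beta>)) (d\<alpha> Vh (0, \<beta>))) (at 0 within {-\<alpha>0..0})"
      if "\<beta> \<in> ?I" for \<beta>
      by (rule psi1_has_derivative[OF adm da[OF fan_C2(3)]]) (use that fan_edge_state in auto)
    show "((\<lambda>\<beta>. psi1 (Vh (\<alpha>, \<beta>))) has_real_derivative
        d\<beta> tt (\<alpha>, \<beta>) * ((rho (Vh (\<alpha>, \<beta>)))\<^sup>2 / 2 * gS (\<alpha>, \<beta>) - deriv W (xx (\<alpha>, \<beta>)) / 2)) (at \<beta>)"
      if "-\<alpha>0 < \<alpha>" "\<alpha> < 0" "\<beta>L < \<beta>" "\<beta> < \<beta>sL" for \<alpha> \<beta>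
      using psi1_has_derivative[OF adm[OF fan_point_interior(2)[OF that]] db[OF fan_C2(3) that]]
      unfolding fan_transport(4)[OF that] gS[OF that] .
  qed (use fan_invariants_origin in auto)
  have K: "(rho (Vh (0, \<beta>)))\<^sup>2 / 2 * gS (0, \<beta>) = K * (sound (Vh (0, \<beta>)))\<^sup>2 * gS (0, \<beta>)"
    "xx (0, \<beta>) = 0" if "\<beta> \<in> ?I" for \<beta>
    using fan_edge_state(7)[OF that] fan_origin[OF that] by (auto simp: K_def)
  have dr: "(r has_real_derivative m \<beta> * (K * (sound (Vh (0, \<beta>)))\<^sup>2 * gS (0, \<beta>) - deriv W 0 / 2)) (at \<beta> within ?I)"
    if "\<beta> \<in> ?I" for \<beta>
    using dr0[OF that] unfolding K[OF that] .
  have s: "s \<beta> = - sound (Vh (0, \<beta>)) * d\<alpha> tt (0, \<beta>) * gS (0, \<beta>)" if "\<beta> \<in> ?I" for \<beta>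
    unfolding s_def using S\<alpha>[OF fan_edge_state(1)[OF that]] .
  have r: "r \<beta> = d\<alpha> tt (0, \<beta>) * (- 2 * sound (Vh (0, \<beta>)) * g\<psi> (0, \<beta>)
      + K * (sound (Vh (0, \<beta>)))\<^sup>2 * gS (0, \<beta>) - deriv W 0 / 2)" if "\<beta> \<in> ?I" for \<beta>
    unfolding r_def using \<psi>\<alpha>[OF fan_edge_state(1)[OF that]] unfolding K[OF that] .
  have match: "gS (0, \<beta>) = dS1 (V0 q) (Vx0 q)" "g\<psi> (0, \<beta>) = dpsi1 (V0 q) (Vx0 q)" "Vh (0, \<beta>) = V0 q"
    if j: "(j, q, \<beta>) \<in> {(Head, Lft, \<beta>L), (Tail, StarL, \<beta>sL)}" for j q \<beta>
  proof -
    note bm = fan_boundary_match[OF j]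
    have \<beta>: "\<beta> \<in> ?I" using j b by auto
    note e = fan_edge_state[OF \<beta>]
    let ?v = "V0 q" and ?\<tau> = "d\<alpha> tt (0, \<beta>)"
    have av: "admissible ?v" using adm[OF e(1)] bm(1) by simp
    have prim: "primitive_eqs (deriv W 0) ?v (Vt0 q) (Vx0 q)"
      by (rule primitive_origin[OF _ av]) (use j in auto)
    have u: "u1 ?v = \<beta> + sound ?v" using e(4) bm(1) by simp
    have \<tau>: "?\<tau> \<noteq> 0" using fan_characteristics(3)[OF e(1)] .
    have c: "sound ?v > 0" using sound_pos[OF av] .
    have lin: "dS1 ?v (?\<tau> *\<^sub>R (Vt0 q + \<beta> *\<^sub>R Vx0 q)) = ?\<tau> * (dS1 ?v (Vt0 q) + \<beta> * dS1 ?v (Vx0 q))"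
      "dpsi1 ?v (?\<tau> *\<^sub>R (Vt0 q + \<beta> *\<^sub>R Vx0 q)) = ?\<tau> * (dpsi1 ?v (Vt0 q) + \<beta> * dpsi1 ?v (Vx0 q))"
      using dS1_linear[of ?v ?\<tau> "Vt0 q" "?\<tau> * \<beta>" "Vx0 q"] dpsi1_linear[of ?v ?\<tau> "Vt0 q" "?\<tau> * \<beta>" "Vx0 q"]
      by (simp_all add: algebra_simps)
    have "?\<tau> * (dS1 ?v (Vt0 q) + \<beta> * dS1 ?v (Vx0 q)) = - sound ?v * ?\<tau> * gS (0, \<beta>)"
      using S\<alpha>[OF e(1)] unfolding bm lin .
    then have "?\<tau> * sound ?v * gS (0, \<beta>) = ?\<tau> * sound ?v * dS1 ?v (Vx0 q)"
      unfolding dS1_transport[OF av prim] u by (auto simp: algebra_simps)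
    then show g1: "gS (0, \<beta>) = dS1 ?v (Vx0 q)" using \<tau> c by simp
    have "?\<tau> * (dpsi1 ?v (Vt0 q) + \<beta> * dpsi1 ?v (Vx0 q)) = ?\<tau> *
      (- 2 * sound ?v * g\<psi> (0, \<beta>) + (rho ?v)\<^sup>2 / 2 * gS (0, \<beta>) - deriv W 0 / 2)"
      using \<psi>\<alpha>[OF e(1)] fan_origin[OF \<beta>] unfolding bm lin by simp
    then have "dpsi1 ?v (Vt0 q) + \<beta> * dpsi1 ?v (Vx0 q) =
      - 2 * sound ?v * g\<psi> (0, \<beta>) + (rho ?v)\<^sup>2 / 2 * gS (0, \<beta>) - deriv W 0 / 2"
      using \<tau> by simp
    then have "sound ?v * g\<psi> (0, \<beta>) = sound ?v * dpsi1 ?v (Vx0 q)"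
      unfolding dpsi1_transport[OF av prim] u g1 by (simp add: algebra_simps)
    then show "g\<psi> (0, \<beta>) = dpsi1 ?v (Vx0 q)" using c by simp
    show "Vh (0, \<beta>) = V0 q" by (rule bm)
  qed
  note mL = match[of Head Lft \<beta>L, unfolded outer_left, simplified]
    and mS = match[of Tail StarL \<beta>sL, simplified]
  have A: "A = K * gS (0, \<beta>L) / sound (Vh (0, \<beta>L))"
    using fan_edge_state(7)[OF b(1)] sound_pos[OF data_admissible(1)] unfolding mL A_def K_def
    by (simp add: power2_eq_square power3_eq_cube)
  note gradients = fan_gradients_at_origin[where \<tau>="\<lambda>\<beta>. d\<alpha> tt (0, \<beta>)" and c="\<lambda>\<beta>. sound (Vh (0, \<beta>))"
      and S="\<lambda>\<beta>. gS (0, \<beta>)" and \<Psi>="\<lambda>\<beta>. g\<psi> (0, \<beta>)", OF fan_range(2) _ _ d\<tau> dx s ds r dr A]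
  have "gS (0, \<beta>sL) / sound (Vh (0, \<beta>sL)) = gS (0, \<beta>L) / sound (Vh (0, \<beta>L))"
    "g\<psi> (0, \<beta>sL) - 3 / 4 * A * (sound (Vh (0, \<beta>sL)))\<^sup>2
      = g\<psi> (0, \<beta>L) - 3 / 4 * A * (sound (Vh (0, \<beta>L)))\<^sup>2"
    using gradients fan_edge_state(5,6) fan_characteristics(3)[OF fan_edge_state(1)] by auto
  then show "dS1 (V0 StarL) (Vx0 StarL) / sound (V0 StarL) = dS1 VL VL' / sound VL"
    and "dpsi1 (V0 StarL) (Vx0 StarL) - 3 / 4 * A * (sound (V0 StarL))\<^sup>2
      = dpsi1 VL VL' - 3 / 4 * A * (sound VL)\<^sup>2"
    unfolding mL mS .
  show "u1 (V0 StarL) + sound (V0 StarL) = psi1 VL" "S1 (V0 StarL) = S1 VL"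
    using fan_invariants_origin[OF b(2)] mS by (auto simp: psi1_def)
qed

end


section \<open>The linear equations for the material derivatives\<close>

lemma dpsi1_minus_entropy:
  assumes "admissible v"
  shows "dpsi1 v h = u1 h + p11 h / (rho v * sound v) + (rho v)\<^sup>2 / (2 * sound v) * dS1 v h"
proof -
  have "rho v > 0" "sound v > 0" "p11 v = (sound v)\<^sup>2 * rho v / 3"
    using assms sound_pos sound_sq[OF assms] by (auto simp: admissible_def)
  then show ?thesis unfolding dpsi1_def dS1_def
    by (simp add: divide_simps) (simp add: algebra_simps power_eq_if)
qed

context grp_configuration
begin

lemma middle_derivatives:
  assumes r: "r \<in> middle"
  shows "u1 (Vx0 r) = - Dp / (3 * ps)" "p11 (Vx0 r) = - rho (V0 r) * (Du + deriv W 0 / 2)"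
    "rho (Vt0 r) = - us * rho (Vx0 r) + rho (V0 r) * Dp / (3 * ps)"
    "u1 (Vt0 r) = us / (3 * ps) * Dp + Du"
    "p11 (Vt0 r) = Dp + rho (V0 r) * us * Du + 1 / 2 * rho (V0 r) * us * deriv W 0"
proof -
  note ms = middle_states(1)[OF r]
  have pos: "ps > 0" "rho (V0 r) > 0" using ms by (auto simp: admissible_def)
  have prim: "primitive_eqs (deriv W 0) (V0 r) (Vt0 r) (Vx0 r)"
    by (rule primitive_origin) (use r ms in \<open>auto simp: middle_def\<close>)
  note D = middle_material_derivatives[OF r]
  have e: "Dp + 3 * ps * u1 (Vx0 r) = 0" "Du + p11 (Vx0 r) / rho (V0 r) = - deriv W 0 / 2"
    "rho (Vt0 r) + us * rho (Vx0 r) + rho (V0 r) * u1 (Vx0 r) = 0"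
    using prim ms D by (simp_all add: primitive_eqs_def)
  show x: "u1 (Vx0 r) = - Dp / (3 * ps)" "p11 (Vx0 r) = - rho (V0 r) * (Du + deriv W 0 / 2)"
    using e(1,2) pos by (simp_all add: field_simps)
  show "rho (Vt0 r) = - us * rho (Vx0 r) + rho (V0 r) * Dp / (3 * ps)"
    using e(3) unfolding x by simp
  have t: "u1 (Vt0 r) = Du - us * u1 (Vx0 r)" "p11 (Vt0 r) = Dp - us * p11 (Vx0 r)"
    using D by auto
  show "u1 (Vt0 r) = us / (3 * ps) * Dp + Du"
    "p11 (Vt0 r) = Dp + rho (V0 r) * us * Du + 1 / 2 * rho (V0 r) * us * deriv W 0"
    unfolding t x by (simp_all add: algebra_simps)
qed

text \<open>Behind the fan the gradients of S1 and psi1 are known. The combination psi_x - rho^2/(2c) S_x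
equals the x-derivative of u1 plus that of p11 divided by rho c, and both are linear in Du and Dp.
The factor psi1 = u1 + c arises when the equation is multiplied by u1 + c to bring it to the
stated normalization. Since S1 is constant on the edge, rho / c has the same value at the head and
at the tail, which converts rho_* into rho_L.\<close>

lemma left_equations:
  fixes c cL S' w :: real
  defines "c \<equiv> sound (V0 StarL)" and "cL \<equiv> sound VL" and "S' \<equiv> dS1 VL VL'" and "w \<equiv> deriv W 0"
  shows "(1 + us / c) * Du + (us / (3 * ps) + 1 / (rsL * c)) * Dp
      = ((rho VL)\<^sup>2 * S' / (8 * cL ^ 3) * (3 * cL\<^sup>2 + c\<^sup>2) - dpsi1 VL VL') * psi1 VL
        - 1 / 2 * (1 + us / c) * w"
    and "rho (Vt0 StarL) =
      1 / c\<^sup>2 * (p11 (Vt0 StarL) + (rho VL)\<^sup>2 * S' * rsL * us * (c ^ 3 / cL ^ 3))"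
proof -
  have mid: "StarL \<in> middle" by (simp add: middle_def)
  note ms = middle_states(1)[OF mid] and rho = middle_states(2)
  note md = middle_derivatives[OF mid, unfolded rho, folded w_def]
  let ?v = "V0 StarL" and ?h = "Vx0 StarL"
  have adm: "admissible ?v" using ms by simp
  have pos: "ps > 0" "rsL > 0" "c > 0" "cL > 0" "rho VL > 0"
    using ms rho sound_pos[OF adm] sound_pos[OF data_admissible(1)] data_admissible(1)
    by (auto simp: admissible_def c_def cL_def)
  have cc: "c\<^sup>2 = 3 * ps / rsL" using sound_sq[OF adm] ms rho by (simp add: c_def)
  have p: "3 * ps = c\<^sup>2 * rsL" using cc pos by (simp add: field_simps)
  have pL: "3 * p11 VL = cL\<^sup>2 * rho VL"
    using sound_sq[OF data_admissible(1)] pos by (simp add: cL_def field_simps)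
  note rel = fan_gradient_relations[folded c_def cL_def S'_def]
  have u: "us + c = psi1 VL" using rel(3) ms by simp
  define A where "A = (rho VL)\<^sup>2 * S' / (2 * cL ^ 3)"
  have Sx: "dS1 ?v ?h = c * S' / cL" using rel(1) pos by (simp add: field_simps)
  have ratio: "rsL\<^sup>2 * cL\<^sup>2 = (rho VL)\<^sup>2 * c\<^sup>2"
  proof -
    have "ps * rho VL ^ 3 = p11 VL * rsL ^ 3"
      using rel(4) ms rho pos by (simp add: S1_def field_simps)
    then have "c\<^sup>2 * rsL * rho VL ^ 3 = cL\<^sup>2 * rho VL * rsL ^ 3" using p pL by algebra
    then have "(rsL * rho VL) * (rsL\<^sup>2 * cL\<^sup>2) = (rsL * rho VL) * ((rho VL)\<^sup>2 * c\<^sup>2)" by algebra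
    then show ?thesis using pos by simp
  qed
  have r2: "rsL\<^sup>2 = (rho VL)\<^sup>2 * c\<^sup>2 / cL\<^sup>2" using ratio pos by (simp add: field_simps)
  have AS: "rsL\<^sup>2 / (2 * c) * dS1 ?v ?h = A * c\<^sup>2"
    unfolding Sx A_def r2 using pos by (simp add: field_simps power2_eq_square power3_eq_cube)
  have psix: "dpsi1 ?v ?h = dpsi1 VL VL' + 3 / 4 * A * (c\<^sup>2 - cL\<^sup>2)"
    using rel(2)[folded A_def] by (simp add: algebra_simps)
  have "dpsi1 ?v ?h = u1 ?h + p11 ?h / (rsL * c) + A * c\<^sup>2"
    using dpsi1_minus_entropy[OF adm, of ?h] AS rho by (simp add: c_def)
  have main: "Dp / (3 * ps) + (Du + w / 2) / c = A / 4 * (3 * cL\<^sup>2 + c\<^sup>2) - dpsi1 VL VL'"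
  proof -
    have "- rsL * (Du + w / 2) / (rsL * c) = - ((Du + w / 2) / c)" using pos by simp
    then show ?thesis
      using \<open>dpsi1 ?v ?h = _ + A * c\<^sup>2\<close> unfolding psix md(1,2) by (simp add: algebra_simps)
  qed
  have "(1 + us / c) * Du + (us / (3 * ps) + 1 / (rsL * c)) * Dp + 1 / 2 * (1 + us / c) * w
      = (Dp / (3 * ps) + (Du + w / 2) / c) * (us + c)"
    unfolding p using pos by (simp add: field_simps power2_eq_square)
  also have "\<dots> = (A / 4 * (3 * cL\<^sup>2 + c\<^sup>2) - dpsi1 VL VL') * psi1 VL"
    unfolding main u ..
  finally show "(1 + us / c) * Du + (us / (3 * ps) + 1 / (rsL * c)) * Dp
      = ((rho VL)\<^sup>2 * S' / (8 * cL ^ 3) * (3 * cL\<^sup>2 + c\<^sup>2) - dpsi1 VL VL') * psi1 VL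
        - 1 / 2 * (1 + us / c) * w"
    by (simp add: A_def)
  have prim: "primitive_eqs w ?v (Vt0 StarL) ?h"
    unfolding w_def by (rule primitive_origin) (use adm in auto)
  have "dS1 ?v (Vt0 StarL) = - us * (c * S' / cL)"
    using dS1_transport[OF adm prim] Sx ms by simp
  have "p11 (Vt0 StarL) - c\<^sup>2 * rho (Vt0 StarL) = - us * (c * S' / cL) * rsL ^ 3"
  proof -
    have "dS1 ?v (Vt0 StarL) = (p11 (Vt0 StarL) - c\<^sup>2 * rho (Vt0 StarL)) / rsL ^ 3"
      using ms rho by (simp add: dS1_def cc)
    then show ?thesis
      using \<open>dS1 ?v (Vt0 StarL) = - us * _\<close> pos by (simp add: field_simps)
  qed
  then have "c\<^sup>2 * rho (Vt0 StarL) = p11 (Vt0 StarL) + us * (c * S' / cL) * (rsL * rsL\<^sup>2)"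
    by (simp add: power3_eq_cube power2_eq_square)
  also have "us * (c * S' / cL) * (rsL * rsL\<^sup>2) = (rho VL)\<^sup>2 * S' * rsL * us * (c ^ 3 / cL ^ 3)"
    unfolding r2 using pos by (simp add: field_simps power2_eq_square power3_eq_cube)
  finally show "rho (Vt0 StarL) =
      1 / c\<^sup>2 * (p11 (Vt0 StarL) + (rho VL)\<^sup>2 * S' * rsL * us * (c ^ 3 / cL ^ 3))"
    using pos by (simp add: field_simps)
qed

text \<open>Both equations are the differentiated shock relations, with derivatives along the shock rewritten:
behind the shock through Du and Dp, ahead of it through the data by means of the primitive
equations. The density relation is multiplied by us because the x-derivative of rho is
accessible only through us * rho_x = rho Dp / (3 p) - rho_t, and us may vanish.\<close>

lemma right_equations:
  fixes w Lam Phi1 Phi2 Phi3 H1 H2 H3 :: real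
  defines "w \<equiv> deriv W 0"
  assumes Lam: "Lam = 1 / sqrt (rho VR * (2 * ps + p11 VR))"
    and Phi: "Phi1 = (ps + 2 * p11 VR) / (2 * ps + p11 VR) * Lam"
      "Phi2 = - ((5 * ps + p11 VR) / (4 * ps + 2 * p11 VR)) * Lam"
      "Phi3 = (p11 VR - ps) / (2 * rho VR) * Lam"
    and H: "H1 = 3 * rho VR * p11 VR / (ps + 2 * p11 VR)\<^sup>2"
      "H2 = - (3 * rho VR * ps / (ps + 2 * p11 VR)\<^sup>2)"
      "H3 = (2 * ps + p11 VR) / (ps + 2 * p11 VR)"
  shows "(1 - rsR * (us - \<sigma>R) * Phi1) * Du + ((us - \<sigma>R) / (3 * ps) - Phi1) * Dp
      = (\<sigma>R - u1 VR) * Phi3 * rho VR' + (\<sigma>R - u1 VR - 3 * p11 VR * Phi2 - rho VR * Phi3) * u1 VR'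
        + (- 1 / rho VR + (\<sigma>R - u1 VR) * Phi2) * p11 VR'
        - 1 / 2 * w * (1 - rsR * (us - \<sigma>R) * Phi1)"
    and "(us - \<sigma>R) * rho (Vt0 StarR) + rsR * us * (\<sigma>R - us) * H1 * Du
        + (\<sigma>R * rsR / (3 * ps) - us * H1) * Dp
      = us * ((\<sigma>R - u1 VR) * H2 * p11 VR' + (\<sigma>R - u1 VR) * H3 * rho VR'
        - (rho VR * H3 + 3 * p11 VR * H2) * u1 VR' - 1 / 2 * rsR * (\<sigma>R - us) * w * H1)"
proof -
  have mid: "StarR \<in> middle" by (simp add: middle_def)
  note md = middle_derivatives[OF mid, unfolded middle_states(5), folded w_def]
  have pos: "ps > 0" using middle_states(1)[OF mid] by (simp add: admissible_def)
  have prim: "primitive_eqs w VR (Vt0 Rgt) VR'"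
    using primitive_origin[of Rgt] data_admissible(2) by (simp add: outer_right w_def)
  define dl dr where "dl = Vt0 StarR + \<sigma>R *\<^sub>R Vx0 StarR" and "dr = Vt0 Rgt + \<sigma>R *\<^sub>R VR'"
  note sh = shock_derivatives[OF Lam, folded dl_def dr_def Phi H]
  have r: "u1 dr = - w / 2 - p11 VR' / rho VR + (\<sigma>R - u1 VR) * u1 VR'"
    "p11 dr = - 3 * p11 VR * u1 VR' + (\<sigma>R - u1 VR) * p11 VR'"
    "rho dr = - rho VR * u1 VR' + (\<sigma>R - u1 VR) * rho VR'"
    using prim by (auto simp: primitive_eqs_def dr_def algebra_simps)
  have l: "u1 dl = Du + (us - \<sigma>R) / (3 * ps) * Dp"
    "p11 dl = Dp + rsR * (us - \<sigma>R) * (Du + w / 2)"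
    unfolding dl_def vector_add_component vector_scaleR_component md(1,2,4,5)
    using pos by (auto simp: field_simps)
  have "us * rho dl = us * rho (Vt0 StarR) + \<sigma>R * (us * rho (Vx0 StarR))"
    by (simp add: dl_def algebra_simps)
  also have "us * rho (Vx0 StarR) = rsR / (3 * ps) * Dp - rho (Vt0 StarR)"
    using md(3) by simp
  finally have l3: "us * rho dl = (us - \<sigma>R) * rho (Vt0 StarR) + \<sigma>R * rsR / (3 * ps) * Dp"
    by (simp add: algebra_simps)
  show "(1 - rsR * (us - \<sigma>R) * Phi1) * Du + ((us - \<sigma>R) / (3 * ps) - Phi1) * Dp
      = (\<sigma>R - u1 VR) * Phi3 * rho VR' + (\<sigma>R - u1 VR - 3 * p11 VR * Phi2 - rho VR * Phi3) * u1 VR'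
        + (- 1 / rho VR + (\<sigma>R - u1 VR) * Phi2) * p11 VR'
        - 1 / 2 * w * (1 - rsR * (us - \<sigma>R) * Phi1)"
    using sh(1) unfolding l r by (simp add: algebra_simps)
  have "us * rho dl = us * ((\<sigma>R - u1 VR) * H2 * p11 VR' + (\<sigma>R - u1 VR) * H3 * rho VR'
      - (rho VR * H3 + 3 * p11 VR * H2) * u1 VR' - 1 / 2 * rsR * (\<sigma>R - us) * w * H1)
      - rsR * us * (\<sigma>R - us) * H1 * Du + us * H1 * Dp"
    unfolding sh(2) l r by (simp add: field_simps)
  then show "(us - \<sigma>R) * rho (Vt0 StarR) + rsR * us * (\<sigma>R - us) * H1 * Du
        + (\<sigma>R * rsR / (3 * ps) - us * H1) * Dp
      = us * ((\<sigma>R - u1 VR) * H2 * p11 VR' + (\<sigma>R - u1 VR) * H3 * rho VR'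
        - (rho VR * H3 + 3 * p11 VR * H2) * u1 VR' - 1 / 2 * rsR * (\<sigma>R - us) * w * H1)"
    unfolding l3 by (simp only: left_diff_distrib[of "\<sigma>R * rsR / (3 * ps)"])
qed

end

lemma linear_system_2:
  fixes a1 a2 b1 b2 d1 d2 x y :: real
  assumes "a1 * x + b1 * y = d1" "a2 * x + b2 * y = d2" "a1 * b2 - a2 * b1 \<noteq> 0"
  shows "x = (d1 * b2 - d2 * b1) / (a1 * b2 - a2 * b1)"
    and "y = (d1 * a2 - d2 * a1) / (a2 * b1 - a1 * b2)"
  using assms(3) unfolding assms(1,2)[symmetric] by (auto simp: field_simps)

theorem theorem5p6:
  fixes W :: "real \<Rightarrow> real"
    and VL VL' VR VR' :: "real^6"
    and \<delta> T \<alpha>0 :: real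
    and X sp :: "curve \<Rightarrow> real \<Rightarrow> real"
    and V :: "region \<Rightarrow> real \<times> real \<Rightarrow> real^6"
    and V0 Vx0 Vt0 :: "region \<Rightarrow> real^6"
    and us ps rsL rsR Du Dp \<sigma>R :: real
    and xx tt :: "real \<times> real \<Rightarrow> real"
    and Vh :: "real \<times> real \<Rightarrow> real^6"
    and Wx0 cL cR csL csR psi1L S1L' psi1L' a1 b1 d1 a2 b2 d2 :: real
    and Lam Phi1 Phi2 Phi3 H1 H2 H3 Lrho Lu1 Lp11 LW g_rho g_u1 g_p11 f_R :: real
  assumes grp: "grp_configuration W VL VL' VR VR' \<delta> T X sp V V0 Vx0 Vt0
                  us ps rsL rsR Du Dp \<sigma>R \<alpha>0 xx tt Vh"
    and "Wx0 = deriv W 0"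
    and "cL = sqrt (3 * p11 VL / rho VL)"
    and "csL = sqrt (3 * ps / rsL)"
    and "psi1L = u1 VL + cL"
    and "S1L' = 1 / rho VL ^ 3 * (p11 VL' - cL\<^sup>2 * rho VL')"
    and "psi1L' = u1 VL' + p11 VL' / (rho VL * cL) + (rho VL)\<^sup>2 / (2 * cL) * S1L'"
    and "a1 = 1 + us / csL"
    and "b1 = us / (3 * ps) + 1 / (rsL * csL)"
    and "d1 = ((rho VL)\<^sup>2 * S1L' / (8 * cL ^ 3) * (3 * cL\<^sup>2 + csL\<^sup>2) - psi1L') * psi1L
              - 1 / 2 * (1 + us / csL) * Wx0"
    and "cR = sqrt (3 * p11 VR / rho VR)"
    and "csR = sqrt (3 * ps / rsR)"
    and "Lam = 1 / sqrt (rho VR * (2 * ps + p11 VR))"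
    and "Phi1 = (ps + 2 * p11 VR) / (2 * ps + p11 VR) * Lam"
    and "Phi2 = - ((5 * ps + p11 VR) / (4 * ps + 2 * p11 VR)) * Lam"
    and "Phi3 = (p11 VR - ps) / (2 * rho VR) * Lam"
    and "a2 = 1 - rsR * (us - \<sigma>R) * Phi1"
    and "b2 = (us - \<sigma>R) / (3 * ps) - Phi1"
    and "Lrho = (\<sigma>R - u1 VR) * Phi3"
    and "Lu1 = \<sigma>R - u1 VR - 3 * p11 VR * Phi2 - rho VR * Phi3"
    and "Lp11 = - 1 / rho VR + (\<sigma>R - u1 VR) * Phi2"
    and "LW = 1 - rsR * (us - \<sigma>R) * Phi1"
    and "d2 = Lrho * rho VR' + Lu1 * u1 VR' + Lp11 * p11 VR' - 1 / 2 * Wx0 * LW"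
    and "H1 = 3 * rho VR * p11 VR / (ps + 2 * p11 VR)\<^sup>2"
    and "H2 = - (3 * rho VR * ps / (ps + 2 * p11 VR)\<^sup>2)"
    and "H3 = (2 * ps + p11 VR) / (ps + 2 * p11 VR)"
    and "g_rho = us - \<sigma>R"
    and "g_u1 = rsR * us * (\<sigma>R - us) * H1"
    and "g_p11 = \<sigma>R / csR\<^sup>2 - us * H1"
    and "f_R = (\<sigma>R - u1 VR) * H2 * p11 VR' + (\<sigma>R - u1 VR) * H3 * rho VR'
               - rho VR * (H3 + cR\<^sup>2 * H2) * u1 VR' - 1 / 2 * rsR * (\<sigma>R - us) * Wx0 * H1"
  shows "(a1 * b2 - a2 * b1 \<noteq> 0 \<longrightarrow>
            Du = (d1 * b2 - d2 * b1) / (a1 * b2 - a2 * b1) \<and>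
            Dp = (d1 * a2 - d2 * a1) / (a2 * b1 - a1 * b2))
       \<and> (\<forall>(r, rs) \<in> {(StarL, rsL), (StarR, rsR)}.
            u1 (Vt0 r) = us / (3 * ps) * Dp + Du \<and>
            p11 (Vt0 r) = Dp + rs * us * Du + 1 / 2 * rs * us * Wx0)
       \<and> rho (Vt0 StarL) =
            1 / csL\<^sup>2 * (p11 (Vt0 StarL) + (rho VL)\<^sup>2 * S1L' * rsL * us * (csL ^ 3 / cL ^ 3))
       \<and> g_rho * rho (Vt0 StarR) + g_u1 * Du + g_p11 * Dp = us * f_R"
proof -
  note eqs = assms(2-)
  have pos: "rho VL > 0" "rho VR > 0" "p11 VR > 0" and adm: "admissible VL"
    using grp_configuration.data_admissible[OF grp] by (auto simp: admissible_def)
  have mid: "StarL \<in> middle" "StarR \<in> middle" by (auto simp: middle_def)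
  note ms = grp_configuration.middle_states[OF grp]
  have pos': "ps > 0" "rsL > 0" "rsR > 0"
    using ms(1)[OF mid(1)] ms(1)[OF mid(2)] ms(2,5) by (auto simp: admissible_def)
  have cL: "cL = sound VL" "csL = sound (V0 StarL)"
    using eqs(2,3) ms(1)[OF mid(1)] ms(2) by (auto simp: sound_def)
  have cL2: "cL\<^sup>2 = 3 * p11 VL / rho VL" using sound_sq[OF adm] cL by simp
  have S: "dS1 VL VL' = S1L'" unfolding eqs(5) cL2 by (simp add: dS1_def)
  have psi: "psi1 VL = psi1L" "dpsi1 VL VL' = psi1L'"
    unfolding eqs(4,6) using dpsi1_minus_entropy[OF adm] S cL(1) by (auto simp: psi1_def)
  note left = grp_configuration.left_equations[OF grp, folded cL, unfolded S psi, folded eqs(1)]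
  note right = grp_configuration.right_equations[OF grp eqs(12-15,23-25), folded eqs(1)]
  have R1: "a2 * Du + b2 * Dp = d2"
    unfolding eqs(16-22) by (rule right(1))
  have L1: "a1 * Du + b1 * Dp = d1"
    unfolding eqs(7-9) by (rule left(1))
  have R2: "g_rho * rho (Vt0 StarR) + g_u1 * Du + g_p11 * Dp = us * f_R"
  proof -
    have cR: "rho VR * (H3 + cR\<^sup>2 * H2) = rho VR * H3 + 3 * p11 VR * H2"
      using pos eqs(10) by (simp add: field_simps)
    have csR: "\<sigma>R / csR\<^sup>2 = \<sigma>R * rsR / (3 * ps)"
      using pos' eqs(11) by (simp add: field_simps)
    show ?thesis unfolding eqs(26-29) cR csR by (rule right(2))
  qed
  note mt = grp_configuration.middle_derivatives(4,5)[OF grp, folded eqs(1)]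
  have "\<forall>(r, rs) \<in> {(StarL, rsL), (StarR, rsR)}.
      u1 (Vt0 r) = us / (3 * ps) * Dp + Du \<and>
      p11 (Vt0 r) = Dp + rs * us * Du + 1 / 2 * rs * us * Wx0"
    using mt[OF mid(1), unfolded ms(2)] mt[OF mid(2), unfolded ms(5)] by simp
  then show ?thesis using linear_system_2[OF L1 R1] left(2) R2 by (intro conjI impI) assumption+
qed

end
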